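(* Let $N\ge1$, $\alpha>-1$, let $\phi:\mathbb{B}_N\to\mathbb{B}_N$ be holomorphic, and let $\psi$ be an Orlicz function satisfying the $\nabla_0$-Condition. Assume that $C_\phi$ is bounded from $A^\psi_\beta(\mathbb{B}_N)$ into itself for some $-1<\beta<\alpha$. Then $C_\phi$ is compact from $A^\psi_\alpha(\mathbb{B}_N)$ into itself if and only if $$\lim_{|z|\to1}\frac{\psi^{-1}\big(1/(1-|\phi(z)|)^{N+\alpha+1}\big)}{\psi^{-1}\big(1/(1-|z|)^{N+\alpha+1}\big)}=0.$$
   Context: $\mathbb{B}_N$ is the open unit ball of $\mathbb{C}^N$; for $\alpha>-1$, $dv_\alpha(z)=c_\alpha(1-|z|^2)^\alpha dv(z)$ is the weighted volume measure normalized to be a probability measure. $C_\phi f=f\circ\phi$. An Orlicz function is a strictly convex $\psi:[0,\infty)\to[0,\infty)$ with $\psi(0)=0$, continuous at $0$, and $\psi(x)/x\to\infty$; $\psi^{-1}$ denotes its inverse function. $\psi$ satisfies the $\nabla_0$-Condition if for every $B>1$ there exists $C_B\ge1$ such that $\frac{\psi(Bx)}{\psi(x)}\le\frac{\psi(C_BBy)}{\psi(y)}$ for all $x\le y$ with $x$ large enough. The weighted Bergman–Orlicz space $A^\psi_\alpha(\mathbb{B}_N)$ is the space of holomorphic $f$ on $\mathbb{B}_N$ with $\int_{\mathbb{B}_N}\psi(|f|/C)\,dv_\alpha<\infty$ for some $C>0$, with Luxemburg norm $\inf\{C>0:\int_{\mathbb{B}_N}\psi(|f|/C)\,dv_\alpha\le1\}$.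 *)

theory Defs
  imports "HOL-Analysis.Analysis"
begin

text \<open>Points of the unit ball of C^N are modelled as complex^'n, N = CARD('n) >= 1.
  The norm on complex^'n is the Euclidean norm |z|.\<close>

definition unit_ball :: "(complex ^ 'n) set" where
  "unit_ball = ball 0 1"

text \<open>Holomorphy in several complex variables: complex Frechet differentiability,
  i.e. real Frechet differentiability with a complex-linear derivative.\<close>

definition holo_fun_on :: "(complex ^ 'n) set \<Rightarrow> (complex ^ 'n \<Rightarrow> complex) \<Rightarrow> bool" where
  "holo_fun_on U f \<longleftrightarrow>
     (\<forall>z\<in>U. \<exists>L. (f has_derivative L) (at z) \<and> (\<forall>c v. L (c *s v) = c * L v))"

definition holo_map_on :: "(complex ^ 'n) set \<Rightarrow> (complex ^ 'n \<Rightarrow> complex ^ 'm) \<Rightarrow> bool" where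
  "holo_map_on U \<phi> \<longleftrightarrow> (\<forall>j. holo_fun_on U (\<lambda>z. \<phi> z $ j))"

definition orlicz_fun :: "(real \<Rightarrow> real) \<Rightarrow> bool" where
  "orlicz_fun \<psi> \<longleftrightarrow>
     \<psi> 0 = 0 \<and> (\<forall>x\<ge>0. \<psi> x \<ge> 0) \<and>
     (\<forall>x y t. 0 \<le> x \<longrightarrow> 0 \<le> y \<longrightarrow> x \<noteq> y \<longrightarrow> 0 < t \<longrightarrow> t < 1 \<longrightarrow>
        \<psi> ((1 - t) * x + t * y) < (1 - t) * \<psi> x + t * \<psi> y) \<and>
     continuous (at_right 0) \<psi> \<and>
     filterlim (\<lambda>x. \<psi> x / x) at_top at_top"

definition orlicz_inv :: "(real \<Rightarrow> real) \<Rightarrow> real \<Rightarrow> real" where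
  "orlicz_inv \<psi> y = (THE x. 0 \<le> x \<and> \<psi> x = y)"

definition nabla0 :: "(real \<Rightarrow> real) \<Rightarrow> bool" where
  "nabla0 \<psi> \<longleftrightarrow>
     (\<forall>B>1. \<exists>C\<ge>1. \<exists>x0. \<forall>x y. x0 \<le> x \<longrightarrow> x \<le> y \<longrightarrow>
        \<psi> (B * x) / \<psi> x \<le> \<psi> (C * B * y) / \<psi> y)"

definition bweight :: "real \<Rightarrow> complex ^ 'n \<Rightarrow> real" where
  "bweight \<alpha> z = indicator unit_ball z * (1 - (norm z)\<^sup>2) powr \<alpha>"

definition dv :: "real \<Rightarrow> (complex ^ 'n) measure" where
  "dv \<alpha> = density lborel
     (\<lambda>z. ennreal (bweight \<alpha> z) / (\<integral>\<^sup>+ w. ennreal (bweight \<alpha> (w :: complex ^ 'n)) \<partial>lborel))"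

definition orlicz_mod :: "(real \<Rightarrow> real) \<Rightarrow> real \<Rightarrow> (complex ^ 'n \<Rightarrow> complex) \<Rightarrow> real \<Rightarrow> ennreal" where
  "orlicz_mod \<psi> \<alpha> f C = (\<integral>\<^sup>+ z. ennreal (\<psi> (norm (f z) / C)) \<partial>dv \<alpha>)"

definition bergman_orlicz :: "(real \<Rightarrow> real) \<Rightarrow> real \<Rightarrow> (complex ^ 'n \<Rightarrow> complex) set" where
  "bergman_orlicz \<psi> \<alpha> =
     {f. holo_fun_on unit_ball f \<and> (\<exists>C>0. orlicz_mod \<psi> \<alpha> f C < \<infinity>)}"

definition lux_norm :: "(real \<Rightarrow> real) \<Rightarrow> real \<Rightarrow> (complex ^ 'n \<Rightarrow> complex) \<Rightarrow> real" where
  "lux_norm \<psi> \<alpha> f = Inf {C. C > 0 \<and> orlicz_mod \<psi> \<alpha> f C \<le> 1}"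

definition comp_op :: "(complex ^ 'n \<Rightarrow> complex ^ 'n) \<Rightarrow> (complex ^ 'n \<Rightarrow> complex) \<Rightarrow> (complex ^ 'n \<Rightarrow> complex)" where
  "comp_op \<phi> f = f \<circ> \<phi>"

definition comp_bounded :: "(real \<Rightarrow> real) \<Rightarrow> real \<Rightarrow> (complex ^ 'n \<Rightarrow> complex ^ 'n) \<Rightarrow> bool" where
  "comp_bounded \<psi> \<alpha> \<phi> \<longleftrightarrow>
     (\<forall>f\<in>bergman_orlicz \<psi> \<alpha>. comp_op \<phi> f \<in> bergman_orlicz \<psi> \<alpha>) \<and>
     (\<exists>M. \<forall>f\<in>bergman_orlicz \<psi> \<alpha>. lux_norm \<psi> \<alpha> (comp_op \<phi> f) \<le> M * lux_norm \<psi> \<alpha> f)"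

text \<open>Compactness: C_phi maps the space into itself and the image of every norm-bounded
  sequence has a subsequence converging in the Luxemburg norm to an element of the space
  (equivalently, the image of the unit ball is relatively compact; the space is complete).\<close>

definition comp_compact :: "(real \<Rightarrow> real) \<Rightarrow> real \<Rightarrow> (complex ^ 'n \<Rightarrow> complex ^ 'n) \<Rightarrow> bool" where
  "comp_compact \<psi> \<alpha> \<phi> \<longleftrightarrow>
     (\<forall>f\<in>bergman_orlicz \<psi> \<alpha>. comp_op \<phi> f \<in> bergman_orlicz \<psi> \<alpha>) \<and>
     (\<forall>fs :: nat \<Rightarrow> complex ^ 'n \<Rightarrow> complex. (\<forall>k. fs k \<in> bergman_orlicz \<psi> \<alpha>) \<longrightarrow> bounded (range (\<lambda>k. lux_norm \<psi> \<alpha> (fs k))) \<longrightarrow>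
        (\<exists>r g. strict_mono r \<and> g \<in> bergman_orlicz \<psi> \<alpha> \<and>
           (\<lambda>k. lux_norm \<psi> \<alpha> (\<lambda>z. comp_op \<phi> (fs (r k)) z - g z)) \<longlonglongrightarrow> 0))"

end

theory Submission
  imports Defs "HOL-Complex_Analysis.Great_Picard"
begin

text \<open>
  Necessity is the standard test function argument: for \<open>a = \<phi> z\<close> the functions
  \<open>gauge \<alpha> a * ((1 - |a|) / (1 - <w, a>)) ^ p\<close> are bounded in the space and tend to \<open>0\<close> locally
  uniformly as \<open>|a| \<rightarrow> 1\<close>, while point evaluation at \<open>z\<close> has norm comparable to \<open>gauge \<alpha> z\<close>.

  For sufficiency, the same test functions turn boundedness on the space of weight \<open>\<beta>\<close> into a
  Carleson-type bound for the pull-back measure on the regions \<open>|1 - <w, a>| < 24 (1 - |a|)\<close>. The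
  limit condition gives the extra decay of \<open>(1 - |z|) powr (\<alpha> - \<beta>)\<close>, and the nabla-zero condition
  makes this product absorb every constant inside \<open>\<psi>\<close>. Since \<open>\<psi> |f|\<close> is plurisubharmonic, its
  value at \<open>\<phi> z\<close> is dominated by its mean over a nonisotropic neighbourhood, and exchanging the
  order of integration shows that the part of the modular of \<open>f \<circ> \<phi>\<close> near the boundary is
  uniformly small; the rest is controlled by Montel's theorem.

  No automorphisms, rotations to a coordinate axis or determinants are needed: the neighbourhoods
  are invariant under multiplication by unimodular scalars, which is enough for the sub-mean value
  property, and their volumes are estimated by packing and covering with translates.
\<close>

section \<open>The complex inner product and Orlicz functions\<close>

text \<open>There is no doubling condition, so a constant inside \<open>\<psi>\<close> cannot in
  general be moved outside at the cost of a bounded factor; convexity gives only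
  \<open>\<psi> (c * x) \<le> c * \<psi> x\<close> for \<open>0 \<le> c \<le> 1\<close>. Constants
  therefore travel inside \<open>\<psi>\<close> (as \<open>A\<close>, \<open>A1\<close>,
  \<open>A2\<close>, \<open>B\<close>) until they can be absorbed. Put
  \<open>\<theta> = (N + \<beta> + 1) / (N + \<alpha> + 1)\<close>,
  \<open>u = gauge \<alpha> \<zeta>\<close> and \<open>v = gauge \<beta> \<zeta>\<close>, so that
  \<open>\<psi> v = \<psi> u powr \<theta>\<close>. Up to constants, the size of the kernel, the
  decay of the weight and the Carleson bound multiply to \<open>\<psi> u * \<psi> u powr - (1 -
  \<theta>) * \<psi> u powr - \<theta> = 1\<close>: the powers balance exactly and no decay is left
  to pay for the constants. The payment comes from the limit condition. A quotient below
  \<open>1 / B\<close> improves the weight factor to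
  \<open>\<psi> (B * u) powr - (1 - \<theta>)\<close> with \<open>B\<close> as large as desired, and
  the nabla-zero condition lets this gain beat the losses in \<open>\<psi> (A2 * u)\<close> and
  \<open>\<psi> (v / A)\<close>. The gap between \<open>\<beta>\<close> and \<open>\<alpha>\<close>
  is essential to this: for equal weights \<open>1 - \<theta>\<close> would be \<open>0\<close> and
  the gain would disappear.\<close>

definition cinner :: "complex ^ 'n \<Rightarrow> complex ^ 'n \<Rightarrow> complex" where
  "cinner v w = (\<Sum>j\<in>UNIV. v $ j * cnj (w $ j))"

lemma Re_cinner: "Re (cinner v w) = v \<bullet> w"
  by (simp add: cinner_def inner_vec_def inner_complex_def)

lemma cinner_add_left: "cinner (u + v) w = cinner u w + cinner v w"
  by (simp add: cinner_def sum.distrib algebra_simps)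

lemma cinner_diff_left: "cinner (u - v) w = cinner u w - cinner v w"
  by (simp add: cinner_def sum_subtractf algebra_simps)

lemma cinner_smult_left: "cinner (c *s v) w = c * cinner v w"
  by (simp add: cinner_def sum_distrib_left algebra_simps)

lemma cinner_scaleR_left: "cinner (r *\<^sub>R v) w = of_real r * cinner v w"
  unfolding cinner_def sum_distrib_left
  by (intro sum.cong) (simp_all add: scaleR_conv_of_real[where 'a=complex])

lemma cinner_scaleR_right: "cinner v (r *\<^sub>R w) = of_real r * cinner v w"
  unfolding cinner_def sum_distrib_left
  by (intro sum.cong) (simp_all add: scaleR_conv_of_real[where 'a=complex])

lemma cinner_zero [simp]: "cinner v 0 = 0" "cinner 0 v = 0"
  by (simp_all add: cinner_def)

lemma cnj_cinner: "cnj (cinner v w) = cinner w v"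
  by (simp add: cinner_def algebra_simps)

lemma cinner_self: "cinner v v = complex_of_real ((norm v)\<^sup>2)"
proof -
  have "Im (cinner v v) = 0"
    using cnj_cinner[of v v] by (metis Im_complex_of_real cnj.sel(2) complex_is_Real_iff Reals_cnj_iff)
  then show ?thesis
    using Re_cinner[of v v] by (simp add: complex_eq_iff power2_norm_eq_inner)
qed

lemma norm_smult [simp]: "norm (c *s v) = norm c * norm (v :: complex ^ 'n)"
  by (simp add: norm_vec_def norm_mult L2_set_right_distrib)

text \<open>Multiplying \<open>v\<close> by a scalar of modulus at most one makes the product real
  and nonnegative, which leaves the real Cauchy-Schwarz inequality.\<close>

lemma norm_cinner_le: "norm (cinner v w) \<le> norm v * norm w"
proof -
  define c where "c = cnj (sgn (cinner v w))"
  have "c * cinner v w = complex_of_real (norm (cinner v w))"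
    using complex_norm_square[of "cinner v w"]
    by (cases "cinner v w = 0") (auto simp: c_def sgn_eq power2_eq_square field_simps)
  then have "norm (cinner v w) = Re (cinner (c *s v) w)"
    by (simp add: cinner_smult_left)
  also have "\<dots> \<le> norm (c *s v) * norm w"
    unfolding Re_cinner by (rule norm_cauchy_schwarz)
  also have "\<dots> \<le> norm v * norm w"
    by (intro mult_right_mono) (auto simp: c_def norm_sgn mult_left_le_one_le)
  finally show ?thesis .
qed

lemma bounded_linear_cinner: "bounded_linear (\<lambda>v. cinner v w)"
  by (rule bounded_linear_intro[where K="norm w"])
     (auto simp: cinner_add_left cinner_scaleR_left scaleR_conv_of_real[where 'a=complex] norm_cinner_le)

lemma continuous_on_cinner [continuous_intros]:
  "continuous_on S f \<Longrightarrow> continuous_on S g \<Longrightarrow> continuous_on S (\<lambda>x. cinner (f x) (g x))"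
  unfolding cinner_def by (intro continuous_intros)

lemma continuous_on_smult [continuous_intros]:
  fixes g :: "'a::topological_space \<Rightarrow> complex ^ 'n"
  shows "continuous_on S f \<Longrightarrow> continuous_on S g \<Longrightarrow> continuous_on S (\<lambda>x. f x *s g x)"
  unfolding vector_scalar_mult_def by (intro continuous_on_vec_lambda continuous_intros)

section \<open>Orlicz functions: monotonicity, inverse function and supporting lines\<close>

locale orlicz =
  fixes \<psi> :: "real \<Rightarrow> real"
  assumes orlicz: "orlicz_fun \<psi>"
begin

lemma zero [simp]: "\<psi> 0 = 0"
  and nonneg [simp]: "0 \<le> x \<Longrightarrow> 0 \<le> \<psi> x"
  and strict_convex: "\<lbrakk>0 \<le> x; 0 \<le> y; x \<noteq> y; 0 < t; t < 1\<rbrakk> \<Longrightarrow> \<psi> ((1 - t) * x + t * y) < (1 - t) * \<psi> x + t * \<psi> y"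
  and cont0: "continuous (at_right 0) \<psi>"
  and superlinear: "filterlim (\<lambda>x. \<psi> x / x) at_top at_top"
  using orlicz unfolding orlicz_fun_def by auto

lemma convex: "convex_on {0..} \<psi>"
proof (rule convex_onI)
  fix t x y :: real assume "0 < t" "t < 1" "x \<in> {0..}" "y \<in> {0..}"
  then show "\<psi> ((1 - t) *\<^sub>R x + t *\<^sub>R y) \<le> (1 - t) * \<psi> x + t * \<psi> y"
    using strict_convex[of x y t] by (cases "x = y") (auto simp: algebra_simps intro: less_imp_le)
qed auto

text \<open>Convexity on the segment from \<open>0\<close>, where \<open>\<psi>\<close> vanishes.
  Together with \<open>scale_ge\<close> this is the only homogeneity available without growth
  conditions.\<close>

lemma scale_le: "0 \<le> x \<Longrightarrow> 0 \<le> c \<Longrightarrow> c \<le> 1 \<Longrightarrow> \<psi> (c * x) \<le> c * \<psi> x"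
  using convex_onD[OF convex, of c 0 x] by auto

lemma scale_ge: "0 \<le> x \<Longrightarrow> 1 \<le> c \<Longrightarrow> c * \<psi> x \<le> \<psi> (c * x)"
  using scale_le[of "c * x" "1 / c"] by (auto simp: field_simps)

lemma pos: "0 < x \<Longrightarrow> 0 < \<psi> x"
  using strict_convex[of 0 "x" "1/2"] nonneg[of "x/2"] by (auto simp del: nonneg)

lemma strict_mono: assumes "0 \<le> x" "x < y" shows "\<psi> x < \<psi> y"
proof -
  have "\<psi> (x / y * y) \<le> x / y * \<psi> y"
    using assms by (intro scale_le) auto
  also have "\<dots> < 1 * \<psi> y"
    using assms pos[of y] by (intro mult_strict_right_mono) auto
  finally show ?thesis using assms by auto
qed

lemma mono: "0 \<le> x \<Longrightarrow> x \<le> y \<Longrightarrow> \<psi> x \<le> \<psi> y"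
  using strict_mono[of x y] by (cases "x = y") auto

lemma less_iff: "0 \<le> x \<Longrightarrow> 0 \<le> y \<Longrightarrow> \<psi> x < \<psi> y \<longleftrightarrow> x < y"
  by (metis linorder_not_le mono strict_mono)

lemma le_iff: "0 \<le> x \<Longrightarrow> 0 \<le> y \<Longrightarrow> \<psi> x \<le> \<psi> y \<longleftrightarrow> x \<le> y"
  by (meson less_iff linorder_not_le)

text \<open>A convex function is continuous on the open half-line; at the endpoint continuity is
  part of the definition of an Orlicz function.\<close>

lemma continuous: "continuous_on {0..} \<psi>"
proof -
  have 1: "continuous_on {0<..} \<psi>"
    by (rule convex_on_continuous) (auto intro: convex_on_subset[OF convex])
  show ?thesis
    unfolding continuous_on_eq_continuous_within
  proof
    fix x :: real assume "x \<in> {0..}"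
    show "continuous (at x within {0..}) \<psi>"
    proof (cases "x = 0")
      case True
      then show ?thesis
        using cont0 by (simp add: continuous_within at_within_Ici_at_right)
    next
      case False
      with \<open>x \<in> {0..}\<close> have "isCont \<psi> x"
        using 1 continuous_on_interior[of "{0<..}" \<psi> x] by (auto simp: interior_open)
      then show ?thesis by (rule continuous_at_imp_continuous_at_within)
    qed
  qed
qed

lemma superlinearD: obtains x0 where "x0 > 0" "\<And>x. x \<ge> x0 \<Longrightarrow> K * x \<le> \<psi> x"
proof -
  obtain N where N: "\<And>x. x \<ge> N \<Longrightarrow> K \<le> \<psi> x / x"
    using superlinear unfolding filterlim_at_top eventually_at_top_linorder by meson
  show ?thesis
  proof (rule that[of "max 1 N"])
    show "K * x \<le> \<psi> x" if "max 1 N \<le> x" for x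
      using N[of x] that by (auto simp: field_simps)
  qed auto
qed

text \<open>Justifies the description operator in \<open>orlicz_inv\<close>: superlinear growth
  supplies a point where \<open>\<psi>\<close> exceeds \<open>y\<close>, and strict monotonicity
  gives uniqueness.\<close>

lemma ex1_inv: assumes "0 \<le> y" shows "\<exists>!x. 0 \<le> x \<and> \<psi> x = y"
proof -
  obtain x0 where x0: "x0 > 0" "\<And>x. x \<ge> x0 \<Longrightarrow> 1 * x \<le> \<psi> x"
    using superlinearD[of 1] by metis
  have "\<exists>x\<ge>0. x \<le> max x0 y \<and> \<psi> x = y"
    using x0(1) x0(2)[of "max x0 y"] assms
    by (intro IVT' continuous_on_subset[OF continuous]) auto
  then show ?thesis
    by (metis less_iff linorder_neq_iff less_irrefl)
qed

abbreviation "\<psi>i \<equiv> orlicz_inv \<psi>"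

lemma inv_nonneg: "0 \<le> y \<Longrightarrow> 0 \<le> \<psi>i y" and inv_right: "0 \<le> y \<Longrightarrow> \<psi> (\<psi>i y) = y"
  using theI'[OF ex1_inv, of y] unfolding orlicz_inv_def by auto

lemma inv_pos: "0 < y \<Longrightarrow> 0 < \<psi>i y"
  using inv_nonneg[of y] inv_right[of y] by (cases "\<psi>i y = 0") auto

lemma le_inv_iff: "0 \<le> x \<Longrightarrow> 0 \<le> y \<Longrightarrow> x \<le> \<psi>i y \<longleftrightarrow> \<psi> x \<le> y"
  using le_iff[of x "\<psi>i y"] inv_nonneg inv_right by auto

lemma inv_le_iff: "0 \<le> x \<Longrightarrow> 0 \<le> y \<Longrightarrow> \<psi>i y \<le> x \<longleftrightarrow> y \<le> \<psi> x"
  using le_iff[of "\<psi>i y" x] inv_nonneg inv_right by auto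

lemma inv_mono: "0 \<le> x \<Longrightarrow> x \<le> y \<Longrightarrow> \<psi>i x \<le> \<psi>i y"
  by (simp add: inv_le_iff inv_nonneg inv_right)

text \<open>The inverse of a convex function vanishing at \<open>0\<close> is concave, so constants
  may leave \<open>\<psi>i\<close> although they may not leave \<open>\<psi>\<close>.\<close>

lemma inv_scale: assumes "0 \<le> y" "1 \<le> c" shows "\<psi>i (c * y) \<le> c * \<psi>i y"
  using assms scale_ge[of "\<psi>i y" c] by (simp add: inv_le_iff inv_nonneg inv_right)

text \<open>Supplies the line for Jensen's inequality in \<open>circle_submean\<close>. Its slope
  must be nonnegative because there only a lower bound for the mean of the argument is
  known.\<close>

lemma support: assumes "0 \<le> x" obtains s where "0 \<le> s" "\<And>y. 0 \<le> y \<Longrightarrow> \<psi> x + s * (y - x) \<le> \<psi> y"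
proof (cases "x = 0")
  case True
  then show ?thesis by (intro that[of 0]) auto
next
  case False
  \<comment> \<open>The left derivative at \<open>x\<close>, as a supremum of left slopes. It needs
    points to the left of \<open>x\<close>, hence the separate case \<open>x = 0\<close>.\<close>
  define s where "s = (SUP y\<in>{0..<x}. (\<psi> x - \<psi> y) / (x - y))"
  have sl: "(\<psi> x - \<psi> y) / (x - y) \<le> (\<psi> z - \<psi> x) / (z - x)" if "0 \<le> y" "y < x" "x < z" for y z
  proof -
    have "(\<psi> y - \<psi> x) / (y - x) \<le> (\<psi> z - \<psi> x) / (z - x)"
      using convex_on_slope_le[OF convex, of y z x] that
      by (auto simp: minus_divide_divide[symmetric, of "\<psi> x - \<psi> z"])
    then show ?thesis by (metis minus_diff_eq minus_divide_divide)
  qed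
  have bdd: "bdd_above ((\<lambda>y. (\<psi> x - \<psi> y) / (x - y)) ` {0..<x})"
    using sl[of _ "x + 1"] by (auto intro!: bdd_aboveI[of _ "(\<psi> (x + 1) - \<psi> x) / (x + 1 - x)"])
  have s1: "(\<psi> x - \<psi> y) / (x - y) \<le> s" if "0 \<le> y" "y < x" for y
    unfolding s_def using that bdd by (intro cSUP_upper) auto
  have s2: "s \<le> (\<psi> z - \<psi> x) / (z - x)" if "x < z" for z
    unfolding s_def using that sl False assms by (intro cSUP_least) auto
  show ?thesis
  proof (rule that[of s])
    show "0 \<le> s"
      using s1[of 0] False assms nonneg[of x] by (metis divide_nonneg_nonneg diff_ge_0_iff_ge diff_zero less_eq_real_def order_trans zero)
    fix y :: real assume "0 \<le> y"
    then show "\<psi> x + s * (y - x) \<le> \<psi> y"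
      using s1[of y] s2[of y] assms by (cases y x rule: linorder_cases) (auto simp: field_simps)
  qed
qed

text \<open>The values of \<open>\<psi>\<close> on negative numbers are arbitrary; \<open>\<psi>p\<close> is continuous on the whole line.\<close>

definition \<psi>p :: "real \<Rightarrow> real" where "\<psi>p x = \<psi> (max 0 x)"

lemma continuous_p: "continuous_on S \<psi>p"
  unfolding \<psi>p_def by (rule continuous_on_compose2[OF continuous]) (auto intro!: continuous_intros)

lemma measurable_p [measurable]: "\<psi>p \<in> borel_measurable borel"
  by (rule borel_measurable_continuous_onI[OF continuous_p])

lemma p_eq: "0 \<le> x \<Longrightarrow> \<psi>p x = \<psi> x"
  by (simp add: \<psi>p_def)

end

section \<open>Invariance, packing and covering for Lebesgue measure\<close>

lemma nn_integral_lborel_translate: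
  fixes f :: "'a::euclidean_space \<Rightarrow> ennreal"
  assumes [measurable]: "f \<in> borel_measurable borel"
  shows "(\<integral>\<^sup>+x. f (a + x) \<partial>lborel) = (\<integral>\<^sup>+x. f x \<partial>lborel)"
proof -
  have "(\<integral>\<^sup>+x. f x \<partial>lborel) = (\<integral>\<^sup>+x. f x \<partial>distr lborel borel ((+) a))"
    by (simp add: lborel_distr_plus)
  also have "\<dots> = (\<integral>\<^sup>+x. f (a + x) \<partial>lborel)"
    by (subst nn_integral_distr) auto
  finally show ?thesis ..
qed

lemma nn_integral_lborel_uminus:
  fixes f :: "'a::euclidean_space \<Rightarrow> ennreal"
  assumes [measurable]: "f \<in> borel_measurable borel"
  shows "(\<integral>\<^sup>+x. f (- x) \<partial>lborel) = (\<integral>\<^sup>+x. f x \<partial>lborel)"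
proof -
  have "(\<integral>\<^sup>+x. f x \<partial>lborel) = (\<integral>\<^sup>+x. f x \<partial>distr lborel borel uminus)"
    using lborel_affine[of "-1" "0 :: 'a"] by (simp add: density_1)
  also have "\<dots> = (\<integral>\<^sup>+x. f (- x) \<partial>lborel)"
    by (subst nn_integral_distr) auto
  finally show ?thesis ..
qed

text \<open>Both sides are translation-invariant integrals, hence proportional by Fubini; the unit ball
  fixes the constant.\<close>

lemma nn_integral_lborel_isometry:
  fixes f :: "'a::euclidean_space \<Rightarrow> ennreal" and R :: "'a \<Rightarrow> 'a"
  assumes [measurable]: "f \<in> borel_measurable borel"
    and lin: "linear R" and norm: "\<And>x. norm (R x) = norm x"
  shows "(\<integral>\<^sup>+x. f (R x) \<partial>lborel) = (\<integral>\<^sup>+x. f x \<partial>lborel)"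
proof -
  have [measurable]: "R \<in> borel_measurable borel"
    using lin by (intro borel_measurable_continuous_onI linear_continuous_on)
      (simp add: linear_conv_bounded_linear[symmetric])
  have "inj R" using lin norm by (metis linear_injective_0 norm_eq_zero)
  then have "surj R" using linear_injective_imp_surjective[of R] lin by blast
  \<comment> \<open>A radial function is invariant under \<open>R\<close>, so it can serve as a
    common weight on both sides.\<close>
  define g :: "'a \<Rightarrow> ennreal" where "g = indicator (ball 0 1)"
  have [measurable]: "g \<in> borel_measurable borel" unfolding g_def by (rule borel_measurable_indicator) simp
  have gR: "g (R x) = g x" for x by (simp add: g_def indicator_def norm)
  have "(\<integral>\<^sup>+x. f (R x) \<partial>lborel) * (\<integral>\<^sup>+y. g y \<partial>lborel)
      = (\<integral>\<^sup>+x. f (R x) * (\<integral>\<^sup>+y. g (R x + y) \<partial>lborel) \<partial>lborel)"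
    by (simp add: nn_integral_lborel_translate nn_integral_multc)
  also have "\<dots> = (\<integral>\<^sup>+x. (\<integral>\<^sup>+y. f (R x) * g (R x + y) \<partial>lborel) \<partial>lborel)"
    by (intro nn_integral_cong nn_integral_cmult[symmetric]) auto
  also have "\<dots> = (\<integral>\<^sup>+y. (\<integral>\<^sup>+x. f (R x) * g (R x + y) \<partial>lborel) \<partial>lborel)"
    by (rule lborel_pair.Fubini') measurable
  also have "\<dots> = (\<integral>\<^sup>+y. (\<integral>\<^sup>+x. f (R x - y) * g (R x) \<partial>lborel) \<partial>lborel)"
  proof (rule nn_integral_cong)
    fix y
    \<comment> \<open>Translating \<open>x\<close> by a preimage of \<open>- y\<close> moves the
      shift from the argument of \<open>g\<close> to that of \<open>f\<close>.\<close>
    obtain z where z: "R z = - y" using \<open>surj R\<close> by (metis surjD)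
    show "(\<integral>\<^sup>+x. f (R x) * g (R x + y) \<partial>lborel) = (\<integral>\<^sup>+x. f (R x - y) * g (R x) \<partial>lborel)"
      using nn_integral_lborel_translate[of "\<lambda>x. f (R x) * g (R x + y)" z]
      by (simp add: linear_add[OF lin] z)
  qed
  also have "\<dots> = (\<integral>\<^sup>+x. (\<integral>\<^sup>+y. f (R x - y) * g (R x) \<partial>lborel) \<partial>lborel)"
    by (rule lborel_pair.Fubini') measurable
  also have "\<dots> = (\<integral>\<^sup>+x. (\<integral>\<^sup>+y. f y \<partial>lborel) * g (R x) \<partial>lborel)"
  proof (rule nn_integral_cong)
    fix x
    have "(\<integral>\<^sup>+y. f (R x - y) \<partial>lborel) = (\<integral>\<^sup>+y. f y \<partial>lborel)"
      using nn_integral_lborel_uminus[of "\<lambda>y. f (R x + y)"] nn_integral_lborel_translate[of f "R x"] by simp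
    then show "(\<integral>\<^sup>+y. f (R x - y) * g (R x) \<partial>lborel) = (\<integral>\<^sup>+y. f y \<partial>lborel) * g (R x)"
      by (subst nn_integral_multc) auto
  qed
  also have "\<dots> = (\<integral>\<^sup>+y. f y \<partial>lborel) * (\<integral>\<^sup>+x. g x \<partial>lborel)"
    unfolding gR by (rule nn_integral_cmult) auto
  finally have *: "(\<integral>\<^sup>+x. f (R x) \<partial>lborel) * emeasure lborel (ball (0 :: 'a) 1)
      = (\<integral>\<^sup>+x. f x \<partial>lborel) * emeasure lborel (ball (0 :: 'a) 1)"
    by (simp add: g_def)
  have "emeasure lborel (ball (0 :: 'a) 1) \<noteq> 0"
    by (simp add: emeasure_ball unit_ball_vol_pos ennreal_eq_0_iff not_le)
  moreover have "emeasure lborel (ball (0 :: 'a) 1) \<noteq> \<infinity>"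
    using emeasure_lborel_ball_finite[of "0 :: 'a" 1] by auto
  ultimately show ?thesis using * by (auto simp: mult.commute[of _ "emeasure lborel _"] ennreal_mult_cancel_left)
qed

lemma linear_smult: "linear ((*s) c :: complex ^ 'n \<Rightarrow> _)"
  by (rule linearI) (simp_all add: vec_eq_iff algebra_simps)

lemma nn_integral_lborel_rotate:
  fixes f :: "complex ^ 'n \<Rightarrow> ennreal"
  assumes "f \<in> borel_measurable borel" "norm c = 1"
  shows "(\<integral>\<^sup>+x. f (c *s x) \<partial>lborel) = (\<integral>\<^sup>+x. f x \<partial>lborel)"
  using assms by (intro nn_integral_lborel_isometry linear_smult) auto

lemma emeasure_lborel_translate:
  fixes A :: "'a::euclidean_space set"
  assumes [measurable]: "A \<in> sets borel"
  shows "emeasure lborel {x. a + x \<in> A} = emeasure lborel A"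
  using nn_integral_lborel_translate[of "indicator A" a]
  by (simp add: nn_integral_indicator[symmetric] indicator_def del: nn_integral_indicator)

lemma emeasure_lborel_scale:
  fixes A :: "'a::euclidean_space set"
  assumes [measurable]: "A \<in> sets borel" and "r > 0"
  shows "emeasure lborel {x. x /\<^sub>R r \<in> A} = ennreal (r ^ DIM('a)) * emeasure lborel A"
proof -
  have [measurable]: "{x. x /\<^sub>R r \<in> A} \<in> sets borel" by measurable
  have "emeasure lborel {x. x /\<^sub>R r \<in> A}
      = emeasure (density (distr lborel borel (\<lambda>x. 0 + r *\<^sub>R x)) (\<lambda>_. ennreal (\<bar>r\<bar> ^ DIM('a)))) {x. x /\<^sub>R r \<in> A}"
    using lborel_affine[of r "0 :: 'a"] \<open>r > 0\<close> by simp
  also have "\<dots> = ennreal (r ^ DIM('a)) * emeasure (distr lborel borel (\<lambda>x :: 'a. 0 + r *\<^sub>R x)) {x. x /\<^sub>R r \<in> A}"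
    using \<open>r > 0\<close> by (subst emeasure_density) (auto simp: nn_integral_cmult)
  also have "emeasure (distr lborel borel (\<lambda>x :: 'a. 0 + r *\<^sub>R x)) {x. x /\<^sub>R r \<in> A} = emeasure lborel A"
    using \<open>r > 0\<close> by (subst emeasure_distr) auto
  finally show ?thesis .
qed

lemma emeasure_packing:
  assumes "finite I" "\<And>i. i \<in> I \<Longrightarrow> A i \<in> sets M" "disjoint_family_on A I" "B \<in> sets M"
    and "\<And>i. i \<in> I \<Longrightarrow> A i \<subseteq> B" "\<And>i. i \<in> I \<Longrightarrow> m \<le> emeasure M (A i)"
  shows "of_nat (card I) * m \<le> emeasure M B"
proof -
  have "of_nat (card I) * m \<le> (\<Sum>i\<in>I. emeasure M (A i))"
    using sum_bounded_below[of I m "\<lambda>i. emeasure M (A i)"] assms by auto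
  also have "\<dots> = emeasure M (\<Union>i\<in>I. A i)"
    using assms by (intro sum_emeasure) auto
  also have "\<dots> \<le> emeasure M B"
    using assms by (intro emeasure_mono) auto
  finally show ?thesis .
qed

lemma emeasure_covering:
  assumes "finite I" "\<And>i. i \<in> I \<Longrightarrow> A i \<in> sets M" "B \<subseteq> (\<Union>i\<in>I. A i)"
    and "\<And>i. i \<in> I \<Longrightarrow> emeasure M (A i) \<le> m"
  shows "emeasure M B \<le> of_nat (card I) * m"
proof -
  have "emeasure M B \<le> emeasure M (\<Union>i\<in>I. A i)"
    using assms by (intro emeasure_mono) auto
  also have "\<dots> \<le> (\<Sum>i\<in>I. emeasure M (A i))"
    using assms by (intro emeasure_subadditive_finite) auto
  also have "\<dots> \<le> of_nat (card I) * m"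
    using sum_bounded_above[of I "\<lambda>i. emeasure M (A i)" m] assms by auto
  finally show ?thesis .
qed

section \<open>Tubes, windows and layers\<close>

lemma emeasure_lborel_ball_vec:
  fixes a :: "complex ^ 'n"
  assumes "0 \<le> r"
  shows "emeasure lborel (ball a r) = ennreal (unit_ball_vol (real (2 * CARD('n))) * r ^ (2 * CARD('n)))"
  using emeasure_ball[OF assms, of a] by (simp add: mult.commute)

text \<open>A set of displacements: the neighbourhood of \<open>w\<close> is the translate of
  \<open>tube w\<close> by \<open>w\<close>. Its size is of order \<open>1 - norm w\<close> in the
  complex direction of \<open>w\<close> and of order the square root of that in the orthogonal
  directions, as for a nonisotropic ball. Centring at \<open>0\<close> makes it balanced.\<close>

definition tube :: "complex ^ 'n \<Rightarrow> (complex ^ 'n) set" where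
  "tube w = {v. norm (cinner v w) < (1 - norm w) / 4 \<and> norm v < sqrt (1 - norm w) / 4}"

lemma continuous_cinner_left: "continuous_on S (\<lambda>v. cinner v w)"
  by (intro continuous_intros)

lemma open_tube: "open (tube w)"
  unfolding tube_def by (intro open_Collect_conj open_Collect_less continuous_intros continuous_cinner_left)

text \<open>A ball of radius about \<open>sqrt h\<close> is covered by about \<open>1 / h\<close> translates of the tube along the
  complex line through \<open>w\<close>.\<close>

lemma tube_lower:
  "\<exists>c>0. \<forall>w\<in>unit_ball. ennreal (c * (1 - norm w) ^ (CARD('n) + 1)) \<le> emeasure lborel (tube (w :: complex ^ 'n))"
proof -
  define V where "V = unit_ball_vol (real (2 * CARD('n)))"
  have V: "V > 0" unfolding V_def by (intro unit_ball_vol_pos) auto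
  have "ennreal (V / 32 ^ (2 * CARD('n)) / 25 * (1 - norm w) ^ (CARD('n) + 1)) \<le> emeasure lborel (tube w)"
    if "w \<in> unit_ball" for w :: "complex ^ 'n"
  proof -
    define h where "h = 1 - norm w"
    have h: "0 < h" "h \<le> 1" using that by (auto simp: h_def unit_ball_def)
    define s where "s = sqrt h"
    have s: "0 < s" "s \<le> 1" "h = s * s" using h by (auto simp: s_def)
    \<comment> \<open>For \<open>w = 0\<close> division by zero gives \<open>e = 0\<close>; all grid
      translations below are then trivial and the condition on \<open>cinner v w\<close> is
      empty.\<close>
    define e where "e = w /\<^sub>R norm w"
    have e: "norm e \<le> 1" by (cases "w = 0") (auto simp: e_def)
    have we: "w = norm w *\<^sub>R e" by (cases "w = 0") (auto simp: e_def)
    \<comment> \<open>The component of \<open>v\<close> along \<open>e\<close> is below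
      \<open>s / 32\<close>, that is, at most \<open>1 / (2 * s)\<close> steps of mesh
      \<open>h / 16\<close>; rounding adds at most one step, and
      \<open>1 \<le> 1 / s\<close>.\<close>
    define M where "M = \<lfloor>2 / s\<rfloor>"
    have M: "0 \<le> M" "of_int M \<le> 2 / s" using s by (auto simp: M_def)
    define g where "g = (\<lambda>(m, n). Complex (of_int m * (h / 16)) (of_int n * (h / 16)))"
    define I where "I = {- M..M} \<times> {- M..M}"
    have "ball 0 (s / 32) \<subseteq> (\<Union>i\<in>I. {v. - (g i *s e) + v \<in> tube w})"
    proof
      fix v :: "complex ^ 'n" assume "v \<in> ball 0 (s / 32)"
      then have v: "norm v < s / 32" by simp
      define z where "z = cinner v e"
      have z: "norm z < s / 32"
        using norm_cinner_le[of v e] e v mult_left_le[of "norm e" "norm v"] by (simp add: z_def)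
      define m n where "m = \<lfloor>Re z / (h / 16)\<rfloor>" and "n = \<lfloor>Im z / (h / 16)\<rfloor>"
      have bnd: "\<bar>\<lfloor>x / (h / 16)\<rfloor>\<bar> \<le> M" "\<bar>x - of_int \<lfloor>x / (h / 16)\<rfloor> * (h / 16)\<bar> \<le> h / 16"
        if "\<bar>x\<bar> < s / 32" for x
      proof -
        define k where "k = \<lfloor>x / (h / 16)\<rfloor>"
        have k: "of_int k \<le> x / (h / 16)" "x / (h / 16) < of_int k + 1"
          by (auto simp: k_def)
        have "\<bar>x / (h / 16)\<bar> \<le> 1 / (2 * s)"
        proof -
          have "\<bar>x / (h / 16)\<bar> = \<bar>x\<bar> / (h / 16)" using h by simp
          also have "\<dots> \<le> (s / 32) / (h / 16)" using that h by (intro divide_right_mono) auto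
          also have "\<dots> = 1 / (2 * s)" using s by (simp add: field_simps)
          finally show ?thesis .
        qed
        moreover have "1 \<le> 1 / s" using s by simp
        moreover have "\<bar>of_int k\<bar> \<le> \<bar>x / (h / 16)\<bar> + 1" using k by linarith
        moreover have "2 / s = 2 * (1 / s)" "1 / (2 * s) = (1 / s) / 2" by simp_all
        ultimately have "\<bar>of_int k\<bar> \<le> 2 / s" by linarith
        then show "\<bar>k\<bar> \<le> M" unfolding M_def by linarith
        show "\<bar>x - of_int k * (h / 16)\<bar> \<le> h / 16"
          using k h by (simp add: field_simps abs_le_iff)
      qed
      have mn: "(m, n) \<in> I"
        using bnd(1)[of "Re z"] bnd(1)[of "Im z"] z abs_Re_le_cmod[of z] abs_Im_le_cmod[of z]
        by (auto simp: I_def m_def n_def)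
      \<comment> \<open>Only the error of rounding to the grid remains in the direction of
        \<open>w\<close>; each of its two real coordinates is at most \<open>h / 16\<close>.\<close>
      define d where "d = z - g (m, n)"
      have d: "norm d \<le> h / 8"
        using bnd(2)[of "Re z"] bnd(2)[of "Im z"] z abs_Re_le_cmod[of z] abs_Im_le_cmod[of z] cmod_le[of d]
        by (auto simp: d_def g_def m_def n_def)
      have "norm (g (m, n)) \<le> norm z + norm d"
        unfolding d_def by norm
      have "norm (v - g (m, n) *s e) \<le> norm v + norm (g (m, n)) * norm e"
        using norm_triangle_ineq4[of v "g (m, n) *s e"] by simp
      also have "\<dots> \<le> norm v + (norm z + norm d) * 1"
        using e \<open>norm (g (m, n)) \<le> norm z + norm d\<close> by (intro add_left_mono mult_mono) auto
      also have "\<dots> < s / 32 + (s / 32 + s / 8)"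
      proof -
        have "s * s \<le> s" using s mult_left_le[of s s] by simp
        then have "norm d \<le> s / 8" using d s(3) by simp
        then show ?thesis unfolding mult_1_right using v z by linarith
      qed
      also have "\<dots> \<le> s / 4" using s by simp
      finally have 1: "norm (v - g (m, n) *s e) < s / 4" .
      have 2: "norm (cinner (v - g (m, n) *s e) w) < h / 4"
      proof (cases "w = 0")
        case True
        then show ?thesis using h by simp
      next
        case False
        then have "cinner e e = 1" by (simp add: cinner_self e_def)
        have "cinner (v - g (m, n) *s e) w = of_real (norm w) * d"
          by (subst we) (simp add: cinner_scaleR_right cinner_diff_left cinner_smult_left \<open>cinner e e = 1\<close> d_def z_def)
        then have "norm (cinner (v - g (m, n) *s e) w) \<le> norm d"
          using h by (simp add: norm_mult h_def mult_left_le_one_le)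
        then show ?thesis using d h by simp
      qed
      show "v \<in> (\<Union>i\<in>I. {v. - (g i *s e) + v \<in> tube w})"
        using mn 1 2 by (auto simp: tube_def h_def s_def intro!: bexI[of _ "(m, n)"])
    qed
    then have "emeasure lborel (ball (0 :: complex ^ 'n) (s / 32)) \<le> of_nat (card I) * emeasure lborel (tube w)"
    proof (rule emeasure_covering[rotated 2])
      show "finite I" by (simp add: I_def)
      fix i
      show "{v. - (g i *s e) + v \<in> tube w} \<in> sets lborel"
        using borel_open[OF open_tube[of w]] by measurable
      show "emeasure lborel {v. - (g i *s e) + v \<in> tube w} \<le> emeasure lborel (tube w)"
        using borel_open[OF open_tube[of w]] by (simp only: emeasure_lborel_translate)
    qed
    also have "of_nat (card I) * emeasure lborel (tube w) \<le> ennreal (25 / h) * emeasure lborel (tube w)"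
    proof (intro mult_right_mono)
      have "real (card I) = (2 * of_int M + 1) * (2 * of_int M + 1)"
        using M(1) by (simp add: I_def card_cartesian_product)
      also have "\<dots> \<le> (5 / s) * (5 / s)"
      proof -
        have "1 \<le> 1 / s" using s by simp
        then have "2 * of_int M + 1 \<le> 5 / s" using M by (simp add: field_simps) 
        then show ?thesis using M s by (intro mult_mono) auto
      qed
      also have "\<dots> = 25 / h" by (simp add: s(3))
      finally show "of_nat (card I) \<le> ennreal (25 / h)"
        by (simp add: ennreal_of_nat_eq_real_of_nat ennreal_leI)
    qed auto
    finally have *: "ennreal (V * (s / 32) ^ (2 * CARD('n))) \<le> ennreal (25 / h) * emeasure lborel (tube w)"
      using s by (simp add: emeasure_lborel_ball_vec V_def)
    \<comment> \<open>The volume of the ball gives \<open>s ^ (2 * N) = h ^ N\<close>; the number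
      \<open>25 / h\<close> of translates costs one more power of \<open>h\<close>.\<close>
    have "ennreal (V / 32 ^ (2 * CARD('n)) / 25 * h ^ (CARD('n) + 1)) = ennreal (h / 25) * ennreal (V * (s / 32) ^ (2 * CARD('n)))"
    proof -
      have "(s / 32) ^ (2 * CARD('n)) = h ^ CARD('n) / 32 ^ (2 * CARD('n))"
        by (simp add: power_divide power_mult[of s 2] s(3) power2_eq_square)
      then show ?thesis using V h by (simp add: ennreal_mult[symmetric] mult_ac)
    qed
    also have "\<dots> \<le> ennreal (h / 25) * (ennreal (25 / h) * emeasure lborel (tube w))"
      using * by (intro mult_left_mono) auto
    also have "\<dots> = emeasure lborel (tube w)"
      using h by (simp add: mult.assoc[symmetric] ennreal_mult[symmetric])
    finally show ?thesis by (simp add: h_def)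
  qed
  then show ?thesis
    using V by (intro exI[of _ "V / 32 ^ (2 * CARD('n)) / 25"]) auto
qed

text \<open>For a unit vector \<open>e\<close>, the nonisotropic (Koranyi) ball of quasi-radius
  \<open>t\<close> about the boundary point \<open>e\<close>, intersected with the unit
  ball.\<close>

definition window :: "complex ^ 'n \<Rightarrow> real \<Rightarrow> (complex ^ 'n) set" where
  "window e t = {z \<in> unit_ball. norm (1 - cinner z e) < t}"

lemma open_window: "open (window e t)"
proof -
  have "window e t = ball 0 1 \<inter> {z. norm (1 - cinner z e) < t}"
    by (auto simp: window_def unit_ball_def)
  then show ?thesis
    by (auto intro!: open_Int open_Collect_less continuous_intros continuous_cinner_left)
qed

text \<open>About \<open>1 / t\<close> disjoint translates of the window along the complex line through \<open>e\<close> fit into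
  a ball of radius about \<open>sqrt t\<close>.\<close>

lemma window_upper:
  "\<exists>C>0. \<forall>e t. norm e = 1 \<longrightarrow> 0 < t \<longrightarrow>
     emeasure lborel (window (e :: complex ^ 'n) t) \<le> ennreal (C * t ^ (CARD('n) + 1))"
proof -
  define V where "V = unit_ball_vol (real (2 * CARD('n)))"
  have V: "V > 0" unfolding V_def by (intro unit_ball_vol_pos) auto
  have "emeasure lborel (window e t) \<le> ennreal (V * 10 ^ (2 * CARD('n)) * t ^ (CARD('n) + 1))"
    if e: "norm e = 1" and t: "0 < t" for e :: "complex ^ 'n" and t
  proof (cases "t \<ge> 1")
    case True
    have "emeasure lborel (window e t) \<le> emeasure lborel (ball (0 :: complex ^ 'n) 1)"
      by (intro emeasure_mono) (auto simp: window_def unit_ball_def)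
    also have "\<dots> = ennreal (V * 1 * 1)"
      by (simp add: emeasure_lborel_ball_vec V_def)
    also have "\<dots> \<le> ennreal (V * 10 ^ (2 * CARD('n)) * t ^ (CARD('n) + 1))"
      using V True by (intro ennreal_leI mult_mono one_le_power) auto
    finally show ?thesis .
  next
    case False
    define s where "s = sqrt t"
    have s: "0 < s" "s \<le> 1" "t = s * s" using t False by (auto simp: s_def)
    define K where "K = nat \<lceil>1 / s\<rceil>"
    have K: "1 / s \<le> real K" "real K \<le> 2 / s"
    proof -
      show "1 / s \<le> real K" by (simp add: K_def real_nat_ceiling_ge)
      have "1 \<le> 1 / s" "real K \<le> 1 / s + 1" using s by (auto simp: K_def)
      then show "real K \<le> 2 / s" by (simp add: field_simps)
    qed
    define I where "I = {..<K} \<times> {..<K}"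
    \<comment> \<open>The product with \<open>e\<close> sends a window into the disc of radius
      \<open>t\<close> about \<open>1\<close>, so shifts by multiples of \<open>2 * t\<close> along
      \<open>e\<close> produce disjoint translates.\<close>
    define g where "g = (\<lambda>(m, n). Complex (real m * (2 * t)) (real n * (2 * t)))"
    define A where "A = (\<lambda>i. {z. - (g i *s e) + z \<in> window e t})"
    have ee: "cinner e e = 1" by (simp add: cinner_self e)
    have *: "of_nat (card I) * emeasure lborel (window e t) \<le> emeasure lborel (ball e (10 * s))"
    proof (rule emeasure_packing[where A = A])
      show "finite I" by (simp add: I_def)
      fix i assume i: "i \<in> I"
      show "A i \<in> sets lborel"
        unfolding A_def using borel_open[OF open_window[of e t]] by measurable
      show "emeasure lborel (window e t) \<le> emeasure lborel (A i)"
        unfolding A_def using borel_open[OF open_window[of e t]] by (simp only: emeasure_lborel_translate)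
      have gi: "norm (g i) \<le> 8 * s"
      proof -
        obtain m n where mn: "i = (m, n)" "m < K" "n < K" using i by (auto simp: I_def)
        have "norm (g i) \<le> real m * (2 * t) + real n * (2 * t)"
          using cmod_le[of "g i"] t by (simp add: g_def mn)
        also have "\<dots> \<le> (2 / s) * (2 * t) + (2 / s) * (2 * t)"
          using mn K t by (intro add_mono mult_right_mono) auto
        also have "\<dots> = 8 * s" using s by simp
        finally show ?thesis .
      qed
      show "A i \<subseteq> ball e (10 * s)"
      proof
        fix z assume "z \<in> A i"
        define u where "u = - (g i *s e) + z"
        have u: "norm u < 1" "norm (1 - cinner u e) < t"
          using \<open>z \<in> A i\<close> by (auto simp: u_def A_def window_def unit_ball_def)
        \<comment> \<open>Closeness of \<open>cinner u e\<close> to \<open>1\<close> forces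
          \<open>u\<close> to be within about \<open>sqrt t\<close> of \<open>e\<close>. Adding a
          shift of length at most \<open>8 * s\<close> explains the radius
          \<open>10 * s\<close>.\<close>
        have "(norm (u - e))\<^sup>2 = (norm u)\<^sup>2 + 1 - 2 * Re (cinner u e)"
          using e by (simp add: Re_cinner power2_norm_eq_inner inner_diff inner_commute norm_eq_1)
        also have "\<dots> < 1 + 1 - 2 * (1 - t)"
        proof -
          have "(norm u)\<^sup>2 < 1" using u(1) by (simp add: power_less_one_iff abs_square_less_1)
          moreover have "1 - Re (cinner u e) < t"
            using u(2) complex_Re_le_cmod[of "1 - cinner u e"] by simp
          ultimately show ?thesis by simp
        qed
        also have "\<dots> \<le> (2 * s)\<^sup>2" using s by (simp add: power2_eq_square)
        finally have "norm (u - e) < 2 * s"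
          using s by (meson power2_less_imp_less less_imp_le mult_pos_pos zero_less_numeral)
        moreover have "norm (z - e) \<le> norm (u - e) + norm (g i *s e)"
          using norm_triangle_ineq[of "u - e" "g i *s e"] by (simp add: u_def)
        ultimately show "z \<in> ball e (10 * s)"
          using gi e by (simp add: dist_norm norm_minus_commute)
      qed
    next
      show "disjoint_family_on A I"
        unfolding disjoint_family_on_def
      proof (intro ballI impI equals0I)
        fix i j z assume ij: "i \<in> I" "j \<in> I" "i \<noteq> j" and z: "z \<in> A i \<inter> A j"
        have "norm (1 - cinner z e + g k) < t" if "z \<in> A k" for k
          using that ee by (simp add: A_def window_def cinner_diff_left cinner_smult_left algebra_simps)
        then have "norm (1 - cinner z e + g i) < t" "norm (1 - cinner z e + g j) < t"
          using z by auto
        then have "norm (g i - g j) < 2 * t"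
          using norm_triangle_ineq4[of "1 - cinner z e + g i" "1 - cinner z e + g j"] by simp
        then have "\<bar>Re (g i - g j)\<bar> < 2 * t" "\<bar>Im (g i - g j)\<bar> < 2 * t"
          using abs_Re_le_cmod abs_Im_le_cmod order_le_less_trans by blast+
        moreover have "\<bar>real a * (2 * t) - real b * (2 * t)\<bar> < 2 * t \<Longrightarrow> a = b" for a b
        proof -
          assume "\<bar>real a * (2 * t) - real b * (2 * t)\<bar> < 2 * t"
          then have "\<bar>real a - real b\<bar> * (2 * t) < 1 * (2 * t)"
            using t by (simp add: left_diff_distrib[symmetric] abs_mult)
          then have "\<bar>real a - real b\<bar> < 1" using t by (simp add: mult_less_cancel_right)
          then show "a = b" by linarith
        qed
        ultimately show False
          using ij by (auto simp: g_def split: prod.splits)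
      qed
    qed auto
    have "1 / t \<le> real (card I)"
    proof -
      have "1 / t = (1 / s) * (1 / s)" by (simp add: s(3))
      also have "\<dots> \<le> real K * real K" using K s by (intro mult_mono) auto
      finally show ?thesis by (simp add: I_def card_cartesian_product)
    qed
    then have "ennreal (1 / t) * emeasure lborel (window e t) \<le> of_nat (card I) * emeasure lborel (window e t)"
      by (intro mult_right_mono) (auto simp: ennreal_of_nat_eq_real_of_nat ennreal_leI)
    also note *
    also have "emeasure lborel (ball e (10 * s)) = ennreal (V * (10 * s) ^ (2 * CARD('n)))"
      using s by (simp add: emeasure_lborel_ball_vec V_def)
    finally have **: "ennreal (1 / t) * emeasure lborel (window e t) \<le> ennreal (V * (10 * s) ^ (2 * CARD('n)))" .
    have "emeasure lborel (window e t) = ennreal t * (ennreal (1 / t) * emeasure lborel (window e t))"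
      using t by (simp add: mult.assoc[symmetric] ennreal_mult[symmetric])
    also have "\<dots> \<le> ennreal t * ennreal (V * (10 * s) ^ (2 * CARD('n)))"
      using ** by (intro mult_left_mono) auto
    also have "\<dots> = ennreal (V * 10 ^ (2 * CARD('n)) * t ^ (CARD('n) + 1))"
    proof -
      have "(10 * s) ^ (2 * CARD('n)) = 10 ^ (2 * CARD('n)) * t ^ CARD('n)"
        by (simp add: power_mult_distrib power_mult[of s 2] s(3) power2_eq_square)
      then show ?thesis using V t by (simp add: ennreal_mult[symmetric] mult_ac)
    qed
    finally show ?thesis .
  qed
  then show ?thesis
    using V by (intro exI[of _ "V * 10 ^ (2 * CARD('n))"]) auto
qed

lemma window_eq_unit_ball: "norm e = 1 \<Longrightarrow> 2 \<le> t \<Longrightarrow> window e t = unit_ball"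
proof -
  assume e: "norm e = 1" and t: "2 \<le> t"
  have "norm (1 - cinner z e) < t" if "norm z < 1" for z
    using norm_cinner_le[of z e] norm_triangle_ineq4[of 1 "cinner z e"] e t that by simp
  then show ?thesis by (auto simp: window_def unit_ball_def)
qed

lemma open_layer: "open {z \<in> window e t. 1 - norm z < s}"
proof -
  have "{z \<in> window e t. 1 - norm z < s} = window e t \<inter> {z. 1 - norm z < s}" by auto
  then show ?thesis
    by (auto intro!: open_Int open_window open_Collect_less continuous_intros)
qed

text \<open>The shells of width \<open>s\<close> obtained from one another by radial contraction are disjoint and
  about \<open>t / s\<close> of them fit into a window of size \<open>2 t\<close>.\<close>

lemma layer_upper:
  "\<exists>C>0. \<forall>e t s. norm e = 1 \<longrightarrow> 0 < t \<longrightarrow> 0 < s \<longrightarrow>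
     emeasure lborel {z \<in> window (e :: complex ^ 'n) t. 1 - norm z < s} \<le> ennreal (C * t ^ CARD('n) * s)"
proof -
  obtain C where C: "C > 0" and W: "\<And>e t. norm e = 1 \<Longrightarrow> 0 < t \<Longrightarrow>
      emeasure lborel (window (e :: complex ^ 'n) t) \<le> ennreal (C * t ^ (CARD('n) + 1))"
    using window_upper[where ?'n = 'n] by blast
  \<comment> \<open>The factors come from the window of size \<open>2 * t\<close>, from contraction
    ratios that may be as small as \<open>1 / 2\<close> in real dimension \<open>2 * N\<close>, and
    from the count of about \<open>t / (4 * s)\<close> shells.\<close>
  define D where "D = C * 2 ^ (CARD('n) + 1) * 4 ^ CARD('n) * 4"
  have "8 \<le> 2 ^ (CARD('n) + 1) * 4 ^ CARD('n) * (4 :: real)"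
  proof -
    have "8 = 2 * 1 * (4 :: real)" by simp
    also have "\<dots> \<le> 2 ^ (CARD('n) + 1) * 4 ^ CARD('n) * (4 :: real)"
      by (intro mult_mono one_le_power) auto
    finally show ?thesis .
  qed
  then have D: "D > 0" "8 * C \<le> D" using C by (auto simp: D_def mult_ac)
  \<comment> \<open>For \<open>t \<le> 2\<close> the contraction ratios stay above
    \<open>1 / 2\<close>; for larger \<open>t\<close> the window is the whole ball and is covered by
    \<open>t = 2\<close>.\<close>
  have L2: "emeasure lborel {z \<in> window (e :: complex ^ 'n) t. 1 - norm z < s} \<le> ennreal (D * t ^ CARD('n) * s)"
    if e: "norm e = 1" and t: "0 < t" "t \<le> 2" and s: "0 < s" for e t s
  proof (cases "s \<ge> t / 8")
    case True
    have "emeasure lborel {z \<in> window e t. 1 - norm z < s} \<le> emeasure lborel (window e t)"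
      by (intro emeasure_mono) (auto intro: borel_open open_window)
    also have "\<dots> \<le> ennreal (C * t ^ (CARD('n) + 1))" using W e t by auto
    also have "\<dots> \<le> ennreal (D * t ^ CARD('n) * s)"
    proof (intro ennreal_leI)
      have "C * t ^ (CARD('n) + 1) = C * t ^ CARD('n) * t" by simp
      also have "\<dots> \<le> C * t ^ CARD('n) * (8 * s)" using True C t by (intro mult_left_mono) auto
      also have "\<dots> = (8 * C) * t ^ CARD('n) * s" by simp
      also have "\<dots> \<le> D * t ^ CARD('n) * s" using D t s by (intro mult_right_mono) auto
      finally show "C * t ^ (CARD('n) + 1) \<le> D * t ^ CARD('n) * s" .
    qed
    finally show ?thesis .
  next
    case False
    define L where "L = {z \<in> window e t. 1 - norm z < s}"
    have L: "L \<in> sets borel" unfolding L_def by (rule borel_open[OF open_layer])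
    have s2: "s < 1/4" using False t by simp
    \<comment> \<open>With this many contractions by \<open>1 - s\<close>, Bernoulli's inequality
      keeps the total ratio above \<open>1 - t / 4\<close>, so the contracted layers stay inside the
      window of size \<open>2 * t\<close>.\<close>
    define J where "J = nat \<lfloor>t / (4 * s)\<rfloor>"
    have J: "real J * s \<le> t / 4" "t / (4 * s) \<le> real (Suc J)"
    proof -
      have "real J \<le> t / (4 * s)" using t s by (simp add: J_def)
      then show "real J * s \<le> t / 4" using s by (simp add: field_simps)
      show "t / (4 * s) \<le> real (Suc J)" unfolding J_def by linarith
    qed
    \<comment> \<open>Contracting the shell between radii \<open>1 - s\<close> and \<open>1\<close>
      by \<open>r j\<close> gives the shell between \<open>r (Suc j)\<close> and \<open>r j\<close>;
      consecutive shells only share a boundary sphere, which the strict inequalities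
      exclude.\<close>
    define r where "r = (\<lambda>j. (1 - s) ^ j)"
    have r: "0 < r j" "r j \<le> 1" "1 - t / 4 \<le> r j" "1 / 2 \<le> r j" if "j \<le> J" for j
    proof -
      show "0 < r j" "r j \<le> 1" using s s2 by (auto simp: r_def power_le_one)
      have "1 + real j * (- s) \<le> (1 + - s) ^ j"
        using s2 by (intro Bernoulli_inequality) auto
      moreover have "real j * s \<le> t / 4"
        using J(1) that s by (meson mult_right_mono of_nat_mono less_imp_le order_trans)
      ultimately show "1 - t / 4 \<le> r j" by (simp add: r_def)
      then show "1 / 2 \<le> r j" using t by simp
    qed
    define A where "A = (\<lambda>j. {z. z /\<^sub>R r j \<in> L})"
    have "of_nat (card {..J}) * (ennreal (1 / 4 ^ CARD('n)) * emeasure lborel L) \<le> emeasure lborel (window e (2 * t))"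
    proof (rule emeasure_packing[where A = A])
      fix j assume j: "j \<in> {..J}"
      show "A j \<in> sets lborel" unfolding A_def using L by measurable
      show "A j \<subseteq> window e (2 * t)"
      proof
        fix z assume "z \<in> A j"
        define u where "u = z /\<^sub>R r j"
        have z: "z = r j *\<^sub>R u" using r[of j] j by (simp add: u_def)
        have u: "norm u < 1" "norm (1 - cinner u e) < t"
          using \<open>z \<in> A j\<close> by (auto simp: u_def A_def L_def window_def unit_ball_def)
        have "norm z \<le> 1 * norm u" using r[of j] j by (simp add: z mult_left_le_one_le)
        moreover have "norm (1 - cinner z e) < 2 * t"
        proof -
          have "1 - cinner z e = (1 - cinner u e) + of_real (1 - r j) * cinner u e"
            by (simp add: z cinner_scaleR_left algebra_simps)
          also have "norm \<dots> \<le> norm (1 - cinner u e) + (1 - r j) * norm (cinner u e)"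
            using r[of j] j by (intro norm_triangle_le) (simp add: norm_mult del: of_real_diff)
          also have "\<dots> \<le> norm (1 - cinner u e) + (t / 4) * 1"
            using r[of j] j u norm_cinner_le[of u e] e by (intro add_left_mono mult_mono) auto
          also have "\<dots> < 2 * t" using u t by simp
          finally show ?thesis .
        qed
        ultimately show "z \<in> window e (2 * t)" using u by (simp add: window_def unit_ball_def)
      qed
      have "1 / 4 ^ CARD('n) = (1 / 2 :: real) ^ DIM(complex ^ 'n)"
        using power_mult[of "2 :: real" 2 "CARD('n)"] by (simp add: mult.commute power_divide)
      also have "\<dots> \<le> r j ^ DIM(complex ^ 'n)"
        using r[of j] j by (intro power_mono) auto
      finally have "ennreal (1 / 4 ^ CARD('n)) * emeasure lborel L \<le> ennreal (r j ^ DIM(complex ^ 'n)) * emeasure lborel L"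
        by (intro mult_right_mono ennreal_leI) auto
      then show "ennreal (1 / 4 ^ CARD('n)) * emeasure lborel L \<le> emeasure lborel (A j)"
        unfolding A_def using r[of j] j by (subst emeasure_lborel_scale[OF L]) auto
    next
      have "i = j" if "z \<in> A i" "z \<in> A j" "i \<le> J" "j \<le> J" for i j z
      proof -
        have shell: "r (Suc k) < norm z \<and> norm z < r k" if "z \<in> A k" "k \<le> J" for k
        proof -
          define u where "u = z /\<^sub>R r k"
          have rk: "0 < r k" "r (Suc k) = (1 - s) * r k" using r[of k] that by (auto simp: r_def)
          have u: "norm u < 1" "1 - s < norm u"
            using that(1) unfolding A_def L_def mem_Collect_eq u_def[symmetric]
            by (simp_all add: window_def unit_ball_def)
          have "norm z = norm u * r k" using rk by (simp add: u_def)
          then show ?thesis using rk u by simp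
        qed
        have mono: "r i \<le> r j" if "j \<le> i" for i j
          unfolding r_def using s s2 that by (intro power_decreasing) auto
        show "i = j"
        proof (rule ccontr)
          assume "i \<noteq> j"
          then consider "Suc i \<le> j" | "Suc j \<le> i" by linarith
          then show False
          proof cases
            case 1
            with shell[OF that(1,3)] shell[OF that(2,4)] mono[of "Suc i" j] show ?thesis by linarith
          next
            case 2
            with shell[OF that(1,3)] shell[OF that(2,4)] mono[of "Suc j" i] show ?thesis by linarith
          qed
        qed
      qed
      then show "disjoint_family_on A {..J}"
        unfolding disjoint_family_on_def by blast
    qed (auto intro: borel_open open_window)
    also have "\<dots> \<le> ennreal (C * (2 * t) ^ (CARD('n) + 1))" using W[of e "2 * t"] e t by auto
    finally have *: "of_nat (Suc J) * (ennreal (1 / 4 ^ CARD('n)) * emeasure lborel L) \<le> ennreal (C * (2 * t) ^ (CARD('n) + 1))"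
      by simp
    have "emeasure lborel L = ennreal (4 * s / t * 4 ^ CARD('n)) * (ennreal (t / (4 * s)) * (ennreal (1 / 4 ^ CARD('n)) * emeasure lborel L))"
      using t s by (simp add: mult.assoc[symmetric] ennreal_mult[symmetric])
    also have "\<dots> \<le> ennreal (4 * s / t * 4 ^ CARD('n)) * (of_nat (Suc J) * (ennreal (1 / 4 ^ CARD('n)) * emeasure lborel L))"
      using J by (intro mult_left_mono mult_right_mono) (auto simp: ennreal_of_nat_eq_real_of_nat ennreal_leI simp del: of_nat_Suc)
    also have "\<dots> \<le> ennreal (4 * s / t * 4 ^ CARD('n)) * ennreal (C * (2 * t) ^ (CARD('n) + 1))"
      using * by (intro mult_left_mono) auto
    also have "\<dots> = ennreal (D * t ^ CARD('n) * s)"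
    proof -
      have "4 * s / t * 4 ^ CARD('n) * (C * (2 * t) ^ (CARD('n) + 1)) = D * t ^ CARD('n) * s"
        using t by (simp add: D_def power_mult_distrib)
      moreover have "0 \<le> 4 * s / t * 4 ^ CARD('n)" "0 \<le> C * (2 * t) ^ (CARD('n) + 1)"
        using t s C by auto
      ultimately show ?thesis by (metis ennreal_mult)
    qed
    finally show ?thesis by (simp add: L_def)
  qed
  have "emeasure lborel {z \<in> window (e :: complex ^ 'n) t. 1 - norm z < s} \<le> ennreal (D * t ^ CARD('n) * s)"
    if e: "norm e = 1" and t: "0 < t" and s: "0 < s" for e t s
  proof (cases "t \<le> 2")
    case True
    then show ?thesis using L2 that by auto
  next
    case False
    then have "window e t = window e 2" using window_eq_unit_ball[OF e, of t] window_eq_unit_ball[OF e, of 2] by simp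
    then have "emeasure lborel {z \<in> window e t. 1 - norm z < s} \<le> ennreal (D * 2 ^ CARD('n) * s)"
      using L2[OF e _ _ s, of 2] by simp
    also have "\<dots> \<le> ennreal (D * t ^ CARD('n) * s)"
      using False D s by (intro ennreal_leI mult_right_mono mult_left_mono power_mono) auto
    finally show ?thesis .
  qed
  then show ?thesis using D by blast
qed

section \<open>Weighted volume of windows\<close>

lemma one_minus_norm_sq:
  assumes "norm z < 1" shows "1 - norm z \<le> 1 - (norm z)\<^sup>2" "1 - (norm z)\<^sup>2 \<le> 2 * (1 - norm z)" "0 < 1 - (norm z)\<^sup>2"
proof -
  have *: "1 - (norm z)\<^sup>2 = (1 - norm z) * (1 + norm z)" by (simp add: power2_eq_square algebra_simps)
  have "(1 - norm z) * 1 \<le> (1 - norm z) * (1 + norm z)"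
    using assms by (intro mult_left_mono) auto
  then show "1 - norm z \<le> 1 - (norm z)\<^sup>2" "0 < 1 - (norm z)\<^sup>2" using assms by (auto simp: * intro!: mult_pos_pos add_pos_nonneg)
  have "(1 - norm z) * (1 + norm z) \<le> (1 - norm z) * 2"
    using assms by (intro mult_left_mono) auto
  then show "1 - (norm z)\<^sup>2 \<le> 2 * (1 - norm z)" by (simp add: *)
qed

text \<open>Both bounds on \<open>x\<close> are required because the exponent may be negative, as it
  is for weights between \<open>-1\<close> and \<open>0\<close>.\<close>

lemma powr_comparable:
  fixes x y a K :: real
  assumes "0 < y" "1 \<le> K" "y / K \<le> x" "x \<le> K * y"
  shows "x powr a \<le> K powr \<bar>a\<bar> * y powr a"
proof (cases "a \<ge> 0")
  case True
  have "x powr a \<le> (K * y) powr a"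
    using assms True by (intro powr_mono2) (auto intro: order_trans[of 0 "y / K"])
  then show ?thesis using assms True by (simp add: powr_mult)
next
  case False
  have "x powr a \<le> (y / K) powr a"
    using assms False by (intro powr_mono2') auto
  also have "\<dots> = K powr \<bar>a\<bar> * y powr a"
    using assms False by (simp add: powr_divide powr_minus field_simps)
  finally show ?thesis .
qed

lemma measurable_bweight [measurable]: "bweight \<alpha> \<in> borel_measurable (borel :: (complex ^ 'n) measure)"
proof -
  have [measurable]: "unit_ball \<in> sets (borel :: (complex ^ 'n) measure)" by (simp add: unit_ball_def)
  show ?thesis unfolding bweight_def by measurable
qed

lemma bweight_nonneg [simp]: "0 \<le> bweight \<alpha> z"
  by (simp add: bweight_def)

lemma le_suminf_ennreal: "f k \<le> (\<Sum>i. f i :: ennreal)"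
  using sum_le_suminf[of f "{k}"] by auto

lemma dyadic_scale:
  fixes x :: real
  assumes "0 < x" "x \<le> 1"
  obtains k where "(1 / 2) ^ Suc k < x" "x \<le> (1 / 2) ^ k"
proof -
  obtain n where "(1 / 2) ^ n < x" using real_arch_pow_inv[of x "1 / 2"] assms by auto
  define m where "m = (LEAST n. (1 / 2) ^ n < x)"
  have m: "(1 / 2) ^ m < x" unfolding m_def using \<open>(1 / 2) ^ n < x\<close> by (rule LeastI)
  then obtain k where k: "m = Suc k" using assms by (cases m) auto
  have "\<not> (1 / 2) ^ k < x" using not_less_Least[of k "\<lambda>n. (1 / 2) ^ n < x"] k by (simp add: m_def)
  then show ?thesis using that[of k] m k by auto
qed

lemma geometric_ennreal:
  assumes "0 \<le> q" "q < 1" "0 \<le> A" shows "(\<Sum>k. ennreal (A * q ^ k)) = ennreal (A / (1 - q))"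
proof -
  have "(\<lambda>k. A * q ^ k) sums (A * (1 / (1 - q)))"
    using assms by (intro sums_mult geometric_sums) auto
  then show ?thesis using assms by (intro suminf_ennreal_eq) auto
qed

text \<open>Split dyadically by the distance to the sphere. At distance about \<open>s k\<close> the
  weight is about \<open>s k powr \<alpha>\<close> and the layer has volume at most of order
  \<open>t ^ N * s k\<close>, so the contributions form a geometric series, which converges
  precisely because \<open>\<alpha> > -1\<close>.\<close>

lemma weighted_window_upper:
  assumes "\<alpha> > -1"
  shows "\<exists>C>0. \<forall>e t. norm e = 1 \<longrightarrow> 0 < t \<longrightarrow>
     (\<integral>\<^sup>+z. indicator (window (e :: complex ^ 'n) t) z * ennreal (bweight \<alpha> z) \<partial>lborel)
       \<le> ennreal (C * t powr (real CARD('n) + 1 + \<alpha>))"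
proof -
  obtain C where C: "C > 0" and L: "\<And>e t s. norm e = 1 \<Longrightarrow> 0 < t \<Longrightarrow> 0 < s \<Longrightarrow>
      emeasure lborel {z \<in> window (e :: complex ^ 'n) t. 1 - norm z < s} \<le> ennreal (C * t ^ CARD('n) * s)"
    using layer_upper[where ?'n = 'n] by blast
  \<comment> \<open>One factor compares \<open>1 - norm z ^ 2\<close> with
    \<open>1 - norm z\<close>, the other compares \<open>1 - norm z\<close> with the dyadic
    scale.\<close>
  define K where "K = (2::real) powr \<bar>\<alpha>\<bar> * 2 powr \<bar>\<alpha>\<bar>"
  have K: "K > 0" by (simp add: K_def)
  define q where "q = (1/2::real) powr (1 + \<alpha>)"
  have q: "0 \<le> q" "q < 1" using assms powr_less_mono2[of "1 + \<alpha>" "1/2" 1] by (auto simp: q_def)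
  have "(\<integral>\<^sup>+z. indicator (window e t) z * ennreal (bweight \<alpha> z) \<partial>lborel)
       \<le> ennreal (2 * K * C / (1 - q) * t powr (real CARD('n) + 1 + \<alpha>))"
    if e: "norm e = 1" and t: "0 < t" for e :: "complex ^ 'n" and t
  proof -
    define s where "s = (\<lambda>k. t * (1/2) ^ k :: real)"
    have s: "0 < s k" for k using t by (simp add: s_def)
    \<comment> \<open>Full layers instead of dyadic shells suffice for an upper bound; the factor
      \<open>2\<close> turns \<open>1 - norm z \<le> s k\<close> into a strict inequality.\<close>
    define S where "S = (\<lambda>k. {z \<in> window e t. 1 - norm z < 2 * s k})"
    have [measurable]: "S k \<in> sets borel" for k unfolding S_def by (rule borel_open[OF open_layer])
    have "indicator (window e t) z * ennreal (bweight \<alpha> z) \<le> (\<Sum>k. ennreal (K * s k powr \<alpha>) * indicator (S k) z)" for z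
    proof (cases "z \<in> window e t")
      case True
      define h where "h = 1 - norm z"
      have z: "norm z < 1" "norm (1 - cinner z e) < t" using True by (auto simp: window_def unit_ball_def)
      have h: "0 < h" "h \<le> t"
        using z norm_cinner_le[of z e] e norm_triangle_ineq2[of 1 "cinner z e"] by (auto simp: h_def)
      obtain k where "(1 / 2) ^ Suc k < h / t" "h / t \<le> (1 / 2) ^ k"
        using dyadic_scale[of "h / t"] h t by auto
      then have k: "s (Suc k) < h" "h \<le> s k" using t by (simp_all add: s_def field_simps)
      have sk: "s k / 2 < h" using k(1) by (simp add: s_def)
      have "bweight \<alpha> z = (1 - (norm z)\<^sup>2) powr \<alpha>"
        using z by (simp add: bweight_def unit_ball_def)
      also have "\<dots> \<le> 2 powr \<bar>\<alpha>\<bar> * h powr \<alpha>"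
        using one_minus_norm_sq[OF z(1)] h by (intro powr_comparable) (auto simp: h_def)
      also have "\<dots> \<le> 2 powr \<bar>\<alpha>\<bar> * (2 powr \<bar>\<alpha>\<bar> * s k powr \<alpha>)"
        using sk k(2) s[of k] by (intro mult_left_mono powr_comparable) auto
      finally have "bweight \<alpha> z \<le> K * s k powr \<alpha>" by (simp add: K_def)
      then have "indicator (window e t) z * ennreal (bweight \<alpha> z) \<le> ennreal (K * s k powr \<alpha>) * indicator (S k) z"
        using True k s[of k] by (auto simp: S_def h_def intro!: ennreal_leI)
      also have "\<dots> \<le> (\<Sum>k. ennreal (K * s k powr \<alpha>) * indicator (S k) z)"
        by (rule le_suminf_ennreal)
      finally show ?thesis .
    qed auto
    then have "(\<integral>\<^sup>+z. indicator (window e t) z * ennreal (bweight \<alpha> z) \<partial>lborel)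
        \<le> (\<integral>\<^sup>+z. (\<Sum>k. ennreal (K * s k powr \<alpha>) * indicator (S k) z) \<partial>lborel)"
      by (intro nn_integral_mono) auto
    also have "\<dots> = (\<Sum>k. ennreal (K * s k powr \<alpha>) * emeasure lborel (S k))"
      by (subst nn_integral_suminf) (auto simp: nn_integral_cmult)
    also have "\<dots> \<le> (\<Sum>k. ennreal (2 * K * C * t powr (real CARD('n) + 1 + \<alpha>) * q ^ k))"
    proof (intro suminf_le)
      fix k
      have "ennreal (K * s k powr \<alpha>) * emeasure lborel (S k) \<le> ennreal (K * s k powr \<alpha>) * ennreal (C * t ^ CARD('n) * (2 * s k))"
        unfolding S_def using s[of k] by (intro mult_left_mono L e t) auto
      also have "\<dots> = ennreal ((K * s k powr \<alpha>) * (C * t ^ CARD('n) * (2 * s k)))"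
        using K s[of k] C t by (intro ennreal_mult[symmetric]) auto
      also have "(K * s k powr \<alpha>) * (C * t ^ CARD('n) * (2 * s k)) = 2 * K * C * t ^ CARD('n) * s k powr (1 + \<alpha>)"
        using s[of k] by (simp add: powr_add)
      also have "s k powr (1 + \<alpha>) = t powr (1 + \<alpha>) * q ^ k"
        using t by (simp add: s_def q_def powr_mult powr_power powr_powr powr_realpow[symmetric] mult.commute)
      also have "2 * K * C * t ^ CARD('n) * (t powr (1 + \<alpha>) * q ^ k) = 2 * K * C * t powr (real CARD('n) + 1 + \<alpha>) * q ^ k"
        using t by (simp add: powr_add powr_realpow)
      finally show "ennreal (K * s k powr \<alpha>) * emeasure lborel (S k) \<le> ennreal (2 * K * C * t powr (real CARD('n) + 1 + \<alpha>) * q ^ k)" .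
    qed auto
    also have "\<dots> = ennreal (2 * K * C * t powr (real CARD('n) + 1 + \<alpha>) / (1 - q))"
      using q K C by (intro geometric_ennreal) auto
    finally show ?thesis by (simp add: mult_ac)
  qed
  then show ?thesis using K C q by (intro exI[of _ "2 * K * C / (1 - q)"]) auto
qed

text \<open>Division by the total mass in \<open>dv\<close> is meaningful only if that mass is
  neither \<open>0\<close> nor infinite; finiteness follows from the window of size
  \<open>2\<close>, which is the whole ball.\<close>

lemma dv_eq_density:
  assumes "\<alpha> > -1"
  obtains k where "k > 0" "(dv \<alpha> :: (complex ^ 'n) measure) = density lborel (\<lambda>z. ennreal (k * bweight \<alpha> z))"
proof -
  define M where "M = (\<integral>\<^sup>+z. ennreal (bweight \<alpha> (z :: complex ^ 'n)) \<partial>lborel)"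
  obtain j :: 'n where True by auto
  define e :: "complex ^ 'n" where "e = axis j 1"
  have e: "norm e = 1" by (simp add: e_def)
  obtain C where "(\<integral>\<^sup>+z. indicator (window e 2) z * ennreal (bweight \<alpha> z) \<partial>lborel) \<le> ennreal (C * 2 powr (real CARD('n) + 1 + \<alpha>))"
    using weighted_window_upper[OF assms, where ?'n = 'n] e by (metis zero_less_numeral)
  moreover have "indicator (window e 2) z * ennreal (bweight \<alpha> z) = ennreal (bweight \<alpha> z)" for z
    by (auto simp: window_eq_unit_ball[OF e] bweight_def indicator_def)
  ultimately have "M \<le> ennreal (C * 2 powr (real CARD('n) + 1 + \<alpha>))" by (simp add: M_def)
  then have fin: "M < \<infinity>" by (simp add: order_le_less_trans)
  have "M \<noteq> 0"
  proof
    assume "M = 0"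
    then have "AE z in lborel. ennreal (bweight \<alpha> (z :: complex ^ 'n)) = 0"
      unfolding M_def by (subst (asm) nn_integral_0_iff_AE) auto
    then have "AE z in lborel. (z :: complex ^ 'n) \<notin> ball 0 1"
    proof eventually_elim
      fix z :: "complex ^ 'n" assume "ennreal (bweight \<alpha> z) = 0"
      then show "z \<notin> ball 0 1" 
        using one_minus_norm_sq(3)[of z] by (auto simp: bweight_def unit_ball_def)
    qed
    then have "emeasure lborel (ball (0 :: complex ^ 'n) 1) = 0"
      by (subst (asm) AE_iff_measurable[OF _ refl]) (auto simp: ball_def)
    moreover have "0 < unit_ball_vol (2 * real CARD('n))"
      by (rule unit_ball_vol_pos) simp
    ultimately show False
      by (simp add: emeasure_lborel_ball_vec ennreal_eq_0_iff not_le)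
  qed
  obtain m where m: "M = ennreal m" "0 \<le> m" using fin by (cases M) auto
  have "0 < m" using \<open>M \<noteq> 0\<close> m by (cases "m = 0") auto
  show ?thesis
  proof (rule that[of "1 / m"])
    show "(dv \<alpha> :: (complex ^ 'n) measure) = density lborel (\<lambda>z. ennreal (1 / m * bweight \<alpha> z))"
      unfolding dv_def M_def[symmetric] m(1) using \<open>0 < m\<close> by (simp add: divide_ennreal)
  qed (use \<open>0 < m\<close> in auto)
qed

section \<open>The sub-mean value property on tubes\<close>

lemma holo_fun_onD_continuous: "holo_fun_on U f \<Longrightarrow> continuous_on U f"
  unfolding holo_fun_on_def by (meson continuous_at_imp_continuous_on has_derivative_continuous)

lemma has_derivative_smult_left:
  fixes v :: "complex ^ 'n"
  shows "((\<lambda>c. w + c *s v) has_derivative (\<lambda>c. c *s v)) (at c)"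
proof -
  have "linear (\<lambda>c. c *s v)"
    by (rule linearI) (simp_all add: vec_eq_iff algebra_simps)
  then have "((\<lambda>c. c *s v) has_derivative (\<lambda>c. c *s v)) (at c)"
    by (simp add: linear_imp_has_derivative)
  then show ?thesis by (auto intro: derivative_eq_intros)
qed

lemma holo_fun_on_slice:
  assumes f: "holo_fun_on U f" and T: "open T" "\<And>c. c \<in> T \<Longrightarrow> w + c *s v \<in> U"
  shows "(\<lambda>c. f (w + c *s v)) holomorphic_on T"
proof -
  have "(\<lambda>c. f (w + c *s v)) field_differentiable at c" if "c \<in> T" for c
  proof -
    have "w + c *s v \<in> U" using T(2) that .
    then obtain L where L: "(f has_derivative L) (at (w + c *s v))" "\<And>c v. L (c *s v) = c * L v"
      using f unfolding holo_fun_on_def by blast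
    have "((\<lambda>c. f (w + c *s v)) has_derivative (\<lambda>c. L (c *s v))) (at c)"
      using has_derivative_compose has_derivative_smult_left L(1) by blast
    then show ?thesis
      unfolding field_differentiable_def has_field_derivative_def L(2)
      by (metis (no_types, lifting) ext mult.commute)
  qed
  then show ?thesis
    using holomorphic_on_def field_differentiable_at_within by blast
qed

lemma circle_mean_value:
  assumes "g holomorphic_on cball 0 1"
  shows "((\<lambda>t. g (exp (2 * of_real pi * \<i> * of_real t))) has_integral g 0) {0..1}"
proof -
  have "((\<lambda>u. g u / (u - 0)) has_contour_integral 2 * of_real pi * \<i> * g 0) (circlepath 0 1)"
    using assms by (intro Cauchy_integral_circlepath_simple) auto
  then have "((\<lambda>t. g (circlepath 0 1 t) / (circlepath 0 1 t) * vector_derivative (circlepath 0 1) (at t within {0..1}))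
      has_integral 2 * of_real pi * \<i> * g 0) {0..1}"
    by (simp add: has_contour_integral_def)
  then have "((\<lambda>t. 2 * of_real pi * \<i> * g (exp (2 * of_real pi * \<i> * of_real t))) has_integral 2 * of_real pi * \<i> * g 0) {0..1}"
  proof (rule has_integral_eq[rotated])
    fix t :: real assume "t \<in> {0..1}"
    then have "vector_derivative (circlepath 0 1) (at t within {0..1}) = 2 * of_real pi * \<i> * exp (2 * of_real pi * \<i> * of_real t)"
      by (simp add: vector_derivative_circlepath01 mult_ac)
    moreover have "circlepath 0 1 t = exp (2 * of_real pi * \<i> * of_real t)" by (simp add: circlepath)
    ultimately show "g (circlepath 0 1 t) / (circlepath 0 1 t) * vector_derivative (circlepath 0 1) (at t within {0..1})
      = 2 * of_real pi * \<i> * g (exp (2 * of_real pi * \<i> * of_real t))" by simp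
  qed
  then have "((\<lambda>t. 1 / (2 * of_real pi * \<i>) * (2 * of_real pi * \<i> * g (exp (2 * of_real pi * \<i> * of_real t))))
      has_integral 1 / (2 * of_real pi * \<i>) * (2 * of_real pi * \<i> * g 0)) {0..1}"
    by (rule has_integral_mult_right)
  then show ?thesis by simp
qed

text \<open>Jensen's inequality for the circle mean, written with the supporting line at
  \<open>norm (g 0)\<close>; the mean of \<open>norm g\<close> is at least \<open>norm (g 0)\<close>
  by the mean value property.\<close>

lemma (in orlicz) circle_submean:
  assumes g: "g holomorphic_on cball 0 1"
  shows "ennreal (\<psi> (norm (g 0)))
    \<le> (\<integral>\<^sup>+t. indicator {0..1} t * ennreal (\<psi> (norm (g (exp (2 * of_real pi * \<i> * of_real t))))) \<partial>lborel)"
proof -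
  define G where "G = (\<lambda>t. norm (g (exp (2 * of_real pi * \<i> * of_real t))))"
  define x where "x = norm (g 0)"
  have cg: "continuous_on {0..1} (\<lambda>t. g (exp (2 * of_real pi * \<i> * of_real t)))"
    by (rule continuous_on_compose2[OF holomorphic_on_imp_continuous_on[OF g]])
       (auto intro!: continuous_intros)
  then have cG: "continuous_on {0..1} G" unfolding G_def by (rule continuous_on_norm)
  have cP: "continuous_on {0..1} (\<lambda>t. \<psi> (G t))"
    by (rule continuous_on_compose2[OF continuous cG]) (auto simp: G_def)
  have x: "x \<le> integral {0..1} G"
    using integral_norm_bound_integral[OF integrable_continuous_interval[OF cg] integrable_continuous_interval[OF cG]]
    by (simp add: G_def x_def integral_unique[OF circle_mean_value[OF g]])
  obtain s where s: "0 \<le> s" "\<And>y. 0 \<le> y \<Longrightarrow> \<psi> x + s * (y - x) \<le> \<psi> y"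
    using support[of x] by (auto simp: x_def)
  have "\<psi> x \<le> \<psi> x + s * (integral {0..1} G - x)" using s x by simp
  also have "\<dots> = integral {0..1} (\<lambda>t. \<psi> x + s * (G t - x))"
  proof -
    have "((\<lambda>t. \<psi> x + s * (G t - x)) has_integral (\<psi> x * (1 - 0) + s * (integral {0..1} G - x * (1 - 0)))) {0..1}"
      using cG has_integral_const_real[of x 0 1] has_integral_const_real[of "\<psi> x" 0 1]
      by (intro has_integral_add has_integral_mult_right has_integral_diff integrable_integral integrable_continuous_interval)
         (auto simp: mult.commute)
    then show ?thesis by (simp add: integral_unique)
  qed
  also have "\<dots> \<le> integral {0..1} (\<lambda>t. \<psi> (G t))"
    using cG cP s by (intro integral_le integrable_continuous_interval continuous_intros) (auto simp: G_def)
  finally have "ennreal (\<psi> x) \<le> ennreal (integral {0..1} (\<lambda>t. \<psi> (G t)))" by (rule ennreal_leI)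
  also have "\<dots> = (\<integral>\<^sup>+t. ennreal (\<psi> (G t)) * indicator {0..1} t \<partial>lborel)"
    using integrable_integral[OF integrable_continuous_interval[OF cP]]
    by (intro nn_integral_has_integral_lebesgue'[symmetric]) (auto simp: G_def)
  finally show ?thesis by (simp add: G_def x_def mult.commute)
qed

lemma measurable_on_unit_ball:
  assumes "continuous_on unit_ball (f :: complex ^ 'n \<Rightarrow> complex)"
  shows "(\<lambda>z. indicator unit_ball z *\<^sub>R f z) \<in> borel_measurable borel"
  using assms by (intro borel_measurable_continuous_on_indicator) (auto simp: unit_ball_def)

lemma sets_unit_ball [measurable]: "unit_ball \<in> sets (borel :: (complex ^ 'n) measure)"
  by (simp add: unit_ball_def)

text \<open>Neither \<open>f\<close> outside the ball nor \<open>\<psi>\<close> on negative numbers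
  is controlled; the indicator and \<open>\<psi>p\<close> remove both defects.\<close>

lemma (in orlicz) measurable_modulus:
  assumes "continuous_on unit_ball (f :: complex ^ 'n \<Rightarrow> complex)" "0 \<le> c"
  shows "(\<lambda>z. indicator unit_ball z * ennreal (\<psi> (c * norm (f z)))) \<in> borel_measurable borel"
proof -
  have [measurable]: "(\<lambda>z. indicator unit_ball z *\<^sub>R f z) \<in> borel_measurable borel"
    by (rule measurable_on_unit_ball[OF assms(1)])
  have *: "(\<lambda>z. indicator unit_ball z * ennreal (\<psi> (c * norm (f z))))
     = (\<lambda>z. indicator unit_ball z * ennreal (\<psi>p (c * norm (indicator unit_ball z *\<^sub>R f z))))"
    using assms(2) by (auto simp: fun_eq_iff indicator_def p_eq)
  show ?thesis unfolding * by measurable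
qed

lemma measurable_smult [measurable]: "(*s) c \<in> borel_measurable (borel :: (complex ^ 'n) measure)"
  by (intro borel_measurable_continuous_onI continuous_intros)

lemma measurable_circle_action [measurable]:
  "(\<lambda>(t, v). w + exp (2 * of_real pi * \<i> * of_real t) *s v) \<in> borel_measurable (borel \<Otimes>\<^sub>M (borel :: (complex ^ 'n) measure))"
  unfolding borel_prod case_prod_unfold by (intro borel_measurable_continuous_onI continuous_intros)

text \<open>For \<open>v\<close> in \<open>S\<close> the whole disc of points
  \<open>w + c *s v\<close> with \<open>norm c \<le> 1\<close> lies in the ball, so the circle
  inequality applies on it. Integrating over \<open>v\<close> and exchanging the integrals removes
  the angle, since each rotation preserves both \<open>S\<close> and Lebesgue measure.\<close>

lemma (in orlicz) submean_balanced:
  fixes f :: "complex ^ 'n \<Rightarrow> complex"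
  assumes f: "holo_fun_on unit_ball f" and S: "open S" "\<And>c v. norm c \<le> 1 \<Longrightarrow> v \<in> S \<Longrightarrow> c *s v \<in> S"
    and wS: "\<And>v. v \<in> S \<Longrightarrow> w + v \<in> unit_ball"
  shows "ennreal (\<psi> (norm (f w))) * emeasure lborel S
     \<le> (\<integral>\<^sup>+v. indicator S v * ennreal (\<psi> (norm (f (w + v)))) \<partial>lborel)"
proof -
  define F where "F z = indicator unit_ball z * ennreal (\<psi> (norm (f z)))" for z
  define E where "E = (\<lambda>t. exp (2 * of_real pi * \<i> * complex_of_real t))"
  have E: "norm (E t) = 1" for t by (simp add: E_def)
  have [measurable]: "F \<in> borel_measurable borel"
    unfolding F_def using measurable_modulus[OF holo_fun_onD_continuous[OF f], of 1] by simp
  have [measurable]: "S \<in> sets borel" using S by auto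
  have [measurable]: "(\<lambda>p. w + E (fst p) *s snd p) \<in> borel_measurable (borel \<Otimes>\<^sub>M borel)"
    using measurable_circle_action[of w] by (simp add: E_def case_prod_unfold)
  have inS: "E t *s v \<in> S \<longleftrightarrow> v \<in> S" for t v
  proof
    assume "E t *s v \<in> S"
    then have "inverse (E t) *s (E t *s v) \<in> S" by (rule S(2)[rotated]) (auto simp: norm_inverse E)
    moreover have "inverse (E t) *s (E t *s v) = v" by (simp add: vector_smult_assoc E_def)
    ultimately show "v \<in> S" by metis
  qed (simp add: S(2) E)
  have "ennreal (\<psi> (norm (f w))) * emeasure lborel S = (\<integral>\<^sup>+v. indicator S v * ennreal (\<psi> (norm (f w))) \<partial>lborel)"
    by (subst nn_integral_multc) (auto simp: mult.commute)
  also have "\<dots> \<le> (\<integral>\<^sup>+v. (\<integral>\<^sup>+t. indicator {0..1} t * (indicator S v * F (w + E t *s v)) \<partial>lborel) \<partial>lborel)"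
  proof (intro nn_integral_mono)
    fix v
    show "indicator S v * ennreal (\<psi> (norm (f w)))
        \<le> (\<integral>\<^sup>+t. indicator {0..1} t * (indicator S v * F (w + E t *s v)) \<partial>lborel)"
    proof (cases "v \<in> S")
      case True
      define T where "T = {c. w + c *s v \<in> unit_ball}"
      have "open T"
        unfolding T_def unit_ball_def mem_ball_0 by (intro open_Collect_less continuous_intros)
      have T: "cball 0 1 \<subseteq> T"
        using wS S(2)[OF _ True] by (auto simp: T_def)
      have "(\<lambda>c. f (w + c *s v)) holomorphic_on T"
        using f \<open>open T\<close> by (intro holo_fun_on_slice) (auto simp: T_def)
      then have "(\<lambda>c. f (w + c *s v)) holomorphic_on cball 0 1"
        using T holomorphic_on_subset by blast
      from circle_submean[OF this]
      have "ennreal (\<psi> (norm (f w))) \<le> (\<integral>\<^sup>+t. indicator {0..1} t * ennreal (\<psi> (norm (f (w + E t *s v)))) \<partial>lborel)"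
        by (simp add: E_def)
      also have "\<dots> = (\<integral>\<^sup>+t. indicator {0..1} t * (indicator S v * F (w + E t *s v)) \<partial>lborel)"
        using True wS inS by (auto simp: F_def)
      finally show ?thesis using True by simp
    qed simp
  qed
  also have "\<dots> = (\<integral>\<^sup>+t. (\<integral>\<^sup>+v. indicator {0..1} t * (indicator S v * F (w + E t *s v)) \<partial>lborel) \<partial>lborel)"
    by (rule lborel_pair.Fubini') measurable
  also have "\<dots> = (\<integral>\<^sup>+t. indicator {0..1} (t :: real) * (\<integral>\<^sup>+v. indicator S v * F (w + v) \<partial>lborel) \<partial>lborel)"
  proof (rule nn_integral_cong)
    fix t
    have "(\<integral>\<^sup>+v. indicator {0..1} t * (indicator S v * F (w + E t *s v)) \<partial>lborel)
        = (\<integral>\<^sup>+v. indicator {0..1} t * (indicator S (E t *s v) * F (w + E t *s v)) \<partial>lborel)"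
      by (simp add: indicator_def inS)
    also have "\<dots> = indicator {0..1} t * (\<integral>\<^sup>+v. indicator S (E t *s v) * F (w + E t *s v) \<partial>lborel)"
      by (intro nn_integral_cmult) measurable
    also have "(\<integral>\<^sup>+v. indicator S (E t *s v) * F (w + E t *s v) \<partial>lborel) = (\<integral>\<^sup>+v. indicator S v * F (w + v) \<partial>lborel)"
      by (rule nn_integral_lborel_rotate[where f = "\<lambda>v. indicator S v * F (w + v)"]) (auto simp: E)
    finally show "(\<integral>\<^sup>+v. indicator {0..1} t * (indicator S v * F (w + E t *s v)) \<partial>lborel)
       = indicator {0..1} t * (\<integral>\<^sup>+v. indicator S v * F (w + v) \<partial>lborel)" .
  qed
  also have "\<dots> = (\<integral>\<^sup>+v. indicator S v * F (w + v) \<partial>lborel)"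
    by (subst nn_integral_multc) auto
  also have "\<dots> = (\<integral>\<^sup>+v. indicator S v * ennreal (\<psi> (norm (f (w + v)))) \<partial>lborel)"
    using wS by (intro nn_integral_cong) (auto simp: F_def indicator_def)
  finally show ?thesis .
qed

text \<open>On the translate of the tube by \<open>w\<close> the distance to the sphere is
  comparable to that of \<open>w\<close>. The last conclusion reverses the roles of the two points:
  it places \<open>w\<close> in a region determined by \<open>z\<close>, as the exchange of
  integrals later requires.\<close>

lemma tube_geometry:
  assumes w: "norm w < 1" and v: "v \<in> tube w"
  defines "h \<equiv> 1 - norm w" and "z \<equiv> w + v"
  shows "norm z < 1" and "h / 8 \<le> 1 - norm z" and "1 - norm z \<le> 3 * h"
    and "h / 8 \<le> 1 - (norm z)\<^sup>2" and "1 - (norm z)\<^sup>2 \<le> 8 * h"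
    and "norm (1 - cinner w z) < 24 * (1 - norm z)"
proof -
  have h: "h > 0" using w by (simp add: h_def)
  have v1: "norm (cinner v w) < h / 4" and "norm v < sqrt h / 4"
    using v by (auto simp: tube_def h_def)
  then have "(norm v)\<^sup>2 < (sqrt h / 4)\<^sup>2" by (intro power_strict_mono) auto
  then have v2: "(norm v)\<^sup>2 < h / 16" using h by (simp add: power_divide)
  have "\<bar>v \<bullet> w\<bar> < h / 4"
    using v1 abs_Re_le_cmod[of "cinner v w"] by (simp add: Re_cinner)
  moreover have "(norm z)\<^sup>2 = (norm w)\<^sup>2 + 2 * (v \<bullet> w) + (norm v)\<^sup>2"
    by (simp add: z_def power2_norm_eq_inner inner_add inner_commute)
  \<comment> \<open>The cross term is below \<open>h / 2\<close> and the square of the displacement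
    is below \<open>h / 16\<close>, while \<open>1 - norm w ^ 2\<close> lies between
    \<open>h\<close> and \<open>2 * h\<close>.\<close>
  ultimately have z: "7 * h / 16 \<le> 1 - (norm z)\<^sup>2" "1 - (norm z)\<^sup>2 \<le> 5 * h / 2"
    using v2 one_minus_norm_sq(1,2)[OF w, folded h_def] zero_le_power2[of "norm v"]
    unfolding abs_less_iff by linarith+
  then show "h / 8 \<le> 1 - (norm z)\<^sup>2" "1 - (norm z)\<^sup>2 \<le> 8 * h" using h by auto
  have "(norm z)\<^sup>2 < 1" using z(1) h by simp
  then show z1: "norm z < 1" by (simp add: abs_square_less_1)
  show *: "h / 8 \<le> 1 - norm z" "1 - norm z \<le> 3 * h"
    using one_minus_norm_sq[OF z1] z h by auto
  have "cinner w z = of_real ((norm w)\<^sup>2) + cnj (cinner v w)"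
    unfolding z_def cnj_cinner[of v w] cinner_self[symmetric] by (simp add: cinner_def algebra_simps sum.distrib)
  then have "1 - cinner w z = of_real (1 - (norm w)\<^sup>2) - cnj (cinner v w)" by simp
  then have "norm (1 - cinner w z) \<le> norm (complex_of_real (1 - (norm w)\<^sup>2)) + norm (cnj (cinner v w))"
    by (metis norm_triangle_ineq4)
  also have "\<dots> \<le> \<bar>1 - (norm w)\<^sup>2\<bar> + norm (cinner v w)" by (simp del: of_real_diff)
  \<comment> \<open>The two terms are at most \<open>2 * h\<close> and \<open>h / 4\<close>; with
    \<open>h \<le> 8 * (1 - norm z)\<close> this is the source of the constant
    \<open>24\<close>.\<close>
  also have "\<dots> < 3 * h" using one_minus_norm_sq[OF w] v1 h by (simp add: h_def)
  also have "\<dots> \<le> 24 * (1 - norm z)" using * by simp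
  finally show "norm (1 - cinner w z) < 24 * (1 - norm z)" .
qed

lemma tube_balanced: assumes "norm c \<le> 1" "v \<in> tube w" shows "c *s v \<in> tube w"
proof -
  have "norm c * norm (cinner v w) \<le> norm (cinner v w)" "norm c * norm v \<le> norm v"
    using assms by (auto intro: mult_left_le_one_le)
  then show ?thesis using assms(2) by (auto simp: tube_def cinner_smult_left norm_mult)
qed

text \<open>The tube has volume at least of order \<open>(1 - norm w) ^ (N + 1)\<close>, and on its
  translate the density of \<open>dv \<alpha>\<close> is comparable to
  \<open>(1 - norm w) powr \<alpha>\<close>.\<close>

lemma (in orlicz) submean_dv:
  assumes "\<alpha> > -1"
  shows "\<exists>C>0. \<forall>f w. holo_fun_on unit_ball f \<longrightarrow> w \<in> unit_ball \<longrightarrow>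
    ennreal (\<psi> (norm (f w)) * (1 - norm w) powr (real CARD('n) + 1 + \<alpha>))
      \<le> ennreal C * (\<integral>\<^sup>+z. indicator (tube w) (z - w) * ennreal (\<psi> (norm (f z))) \<partial>(dv \<alpha> :: (complex ^ 'n) measure))"
proof -
  obtain c where c: "c > 0" "\<And>w. w \<in> unit_ball \<Longrightarrow>
      ennreal (c * (1 - norm w) ^ (CARD('n) + 1)) \<le> emeasure lborel (tube (w :: complex ^ 'n))"
    using tube_lower[where ?'n = 'n] by blast
  obtain k where k: "k > 0" "(dv \<alpha> :: (complex ^ 'n) measure) = density lborel (\<lambda>z. ennreal (k * bweight \<alpha> z))"
    using dv_eq_density[OF assms] by blast
  define C where "C = 8 powr \<bar>\<alpha>\<bar> / (k * c)"
  have C: "C > 0" using k c by (simp add: C_def)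
  have "ennreal (\<psi> (norm (f w)) * (1 - norm w) powr (real CARD('n) + 1 + \<alpha>))
      \<le> ennreal C * (\<integral>\<^sup>+z. indicator (tube w) (z - w) * ennreal (\<psi> (norm (f z))) \<partial>dv \<alpha>)"
    if f: "holo_fun_on unit_ball f" and w: "w \<in> unit_ball" for f and w :: "complex ^ 'n"
  proof -
    define h where "h = 1 - norm w"
    have w1: "norm w < 1" using w by (simp add: unit_ball_def)
    have h: "h > 0" using w1 by (simp add: h_def)
    define F where "F z = indicator unit_ball z * ennreal (\<psi> (norm (f z)))" for z
    have [measurable]: "F \<in> borel_measurable borel"
      unfolding F_def using measurable_modulus[OF holo_fun_onD_continuous[OF f], of 1] by simp
    have [measurable]: "tube w \<in> sets borel" by (rule borel_open[OF open_tube])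
    have ball: "z \<in> unit_ball" if "z - w \<in> tube w" for z
      using tube_geometry(1)[OF w1 that] by (simp add: unit_ball_def)
    have "ennreal (\<psi> (norm (f w))) * ennreal (c * h ^ (CARD('n) + 1)) \<le> ennreal (\<psi> (norm (f w))) * emeasure lborel (tube w)"
      unfolding h_def by (intro mult_left_mono c w) auto
    also have "\<dots> \<le> (\<integral>\<^sup>+v. indicator (tube w) v * ennreal (\<psi> (norm (f (w + v)))) \<partial>lborel)"
      using tube_geometry(1)[OF w1] by (intro submean_balanced[OF f open_tube]) (auto simp: tube_balanced unit_ball_def)
    also have "\<dots> = (\<integral>\<^sup>+v. indicator (tube w) (- w + (w + v)) * F (w + v) \<partial>lborel)"
      using ball by (intro nn_integral_cong) (auto simp: F_def indicator_def)
    also have "\<dots> = (\<integral>\<^sup>+z. indicator (tube w) (- w + z) * F z \<partial>lborel)"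
      by (rule nn_integral_lborel_translate[where f = "\<lambda>z. indicator (tube w) (- w + z) * F z"]) measurable
    finally have 1: "ennreal (\<psi> (norm (f w))) * ennreal (c * h ^ (CARD('n) + 1))
      \<le> (\<integral>\<^sup>+z. indicator (tube w) (z - w) * F z \<partial>lborel)" by simp
    have "ennreal (\<psi> (norm (f w)) * h powr (real CARD('n) + 1 + \<alpha>))
       = ennreal (h powr \<alpha> / c) * (ennreal (\<psi> (norm (f w))) * ennreal (c * h ^ (CARD('n) + 1)))"
      using h c(1) by (simp add: ennreal_mult[symmetric] powr_add powr_realpow mult_ac)
    also have "\<dots> \<le> ennreal (h powr \<alpha> / c) * (\<integral>\<^sup>+z. indicator (tube w) (z - w) * F z \<partial>lborel)"
      using 1 by (intro mult_left_mono) auto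
    also have "\<dots> = (\<integral>\<^sup>+z. ennreal (h powr \<alpha> / c) * (indicator (tube w) (z - w) * F z) \<partial>lborel)"
      by (intro nn_integral_cmult[symmetric]) measurable
    also have "\<dots> \<le> (\<integral>\<^sup>+z. ennreal C * (ennreal (k * bweight \<alpha> z) * (indicator (tube w) (z - w) * F z)) \<partial>lborel)"
    proof (intro nn_integral_mono)
      fix z
      show "ennreal (h powr \<alpha> / c) * (indicator (tube w) (z - w) * F z)
          \<le> ennreal C * (ennreal (k * bweight \<alpha> z) * (indicator (tube w) (z - w) * F z))"
      proof (cases "z - w \<in> tube w")
        case True
        have "h powr \<alpha> \<le> 8 powr \<bar>\<alpha>\<bar> * (1 - (norm z)\<^sup>2) powr \<alpha>"
          using tube_geometry(4,5)[OF w1 True] h by (intro powr_comparable) (auto simp: h_def)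
        also have "(1 - (norm z)\<^sup>2) powr \<alpha> = bweight \<alpha> z"
          using ball[OF True] by (simp add: bweight_def)
        finally have "h powr \<alpha> / c \<le> C * (k * bweight \<alpha> z)"
          using c(1) k(1) by (simp add: C_def field_simps)
        then have "ennreal (h powr \<alpha> / c) \<le> ennreal C * ennreal (k * bweight \<alpha> z)"
          using C k(1) by (simp add: ennreal_mult[symmetric] ennreal_leI)
        then show ?thesis unfolding mult.assoc[symmetric] by (intro mult_right_mono) auto
      qed auto
    qed
    also have "\<dots> = ennreal C * (\<integral>\<^sup>+z. ennreal (k * bweight \<alpha> z) * (indicator (tube w) (z - w) * F z) \<partial>lborel)"
      by (intro nn_integral_cmult) measurable
    also have "(\<integral>\<^sup>+z. ennreal (k * bweight \<alpha> z) * (indicator (tube w) (z - w) * F z) \<partial>lborel)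
      = (\<integral>\<^sup>+z. indicator (tube w) (z - w) * F z \<partial>dv \<alpha>)"
      unfolding k(2) by (subst nn_integral_density) auto
    also have "\<dots> = (\<integral>\<^sup>+z. indicator (tube w) (z - w) * ennreal (\<psi> (norm (f z))) \<partial>dv \<alpha>)"
      using ball by (intro nn_integral_cong) (auto simp: F_def indicator_def)
    finally show ?thesis by (simp add: h_def)
  qed
  then show ?thesis using C by blast
qed

section \<open>Modular and Luxemburg norm\<close>

lemma sets_dv [simp, measurable_cong]: "sets (dv \<alpha>) = sets borel"
  and space_dv [simp]: "space (dv \<alpha>) = UNIV"
  by (simp_all add: dv_def)

lemma AE_dv: "\<alpha> > -1 \<Longrightarrow> AE z in (dv \<alpha> :: (complex ^ 'n) measure). z \<in> unit_ball"
proof -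
  assume "\<alpha> > -1"
  then obtain k where k: "(dv \<alpha> :: (complex ^ 'n) measure) = density lborel (\<lambda>z. ennreal (k * bweight \<alpha> z))"
    using dv_eq_density by blast
  show ?thesis
    unfolding k by (subst AE_density) (auto simp: bweight_def split: split_indicator)
qed

lemma dv_window_upper:
  assumes "\<alpha> > -1"
  shows "\<exists>C>0. \<forall>e t. norm e = 1 \<longrightarrow> 0 < t \<longrightarrow>
     emeasure (dv \<alpha>) (window (e :: complex ^ 'n) t) \<le> ennreal (C * t powr (real CARD('n) + \<alpha> + 1))"
proof -
  obtain k where k: "k > 0" "(dv \<alpha> :: (complex ^ 'n) measure) = density lborel (\<lambda>z. ennreal (k * bweight \<alpha> z))"
    using dv_eq_density[OF assms] by blast
  obtain C where C: "C > 0" and W: "\<And>e t. norm e = 1 \<Longrightarrow> 0 < t \<Longrightarrow>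
     (\<integral>\<^sup>+z. indicator (window (e :: complex ^ 'n) t) z * ennreal (bweight \<alpha> z) \<partial>lborel)
       \<le> ennreal (C * t powr (real CARD('n) + 1 + \<alpha>))"
    using weighted_window_upper[OF assms, where ?'n = 'n] by blast
  have "emeasure (dv \<alpha>) (window e t) \<le> ennreal (k * C * t powr (real CARD('n) + \<alpha> + 1))"
    if e: "norm e = 1" and t: "0 < t" for e :: "complex ^ 'n" and t
  proof -
    have [measurable]: "window e t \<in> sets borel" by (rule borel_open[OF open_window])
    have "emeasure (dv \<alpha>) (window e t) = (\<integral>\<^sup>+z. ennreal k * (indicator (window e t) z * ennreal (bweight \<alpha> z)) \<partial>lborel)"
      unfolding k(2) using k(1) by (subst emeasure_density) (auto intro!: nn_integral_cong simp: ennreal_mult mult_ac)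
    also have "\<dots> = ennreal k * (\<integral>\<^sup>+z. indicator (window e t) z * ennreal (bweight \<alpha> z) \<partial>lborel)"
      by (intro nn_integral_cmult) measurable
    also have "\<dots> \<le> ennreal k * ennreal (C * t powr (real CARD('n) + 1 + \<alpha>))"
      using W e t by (intro mult_left_mono) auto
    also have "\<dots> = ennreal (k * C * t powr (real CARD('n) + \<alpha> + 1))"
      using k(1) C by (simp add: ennreal_mult[symmetric] add_ac mult_ac)
    finally show ?thesis .
  qed
  then show ?thesis using k(1) C by (intro exI[of _ "k * C"]) auto
qed

lemma finite_measure_dv:
  assumes "\<alpha> > -1" shows "finite_measure (dv \<alpha> :: (complex ^ 'n) measure)"
proof
  define e :: "complex ^ 'n" where "e = axis undefined 1"
  have e: "norm e = 1" by (simp add: e_def)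
  obtain C where C: "\<forall>e t. norm e = 1 \<longrightarrow> 0 < t \<longrightarrow>
     emeasure (dv \<alpha>) (window (e :: complex ^ 'n) t) \<le> ennreal (C * t powr (real CARD('n) + \<alpha> + 1))"
    using dv_window_upper[OF assms, where ?'n = 'n] by blast
  from C[rule_format, OF e, of 2]
  have "emeasure (dv \<alpha>) (window e 2) \<le> ennreal (C * 2 powr (real CARD('n) + \<alpha> + 1))"
    by simp
  moreover have "emeasure (dv \<alpha>) (UNIV :: (complex ^ 'n) set) = emeasure (dv \<alpha>) (window e 2)"
    using AE_dv[OF assms, where ?'n = 'n] by (intro emeasure_eq_AE) (auto simp: window_eq_unit_ball[OF e])
  ultimately show "emeasure (dv \<alpha>) (space (dv \<alpha> :: (complex ^ 'n) measure)) \<noteq> \<infinity>"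
    by (auto simp: top_unique)
qed

section \<open>Closure properties of holomorphic functions of several variables\<close>

lemma holo_fun_on_diff:
  assumes "holo_fun_on U f" "holo_fun_on U g" shows "holo_fun_on U (\<lambda>z. f z - g z)"
  unfolding holo_fun_on_def
proof
  fix z assume "z \<in> U"
  then obtain K L where K: "(f has_derivative K) (at z)" "\<And>c v. K (c *s v) = c * K v"
    and L: "(g has_derivative L) (at z)" "\<And>c v. L (c *s v) = c * L v"
    using assms unfolding holo_fun_on_def by blast
  show "\<exists>L. ((\<lambda>z. f z - g z) has_derivative L) (at z) \<and> (\<forall>c v. L (c *s v) = c * L v)"
    using has_derivative_diff[OF K(1) L(1)]
    by (intro exI[of _ "\<lambda>v. K v - L v"]) (simp add: K(2) L(2) right_diff_distrib)
qed

lemma holo_fun_on_cmult: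
  assumes "holo_fun_on U f" shows "holo_fun_on U (\<lambda>z. c * f z)"
  unfolding holo_fun_on_def
proof
  fix z assume "z \<in> U"
  then obtain K where K: "(f has_derivative K) (at z)" "\<And>c v. K (c *s v) = c * K v"
    using assms unfolding holo_fun_on_def by blast
  show "\<exists>L. ((\<lambda>z. c * f z) has_derivative L) (at z) \<and> (\<forall>c v. L (c *s v) = c * L v)"
    using has_derivative_mult_right[OF K(1), of c]
    by (intro exI[of _ "\<lambda>v. c * K v"]) (simp add: K(2) mult.left_commute)
qed

lemma holo_fun_on_cinner:
  assumes "\<And>z. z \<in> U \<Longrightarrow> G field_differentiable (at (cinner z a))"
  shows "holo_fun_on U (\<lambda>z. G (cinner z a))"
  unfolding holo_fun_on_def
proof
  fix z assume "z \<in> U"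
  then obtain d where d: "(G has_derivative ((*) d)) (at (cinner z a))"
    using assms unfolding field_differentiable_def has_field_derivative_def by blast
  have "((\<lambda>z. cinner z a) has_derivative (\<lambda>v. cinner v a)) (at z)"
    by (rule bounded_linear_imp_has_derivative[OF bounded_linear_cinner])
  from has_derivative_compose[OF this d]
  show "\<exists>L. ((\<lambda>z. G (cinner z a)) has_derivative L) (at z) \<and> (\<forall>c v. L (c *s v) = c * L v)"
    by (auto simp: cinner_smult_left)
qed

lemma comp_op_holo:
  fixes \<phi> :: "complex ^ 'n \<Rightarrow> complex ^ 'm"
  assumes f: "holo_fun_on V f" and \<phi>: "holo_map_on U \<phi>" "\<forall>z\<in>U. \<phi> z \<in> V"
  shows "holo_fun_on U (\<lambda>z. f (\<phi> z))"
  unfolding holo_fun_on_def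
proof
  fix z assume z: "z \<in> U"
  have "\<forall>j. \<exists>L. ((\<lambda>z. \<phi> z $ j) has_derivative L) (at z) \<and> (\<forall>c v. L (c *s v) = c * L v)"
    using \<phi>(1) z unfolding holo_map_on_def holo_fun_on_def by blast
  then obtain L where L: "\<And>j. ((\<lambda>z. \<phi> z $ j) has_derivative L j) (at z)" "\<And>j c v. L j (c *s v) = c * L j v"
    by metis
  have D: "(\<phi> has_derivative (\<lambda>v. \<chi> j. L j v)) (at z)"
    unfolding has_derivative_componentwise_within[of \<phi>]
    by (auto simp: Basis_vec_def inner_axis intro!: has_derivative_inner_left L(1))
  obtain K where K: "(f has_derivative K) (at (\<phi> z))" "\<And>c v. K (c *s v) = c * K v"
    using f \<phi>(2) z unfolding holo_fun_on_def by blast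
  have "(\<chi> j. L j (c *s v)) = c *s (\<chi> j. L j v)" for c v by (simp add: vec_eq_iff L(2))
  then show "\<exists>L. ((\<lambda>z. f (\<phi> z)) has_derivative L) (at z) \<and> (\<forall>c v. L (c *s v) = c * L v)"
    using has_derivative_compose[OF D K(1)] K(2) by (intro exI conjI) auto
qed

lemma holo_map_on_continuous: "holo_map_on U \<phi> \<Longrightarrow> continuous_on U \<phi>"
  using continuous_on_vec_lambda[of U "\<lambda>j z. \<phi> z $ j"]
  by (simp add: holo_map_on_def holo_fun_onD_continuous)

context orlicz
begin

text \<open>With the indicator the integrand becomes Borel on the whole space, although
  \<open>f\<close> is arbitrary outside the ball.\<close>

lemma orlicz_mod_eq:
  assumes "\<alpha> > -1"
  shows "orlicz_mod \<psi> \<alpha> f C = (\<integral>\<^sup>+z. indicator unit_ball z * ennreal (\<psi> (1 / C * norm (f z))) \<partial>(dv \<alpha> :: (complex ^ 'n) measure))"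
  unfolding orlicz_mod_def using AE_dv[OF assms, where ?'n = 'n]
  by (intro nn_integral_cong_AE) (auto elim!: eventually_mono)

lemma orlicz_mod_antimono:
  assumes "0 < C" "C \<le> D" shows "orlicz_mod \<psi> \<alpha> f D \<le> orlicz_mod \<psi> \<alpha> f C"
  unfolding orlicz_mod_def using assms by (intro nn_integral_mono ennreal_leI mono divide_left_mono) auto

lemma orlicz_mod_scale:
  assumes "\<alpha> > -1" "continuous_on unit_ball (f :: complex ^ 'n \<Rightarrow> complex)" "0 < C" "1 \<le> t"
  shows "orlicz_mod \<psi> \<alpha> f (t * C) \<le> ennreal (1 / t) * orlicz_mod \<psi> \<alpha> f C"
proof -
  have "orlicz_mod \<psi> \<alpha> f (t * C)
      \<le> (\<integral>\<^sup>+z. ennreal (1 / t) * (indicator unit_ball z * ennreal (\<psi> (1 / C * norm (f z)))) \<partial>dv \<alpha>)"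
    unfolding orlicz_mod_eq[OF assms(1)]
  proof (intro nn_integral_mono)
    fix z
    have "\<psi> (1 / t * (1 / C * norm (f z))) \<le> 1 / t * \<psi> (1 / C * norm (f z))"
      using assms by (intro scale_le) auto
    then show "indicator unit_ball z * ennreal (\<psi> (1 / (t * C) * norm (f z)))
        \<le> ennreal (1 / t) * (indicator unit_ball z * ennreal (\<psi> (1 / C * norm (f z))))"
      using assms by (auto simp: ennreal_mult[symmetric] indicator_def intro!: ennreal_leI)
  qed
  also have "\<dots> = ennreal (1 / t) * orlicz_mod \<psi> \<alpha> f C"
    unfolding orlicz_mod_eq[OF assms(1)] using assms measurable_modulus[OF assms(2), of "1 / C"]
    by (intro nn_integral_cmult) auto
  finally show ?thesis .
qed

text \<open>Monotonicity suffices: half the sum of two values is at most their maximum, and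
  \<open>\<psi>\<close> of the maximum is at most the sum of the two values of
  \<open>\<psi>\<close>.\<close>

lemma orlicz_mod_diff:
  assumes "\<alpha> > -1" "continuous_on unit_ball (f :: complex ^ 'n \<Rightarrow> complex)" "continuous_on unit_ball g" "0 < C"
  shows "orlicz_mod \<psi> \<alpha> (\<lambda>z. f z - g z) (2 * C) \<le> orlicz_mod \<psi> \<alpha> f C + orlicz_mod \<psi> \<alpha> g C"
proof -
  have "orlicz_mod \<psi> \<alpha> (\<lambda>z. f z - g z) (2 * C)
      \<le> (\<integral>\<^sup>+z. indicator unit_ball z * ennreal (\<psi> (1 / C * norm (f z))) + indicator unit_ball z * ennreal (\<psi> (1 / C * norm (g z))) \<partial>dv \<alpha>)"
    unfolding orlicz_mod_eq[OF assms(1)]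
  proof (intro nn_integral_mono)
    fix z
    define x y where "x = 1 / C * norm (f z)" and "y = 1 / C * norm (g z)"
    have xy: "0 \<le> x" "0 \<le> y" using assms by (auto simp: x_def y_def)
    have "1 / (2 * C) * norm (f z - g z) \<le> 1 / (2 * C) * (norm (f z) + norm (g z))"
      using assms by (intro mult_left_mono norm_triangle_ineq4) auto
    also have "\<dots> = x / 2 + y / 2" using assms by (simp add: x_def y_def field_simps)
    also have "\<dots> \<le> max x y" by auto
    finally have "\<psi> (1 / (2 * C) * norm (f z - g z)) \<le> \<psi> (max x y)"
      using assms by (intro mono) auto
    also have "\<dots> \<le> \<psi> x + \<psi> y"
      using xy by (auto simp: max_def)
    finally show "indicator unit_ball z * ennreal (\<psi> (1 / (2 * C) * norm (f z - g z)))
      \<le> indicator unit_ball z * ennreal (\<psi> (1 / C * norm (f z))) + indicator unit_ball z * ennreal (\<psi> (1 / C * norm (g z)))"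
      using xy unfolding x_def[symmetric] y_def[symmetric]
      by (auto simp: indicator_def ennreal_plus[symmetric] simp del: ennreal_plus intro!: ennreal_leI)
  qed
  also have "\<dots> = orlicz_mod \<psi> \<alpha> f C + orlicz_mod \<psi> \<alpha> g C"
    unfolding orlicz_mod_eq[OF assms(1)]
    using assms measurable_modulus[OF assms(2), of "1 / C"] measurable_modulus[OF assms(3), of "1 / C"]
    by (intro nn_integral_add) auto
  finally show ?thesis .
qed

lemma bergman_orliczI:
  "holo_fun_on unit_ball f \<Longrightarrow> 0 < C \<Longrightarrow> orlicz_mod \<psi> \<alpha> f C \<le> 1 \<Longrightarrow> f \<in> bergman_orlicz \<psi> \<alpha>"
  unfolding bergman_orlicz_def using order_le_less_trans[of "orlicz_mod \<psi> \<alpha> f C" 1 \<infinity>] by auto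

lemma bergman_orliczD:
  assumes "\<alpha> > -1" "f \<in> bergman_orlicz \<psi> \<alpha>"
  shows "holo_fun_on unit_ball f" "\<exists>C>0. orlicz_mod \<psi> \<alpha> (f :: complex ^ 'n \<Rightarrow> complex) C \<le> 1"
proof -
  show h: "holo_fun_on unit_ball f" using assms by (simp add: bergman_orlicz_def)
  obtain C where C: "C > 0" "orlicz_mod \<psi> \<alpha> f C < \<infinity>"
    using assms by (auto simp: bergman_orlicz_def)
  obtain m where m: "orlicz_mod \<psi> \<alpha> f C = ennreal m" "0 \<le> m"
    using C(2) by (cases "orlicz_mod \<psi> \<alpha> f C") auto
  \<comment> \<open>The summand \<open>1\<close> makes the factor at least one, as
    \<open>orlicz_mod_scale\<close> demands, also when \<open>m\<close> is small.\<close>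
  have "orlicz_mod \<psi> \<alpha> f ((m + 1) * C) \<le> ennreal (1 / (m + 1)) * orlicz_mod \<psi> \<alpha> f C"
    using m C by (intro orlicz_mod_scale assms holo_fun_onD_continuous h) auto
  also have "\<dots> = ennreal (1 / (m + 1) * m)"
    using m by (simp add: ennreal_mult[symmetric])
  also have "\<dots> \<le> 1" using m by (auto simp: ennreal_le_1 divide_simps)
  finally show "\<exists>C>0. orlicz_mod \<psi> \<alpha> f C \<le> 1" using C m by (intro exI[of _ "(m + 1) * C"]) auto
qed

lemma bergman_orlicz_diff:
  assumes "\<alpha> > -1" "f \<in> bergman_orlicz \<psi> \<alpha>" "g \<in> bergman_orlicz \<psi> \<alpha>"
  shows "(\<lambda>z. f z - g z) \<in> bergman_orlicz \<psi> (\<alpha> :: real) \<and> holo_fun_on unit_ball (\<lambda>z :: complex ^ 'n. f z - g z)"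
proof -
  note f = bergman_orliczD[OF assms(1,2)] and g = bergman_orliczD[OF assms(1,3)]
  obtain C D where C: "C > 0" "orlicz_mod \<psi> \<alpha> f C \<le> 1" and D: "D > 0" "orlicz_mod \<psi> \<alpha> g D \<le> 1"
    using f g by blast
  define E where "E = max C D"
  have E: "E > 0" "orlicz_mod \<psi> \<alpha> f E \<le> 1" "orlicz_mod \<psi> \<alpha> g E \<le> 1"
    using C D orlicz_mod_antimono[of C E \<alpha> f] orlicz_mod_antimono[of D E \<alpha> g] by (auto simp: E_def)
  have "orlicz_mod \<psi> \<alpha> (\<lambda>z. f z - g z) (2 * E) \<le> orlicz_mod \<psi> \<alpha> f E + orlicz_mod \<psi> \<alpha> g E"
    using f g E by (intro orlicz_mod_diff assms holo_fun_onD_continuous) auto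
  also have "\<dots> \<le> 1 + 1" using E by (intro add_mono) auto
  also have "\<dots> < \<infinity>" by simp
  finally show ?thesis using E f(1) g(1) holo_fun_on_diff unfolding bergman_orlicz_def by (auto intro!: exI[of _ "2 * E"])
qed

lemma lux_norm_nonneg:
  assumes "\<alpha> > -1" "f \<in> bergman_orlicz \<psi> \<alpha>" shows "0 \<le> lux_norm \<psi> \<alpha> (f :: complex ^ 'n \<Rightarrow> complex)"
  unfolding lux_norm_def using bergman_orliczD(2)[OF assms] by (intro cInf_greatest) auto

lemma lux_norm_le: "0 < C \<Longrightarrow> orlicz_mod \<psi> \<alpha> f C \<le> 1 \<Longrightarrow> lux_norm \<psi> \<alpha> f \<le> C"
  unfolding lux_norm_def by (intro cInf_lower bdd_belowI[of _ 0]) auto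

text \<open>The strict inequality spares a proof that the infimum in the Luxemburg norm is
  attained.\<close>

lemma lux_norm_less:
  assumes "\<alpha> > -1" "f \<in> bergman_orlicz \<psi> \<alpha>" "lux_norm \<psi> \<alpha> (f :: complex ^ 'n \<Rightarrow> complex) < C"
  shows "orlicz_mod \<psi> \<alpha> f C \<le> 1"
proof -
  have "\<exists>D\<in>{C. C > 0 \<and> orlicz_mod \<psi> \<alpha> f C \<le> 1}. D < C"
    using assms(3) bergman_orliczD(2)[OF assms(1,2)] unfolding lux_norm_def
    by (subst (asm) cInf_less_iff) (auto intro!: bdd_belowI[of _ 0])
  then obtain D where "D > 0" "orlicz_mod \<psi> \<alpha> f D \<le> 1" "D < C" by auto
  then show ?thesis using orlicz_mod_antimono[of D C \<alpha> f] by auto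
qed

end

section \<open>Point evaluations, test functions and the Carleson condition\<close>

context orlicz
begin

definition gauge :: "real \<Rightarrow> complex ^ 'n \<Rightarrow> real" where
  "gauge \<alpha> z = \<psi>i ((1 / (1 - norm z)) powr (real CARD('n) + \<alpha> + 1))"

lemma gauge_pos: "norm z < 1 \<Longrightarrow> 0 < gauge \<alpha> z"
  unfolding gauge_def by (intro inv_pos) auto

lemma psi_gauge: "\<psi> (gauge \<alpha> (z :: complex ^ 'n)) = (1 / (1 - norm z)) powr (real CARD('n) + \<alpha> + 1)"
  unfolding gauge_def by (intro inv_right) auto

text \<open>Points with comparable distances to the sphere have comparable gauges, because
  \<open>inv_scale\<close> lets the constant leave \<open>\<psi>i\<close>. This is applied to a
  point and its tube neighbours in both directions.\<close>

lemma gauge_scale: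
  fixes z w :: "complex ^ 'n"
  assumes "\<alpha> > -1" "norm w < 1" "1 \<le> K" "1 - norm w \<le> K * (1 - norm z)"
  shows "gauge \<alpha> z \<le> K powr (real CARD('n) + \<alpha> + 1) * gauge \<alpha> w"
proof -
  have z: "norm z < 1" proof -
    have "0 < K * (1 - norm z)" using assms by simp
    then show ?thesis using assms by (simp add: zero_less_mult_iff)
  qed
  have "1 / (1 - norm z) \<le> K * (1 / (1 - norm w))"
    using assms z by (simp add: field_simps)
  then have "(1 / (1 - norm z)) powr (real CARD('n) + \<alpha> + 1) \<le> (K * (1 / (1 - norm w))) powr (real CARD('n) + \<alpha> + 1)"
    using assms z by (intro powr_mono2) auto
  also have "\<dots> = K powr (real CARD('n) + \<alpha> + 1) * (1 / (1 - norm w)) powr (real CARD('n) + \<alpha> + 1)"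
    by (rule powr_mult)
  finally have "gauge \<alpha> z \<le> \<psi>i (K powr (real CARD('n) + \<alpha> + 1) * (1 / (1 - norm w)) powr (real CARD('n) + \<alpha> + 1))"
    unfolding gauge_def by (intro inv_mono) auto
  also have "\<dots> \<le> K powr (real CARD('n) + \<alpha> + 1) * gauge \<alpha> w"
    unfolding gauge_def using assms by (intro inv_scale) (auto intro: ge_one_powr_ge_zero)
  finally show ?thesis .
qed

text \<open>The integral over a tube is at most the modular, hence at most one, so
  \<open>\<psi> (norm (f w) / C)\<close> is at most a constant times
  \<open>\<psi> (gauge \<alpha> w)\<close>; then \<open>inv_scale\<close> extracts the
  constant.\<close>

lemma pointwise_bound:
  assumes "\<alpha> > -1"
  shows "\<exists>K\<ge>1. \<forall>f C w. holo_fun_on unit_ball f \<longrightarrow> 0 < C \<longrightarrow> orlicz_mod \<psi> \<alpha> f C \<le> 1 \<longrightarrow> w \<in> unit_ball \<longrightarrow>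
     norm (f w) \<le> C * (K * gauge \<alpha> (w :: complex ^ 'n))"
proof -
  obtain C1 where C1: "C1 > 0" and sub: "\<And>f w. holo_fun_on unit_ball f \<Longrightarrow> w \<in> unit_ball \<Longrightarrow>
    ennreal (\<psi> (norm (f w)) * (1 - norm w) powr (real CARD('n) + 1 + \<alpha>))
      \<le> ennreal C1 * (\<integral>\<^sup>+z. indicator (tube w) (z - w) * ennreal (\<psi> (norm (f z))) \<partial>(dv \<alpha> :: (complex ^ 'n) measure))"
    using submean_dv[OF assms, where ?'n = 'n] by blast
  define K where "K = max 1 C1"
  have "norm (f w) \<le> C * (K * gauge \<alpha> w)"
    if f: "holo_fun_on unit_ball f" and C: "0 < C" "orlicz_mod \<psi> \<alpha> f C \<le> 1" and w: "w \<in> unit_ball" for f C and w :: "complex ^ 'n"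
  proof -
    define n1 where "n1 = real CARD('n) + \<alpha> + 1"
    define h where "h = 1 - norm w"
    have h: "0 < h" using w by (simp add: h_def unit_ball_def)
    have "ennreal (\<psi> (norm (complex_of_real (1 / C) * f w)) * h powr n1)
      \<le> ennreal C1 * (\<integral>\<^sup>+z. indicator (tube w) (z - w) * ennreal (\<psi> (norm (complex_of_real (1 / C) * f z))) \<partial>dv \<alpha>)"
      using sub[OF holo_fun_on_cmult[OF f, of "complex_of_real (1 / C)"] w] by (simp add: h_def n1_def add_ac)
    also have "\<dots> \<le> ennreal C1 * orlicz_mod \<psi> \<alpha> f C"
      unfolding orlicz_mod_def using C(1) by (intro mult_left_mono nn_integral_mono) (auto simp: norm_mult norm_divide indicator_def)
    also have "\<dots> \<le> ennreal C1 * 1" using C by (intro mult_left_mono) auto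
    finally have "\<psi> (norm (f w) / C) * h powr n1 \<le> C1"
      using C1 C(1) by (simp add: norm_mult norm_divide)
    then have "\<psi> (norm (f w) / C) \<le> C1 * (1 / h) powr n1"
      using h by (simp add: powr_divide field_simps)
    also have "\<dots> \<le> K * (1 / h) powr n1"
      by (intro mult_right_mono) (auto simp: K_def)
    finally have "norm (f w) / C \<le> \<psi>i (K * (1 / h) powr n1)"
      using C by (subst le_inv_iff) (auto simp: K_def)
    also have "\<dots> \<le> K * gauge \<alpha> w"
      unfolding gauge_def h_def[symmetric] n1_def[symmetric] by (intro inv_scale) (auto simp: K_def)
    finally show ?thesis using C by (simp add: field_simps)
  qed
  then show ?thesis by (intro exI[of _ K]) (auto simp: K_def)
qed

text \<open>A natural exponent avoids branches of complex powers; it only has to exceed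
  \<open>N + \<alpha> + 1\<close>.\<close>

definition testf :: "real \<Rightarrow> nat \<Rightarrow> complex ^ 'n \<Rightarrow> complex ^ 'n \<Rightarrow> complex" where
  "testf \<alpha> p a z = of_real (gauge \<alpha> a) * (of_real (1 - norm a) / (1 - cinner z a)) ^ p"

lemma one_minus_cinner:
  fixes a z :: "complex ^ 'n"
  assumes "norm a < 1" "norm z < 1"
  shows "1 - norm a \<le> norm (1 - cinner z a)" "1 - norm z \<le> norm (1 - cinner z a)" "1 - cinner z a \<noteq> 0"
proof -
  have "norm (cinner z a) \<le> norm z * norm a" by (rule norm_cinner_le)
  moreover have "norm z * norm a \<le> norm a" "norm z * norm a \<le> norm z"
    using assms by (auto intro: mult_left_le_one_le mult_right_le_one_le)
  moreover have "1 - norm (cinner z a) \<le> norm (1 - cinner z a)"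
    using norm_triangle_ineq2[of 1 "cinner z a"] by simp
  ultimately show "1 - norm a \<le> norm (1 - cinner z a)" "1 - norm z \<le> norm (1 - cinner z a)" by auto
  then show "1 - cinner z a \<noteq> 0" using assms by auto
qed

lemma testf_holo: assumes "norm (a :: complex ^ 'n) < 1" shows "holo_fun_on unit_ball (testf \<alpha> p a)"
  unfolding testf_def
proof (rule holo_fun_on_cinner[where G = "\<lambda>c. of_real (gauge \<alpha> a) * (of_real (1 - norm a) / (1 - c)) ^ p"])
  fix z :: "complex ^ 'n" assume "z \<in> unit_ball"
  then have "1 - cinner z a \<noteq> 0" using one_minus_cinner(3)[OF assms] by (simp add: unit_ball_def)
  then show "(\<lambda>c. of_real (gauge \<alpha> a) * (of_real (1 - norm a) / (1 - c)) ^ p) field_differentiable at (cinner z a)"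
    by (intro derivative_intros) auto
qed

lemma norm_testf:
  assumes "norm a < 1"
  shows "norm (testf \<alpha> p a z) = gauge \<alpha> a * ((1 - norm a) / norm (1 - cinner z a)) ^ p"
  using gauge_pos[OF assms, of \<alpha>] assms
  by (simp add: testf_def norm_mult norm_power norm_divide del: of_real_diff)

text \<open>Where \<open>norm (1 - cinner z a)\<close> is about \<open>2 ^ k * (1 - norm a)\<close>,
  the function is at most \<open>gauge \<alpha> a / 2 ^ (k * p)\<close> and \<open>scale_le\<close>
  takes the small factor out of \<open>\<psi>\<close>. The region has measure of order
  \<open>(2 ^ k * (1 - norm a)) powr n1\<close>, whose size at \<open>k = 0\<close> cancels
  \<open>\<psi> (gauge \<alpha> a)\<close>, leaving a geometric series with ratio
  \<open>2 powr (n1 - p)\<close>.\<close>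

lemma testf_mod:
  assumes "\<alpha> > -1" and p: "real p > real CARD('n) + \<alpha> + 1"
  shows "\<exists>K\<ge>1. \<forall>a. norm (a :: complex ^ 'n) < 1 \<longrightarrow> orlicz_mod \<psi> \<alpha> (testf \<alpha> p a) K \<le> 1"
proof -
  define n1 where "n1 = real CARD('n) + \<alpha> + 1"
  obtain C where C: "C > 0" and W: "\<And>e t. norm e = 1 \<Longrightarrow> 0 < t \<Longrightarrow>
     emeasure (dv \<alpha>) (window (e :: complex ^ 'n) t) \<le> ennreal (C * t powr n1)"
    using dv_window_upper[OF assms(1), where ?'n = 'n] unfolding n1_def by blast
  define q where "q = 2 powr n1 / 2 ^ p"
  have q: "0 \<le> q" "q < 1"
    using p by (auto simp: q_def n1_def powr_realpow[symmetric])
  define K where "K = max 1 (C * 4 powr n1 / (1 - q))"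
  have "orlicz_mod \<psi> \<alpha> (testf \<alpha> p a) K \<le> 1" if a: "norm a < 1" for a :: "complex ^ 'n"
  proof -
    define h where "h = 1 - norm a"
    have h: "0 < h" using a by (simp add: h_def)
    \<comment> \<open>Windows are centred on the sphere, so \<open>a\<close> is projected to it; for
      \<open>a = 0\<close> any unit vector will do.\<close>
    define e where "e = (if a = 0 then axis undefined 1 else a /\<^sub>R norm a)"
    have e: "norm e = 1" by (simp add: e_def)
    have ae: "a = norm a *\<^sub>R e" by (auto simp: e_def)
    \<comment> \<open>In the \<open>k\<close>-th region
      \<open>norm (1 - cinner z a) < 2 * 2 ^ k * h\<close>, and replacing \<open>a\<close> by
      \<open>e\<close> costs at most another \<open>h\<close>; the factor \<open>4\<close> covers
      both.\<close>
    define S where "S = (\<lambda>k. window e (4 * 2 ^ k * h))"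
    have [measurable]: "S k \<in> sets borel" for k unfolding S_def by (rule borel_open[OF open_window])
    have pt: "ennreal (\<psi> (1 / K * norm (testf \<alpha> p a z))) \<le> ennreal (\<psi> (gauge \<alpha> a) / K) * (\<Sum>k. ennreal (1 / 2 ^ p) ^ k * indicator (S k) z)"
      if z: "z \<in> unit_ball" for z
    proof -
      define y where "y = h / norm (1 - cinner z a)"
      have z1: "norm z < 1" using z by (simp add: unit_ball_def)
      have d: "0 < norm (1 - cinner z a)" "h \<le> norm (1 - cinner z a)"
        using one_minus_cinner[OF a z1] by (auto simp: h_def)
      have y: "0 < y" "y \<le> 1" using d h by (auto simp: y_def)
      obtain k where "(1 / 2) ^ Suc k < y" "y \<le> (1 / 2) ^ k" using dyadic_scale y by blast
      then have k: "y * 2 ^ k \<le> 1" "1 < y * 2 ^ Suc k" by (simp_all add: power_divide field_simps)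
      have "norm (1 - cinner z a) < 2 * 2 ^ k * h"
        using k(2) d h by (simp add: y_def field_simps)
      moreover have "norm (1 - cinner z e) \<le> norm (1 - cinner z a) + h"
      proof -
        have "1 - cinner z e = (1 - cinner z a) - of_real h * cinner z e"
          using cinner_scaleR_right[of z "norm a" e] by (simp add: ae[symmetric] h_def algebra_simps)
        also have "norm \<dots> \<le> norm (1 - cinner z a) + h * norm (cinner z e)"
          using h by (intro norm_triangle_le_diff) (simp add: norm_mult)
        also have "\<dots> \<le> norm (1 - cinner z a) + h * 1"
          using norm_cinner_le[of z e] e z1 h by (intro add_left_mono mult_left_mono) auto
        finally show ?thesis by simp
      qed
      moreover have "h \<le> 2 ^ k * h" using h one_le_power[of "2::real" k] by simp
      ultimately have "norm (1 - cinner z e) < 4 * 2 ^ k * h" using h by linarith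
      then have zS: "z \<in> S k" using z by (simp add: S_def window_def)
      have "y ^ p \<le> (1 / 2 ^ k) ^ p"
        using k(1) y by (intro power_mono) (auto simp: field_simps)
      also have "\<dots> = (1 / 2 ^ p) ^ k" by (simp add: power_divide power_mult[symmetric] mult.commute)
      finally have yp: "y ^ p \<le> (1 / 2 ^ p) ^ k" .
      have K1: "1 / K \<le> 1" "0 < 1 / K" by (auto simp: K_def)
      have "\<psi> (1 / K * norm (testf \<alpha> p a z)) = \<psi> ((1 / K * y ^ p) * gauge \<alpha> a)"
        by (simp add: norm_testf[OF a] y_def h_def mult_ac)
      also have "\<dots> \<le> (1 / K * y ^ p) * \<psi> (gauge \<alpha> a)"
        using gauge_pos[OF a, of \<alpha>] y K1 by (intro scale_le mult_le_one mult_nonneg_nonneg) (auto intro: power_le_one)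
      also have "\<dots> \<le> (1 / K * (1 / 2 ^ p) ^ k) * \<psi> (gauge \<alpha> a)"
        using yp K1 gauge_pos[OF a, of \<alpha>] by (intro mult_right_mono mult_left_mono) auto
      finally have "\<psi> (1 / K * norm (testf \<alpha> p a z)) \<le> (\<psi> (gauge \<alpha> a) / K) * (1 / 2 ^ p) ^ k" by (simp add: mult_ac)
      then have "ennreal (\<psi> (1 / K * norm (testf \<alpha> p a z))) \<le> ennreal (\<psi> (gauge \<alpha> a) / K) * (ennreal (1 / 2 ^ p) ^ k * indicator (S k) z)"
        using zS gauge_pos[OF a, of \<alpha>] K1 by (simp add: ennreal_power ennreal_mult[symmetric] ennreal_leI)
      also have "\<dots> \<le> ennreal (\<psi> (gauge \<alpha> a) / K) * (\<Sum>k. ennreal (1 / 2 ^ p) ^ k * indicator (S k) z)"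
        by (intro mult_left_mono le_suminf_ennreal) auto
      finally show ?thesis .
    qed
    have "orlicz_mod \<psi> \<alpha> (testf \<alpha> p a) K \<le> (\<integral>\<^sup>+z. ennreal (\<psi> (gauge \<alpha> a) / K) * (\<Sum>k. ennreal (1 / 2 ^ p) ^ k * indicator (S k) z) \<partial>dv \<alpha>)"
      unfolding orlicz_mod_eq[OF assms(1)] using pt by (intro nn_integral_mono) (auto simp: indicator_def)
    also have "\<dots> = ennreal (\<psi> (gauge \<alpha> a) / K) * (\<Sum>k. ennreal (1 / 2 ^ p) ^ k * emeasure (dv \<alpha>) (S k))"
      by (subst nn_integral_cmult, measurable, subst nn_integral_suminf) (auto simp: nn_integral_cmult)
    also have "\<dots> \<le> ennreal (\<psi> (gauge \<alpha> a) / K) * (\<Sum>k. ennreal (C * 4 powr n1 * h powr n1 * q ^ k))"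
    proof (intro mult_left_mono suminf_le)
      fix k
      have "ennreal (1 / 2 ^ p) ^ k * emeasure (dv \<alpha>) (S k) \<le> ennreal ((1 / 2 ^ p) ^ k) * ennreal (C * (4 * 2 ^ k * h) powr n1)"
        unfolding S_def using h by (subst ennreal_power, simp) (rule mult_left_mono[OF W[OF e]], auto)
      also have "\<dots> = ennreal ((1 / 2 ^ p) ^ k * (C * (4 * 2 ^ k * h) powr n1))"
        using C by (intro ennreal_mult[symmetric]) auto
      also have "(4 * 2 ^ k * h) powr n1 = 4 powr n1 * (2 powr n1) ^ k * h powr n1"
        using h by (simp add: powr_mult powr_power powr_powr powr_realpow[symmetric] mult.commute)
      also have "(1 / 2 ^ p) ^ k * (C * (4 powr n1 * (2 powr n1) ^ k * h powr n1)) = C * 4 powr n1 * h powr n1 * q ^ k"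
        by (simp add: q_def power_divide mult_ac)
      finally show "ennreal (1 / 2 ^ p) ^ k * emeasure (dv \<alpha>) (S k) \<le> ennreal (C * 4 powr n1 * h powr n1 * q ^ k)" .
    qed auto
    also have "(\<Sum>k. ennreal (C * 4 powr n1 * h powr n1 * q ^ k)) = ennreal (C * 4 powr n1 * h powr n1 / (1 - q))"
      using q C by (intro geometric_ennreal) auto
    also have "ennreal (\<psi> (gauge \<alpha> a) / K) * \<dots> = ennreal ((\<psi> (gauge \<alpha> a) / K) * (C * 4 powr n1 * h powr n1 / (1 - q)))"
      using q C gauge_pos[OF a, of \<alpha>] by (intro ennreal_mult[symmetric]) (auto simp: K_def intro!: divide_nonneg_pos)
    also have "\<psi> (gauge \<alpha> a) = (1 / h) powr n1"
      by (simp add: psi_gauge h_def n1_def)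
    also have "((1 / h) powr n1 / K) * (C * 4 powr n1 * h powr n1 / (1 - q)) = (C * 4 powr n1 / (1 - q)) / K"
      using h by (simp add: powr_divide)
    also have "ennreal ((C * 4 powr n1 / (1 - q)) / K) \<le> ennreal 1"
    proof (rule ennreal_leI)
      have "d / max 1 d \<le> 1" for d :: real by (auto simp: max_def)
      then show "(C * 4 powr n1 / (1 - q)) / K \<le> 1" unfolding K_def .
    qed
    finally show ?thesis by simp
  qed
  then show ?thesis by (intro exI[of _ K]) (auto simp: K_def)
qed

text \<open>The constant is that of \<open>tube_geometry\<close>: if \<open>a - w\<close> lies in
  \<open>tube w\<close> for some \<open>w\<close> in the ball, then \<open>w\<close> lies in
  \<open>approach a\<close>. On this region, within the ball, the test function at \<open>a\<close>
  exceeds \<open>gauge \<alpha> a / 24 ^ p\<close>.\<close>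

definition approach :: "complex ^ 'n \<Rightarrow> (complex ^ 'n) set" where
  "approach a = {w. norm (1 - cinner w a) < 24 * (1 - norm a)}"

text \<open>Chebyshev's inequality for the composed test function at \<open>a\<close>. All constants
  end up in \<open>A\<close> inside \<open>\<psi>\<close>, where they have to stay.\<close>

lemma carleson:
  fixes \<phi> :: "complex ^ 'n \<Rightarrow> complex ^ 'n"
  assumes "\<beta> > -1" "holo_map_on unit_ball \<phi>" "\<forall>z\<in>unit_ball. \<phi> z \<in> unit_ball" "comp_bounded \<psi> \<beta> \<phi>"
  shows "\<exists>A\<ge>2. \<forall>a\<in>unit_ball. ennreal (\<psi> (gauge \<beta> a / A)) * emeasure (dv \<beta>) {z \<in> unit_ball. \<phi> z \<in> approach a} \<le> 1"
proof -
  obtain p where p: "real CARD('n) + \<beta> + 1 < real p" using reals_Archimedean2 by blast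
  obtain K where K: "K \<ge> 1" "\<And>a. norm (a :: complex ^ 'n) < 1 \<Longrightarrow> orlicz_mod \<psi> \<beta> (testf \<beta> p a) K \<le> 1"
    using testf_mod[OF assms(1) p] by blast
  obtain M where M: "\<And>f. f \<in> bergman_orlicz \<psi> \<beta> \<Longrightarrow> lux_norm \<psi> \<beta> (comp_op \<phi> f) \<le> M * lux_norm \<psi> \<beta> f"
    and cl: "\<And>f. f \<in> bergman_orlicz \<psi> \<beta> \<Longrightarrow> comp_op \<phi> f \<in> bergman_orlicz \<psi> \<beta>"
    using assms(4) unfolding comp_bounded_def by blast
  \<comment> \<open>The bound \<open>M\<close> of the operator may be negative, hence the absolute
    value; the summand puts \<open>A0\<close> strictly above the norm, so
    \<open>lux_norm_less\<close> applies.\<close>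
  define A0 where "A0 = \<bar>M\<bar> * K + 2"
  have A0: "A0 \<ge> 2" using K by (simp add: A0_def)
  have "ennreal (\<psi> (gauge \<beta> a / (24 ^ p * A0))) * emeasure (dv \<beta>) {z \<in> unit_ball. \<phi> z \<in> approach a} \<le> 1"
    if "a \<in> unit_ball" for a
  proof -
    have a: "norm a < 1" using that by (simp add: unit_ball_def)
    define S where "S = {z \<in> unit_ball. \<phi> z \<in> approach a}"
    define f where "f = testf \<beta> p a"
    have f: "f \<in> bergman_orlicz \<psi> \<beta>"
      unfolding f_def using K a by (intro bergman_orliczI[of _ K] testf_holo a) auto
    have "lux_norm \<psi> \<beta> f \<le> K" unfolding f_def using K a by (intro lux_norm_le) auto
    have "lux_norm \<psi> \<beta> (comp_op \<phi> f) \<le> \<bar>M\<bar> * K"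
    proof -
      have "M * lux_norm \<psi> \<beta> f \<le> \<bar>M\<bar> * lux_norm \<psi> \<beta> f"
        using lux_norm_nonneg[OF assms(1) f] by (intro mult_right_mono) auto
      also have "\<dots> \<le> \<bar>M\<bar> * K" using \<open>lux_norm \<psi> \<beta> f \<le> K\<close> by (intro mult_left_mono) auto
      finally show ?thesis using M[OF f] by linarith
    qed
    then have mod: "orlicz_mod \<psi> \<beta> (comp_op \<phi> f) A0 \<le> 1"
      using cl[OF f] by (intro lux_norm_less assms) (auto simp: A0_def)
    have cont: "continuous_on unit_ball \<phi>" by (rule holo_map_on_continuous[OF assms(2)])
    have "openin (top_of_set unit_ball) (unit_ball \<inter> \<phi> -` approach a)"
      using cont continuous_on_open_gen[of \<phi> unit_ball UNIV] unfolding approach_def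
      by (intro continuous_openin_preimage_gen) (auto intro!: open_Collect_less continuous_intros continuous_cinner_left)
    then have "open S"
      by (auto simp: S_def unit_ball_def openin_open_eq vimage_def Int_def)
    then have [measurable]: "S \<in> sets borel" by auto
    have "ennreal (\<psi> (gauge \<beta> a / (24 ^ p * A0))) * emeasure (dv \<beta>) S
        = (\<integral>\<^sup>+z. ennreal (\<psi> (gauge \<beta> a / (24 ^ p * A0))) * indicator S z \<partial>dv \<beta>)"
      by (simp add: nn_integral_cmult)
    also have "\<dots> \<le> orlicz_mod \<psi> \<beta> (comp_op \<phi> f) A0"
      unfolding orlicz_mod_def
    proof (intro nn_integral_mono)
      fix z
      show "ennreal (\<psi> (gauge \<beta> a / (24 ^ p * A0))) * indicator S z \<le> ennreal (\<psi> (norm (comp_op \<phi> f z) / A0))"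
      proof (cases "z \<in> S")
        case True
        then have z: "norm (\<phi> z) < 1" "norm (1 - cinner (\<phi> z) a) < 24 * (1 - norm a)"
          using assms(3) by (auto simp: S_def approach_def unit_ball_def)
        have d: "0 < norm (1 - cinner (\<phi> z) a)" using one_minus_cinner[OF a z(1)] by auto
        have "(1 / 24) ^ p \<le> ((1 - norm a) / norm (1 - cinner (\<phi> z) a)) ^ p"
          using z(2) d by (intro power_mono) (auto simp: field_simps)
        then have "gauge \<beta> a * (1 / 24) ^ p \<le> norm (f (\<phi> z))"
          unfolding f_def norm_testf[OF a] using gauge_pos[OF a, of \<beta>] by (intro mult_left_mono) auto
        then have "gauge \<beta> a / (24 ^ p * A0) \<le> norm (f (\<phi> z)) / A0"
          using A0 by (simp add: power_divide divide_right_mono flip: divide_divide_eq_left)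
        then show ?thesis
          using True gauge_pos[OF a, of \<beta>] A0 by (auto simp: comp_op_def intro!: ennreal_leI mono)
      qed simp
    qed
    also note mod
    finally show ?thesis by (simp add: S_def)
  qed
  moreover have "2 \<le> 24 ^ p * A0"
    using A0 mult_mono[of 1 "24 ^ p" 2 A0] by simp
  ultimately show ?thesis by blast
qed

end

section \<open>Consequences of the nabla-zero condition\<close>

context orlicz
begin

lemma nabla0D:
  assumes "nabla0 \<psi>" "1 < B"
  obtains C x0 where "1 \<le> C" "0 < x0"
    "\<And>x y. x0 \<le> x \<Longrightarrow> x \<le> y \<Longrightarrow> \<psi> (B * x) / \<psi> x \<le> \<psi> (C * B * y) / \<psi> y"
proof -
  obtain C x0 where "1 \<le> C" "\<And>x y. x0 \<le> x \<Longrightarrow> x \<le> y \<Longrightarrow> \<psi> (B * x) / \<psi> x \<le> \<psi> (C * B * y) / \<psi> y"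
    using assms unfolding nabla0_def by meson
  then show ?thesis by (intro that[of C "max 1 x0"]) auto
qed

text \<open>Iterate along \<open>u\<close>, \<open>D * u\<close>, \<open>D ^ 2 * u\<close> and so on
  with \<open>D = C * B\<close>: by the nabla-zero condition each further factor \<open>D\<close>
  multiplies \<open>\<psi>\<close> by at least the initial ratio
  \<open>\<psi> (B * u) / \<psi> u\<close>.\<close>

lemma nabla0_power:
  assumes "nabla0 \<psi>" "1 < B"
  obtains D x0 where "1 \<le> D" "0 < x0" "\<And>u k. x0 \<le> u \<Longrightarrow> \<psi> u * (\<psi> (B * u) / \<psi> u) ^ k \<le> \<psi> (D ^ k * u)"
proof -
  obtain C x0 where C: "1 \<le> C" "0 < x0"
    "\<And>x y. x0 \<le> x \<Longrightarrow> x \<le> y \<Longrightarrow> \<psi> (B * x) / \<psi> x \<le> \<psi> (C * B * y) / \<psi> y"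
    using nabla0D[OF assms] by blast
  define D where "D = C * B"
  have D: "1 \<le> D" unfolding D_def using C(1) assms(2) mult_mono[of 1 C 1 B] by simp
  have "\<psi> u * (\<psi> (B * u) / \<psi> u) ^ k \<le> \<psi> (D ^ k * u)" if "x0 \<le> u" for u k
  proof (induction k)
    case (Suc k)
    have u: "0 < u" using that C(2) by simp
    have Dk: "1 \<le> D ^ k" using D by simp
    then have uD: "u \<le> D ^ k * u" "0 < D ^ k * u" using u by auto
    have "\<psi> u * (\<psi> (B * u) / \<psi> u) ^ Suc k = (\<psi> (B * u) / \<psi> u) * (\<psi> u * (\<psi> (B * u) / \<psi> u) ^ k)" by simp
    also have "\<dots> \<le> (\<psi> (D * (D ^ k * u)) / \<psi> (D ^ k * u)) * \<psi> (D ^ k * u)"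
      using C(3)[OF that uD(1)] Suc.IH u assms(2) uD D by (intro mult_mono) (auto simp: D_def intro!: divide_nonneg_nonneg)
    also have "\<dots> = \<psi> (D ^ Suc k * u)" using pos[OF uD(2)] by (simp add: mult_ac)
    finally show ?case .
  qed auto
  then show ?thesis using that[of D x0] D C(2) by blast
qed

text \<open>With \<open>R = \<psi> (A3 * u) / \<psi> u\<close> the condition gives \<open>\<psi> (v / A) \<ge> \<psi> u powr \<theta> / R\<close> and
  \<open>\<psi> (B * u) \<ge> \<psi> u * R ^ k\<close> for suitable \<open>B\<close>, so a large \<open>k\<close> wins.\<close>

lemma nabla0_absorb:
  assumes nab: "nabla0 \<psi>" and A: "1 < A" and \<theta>: "0 < \<theta>" "\<theta> < 1" and \<eta>: "0 < \<eta>" and A2: "0 \<le> A2"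
  obtains B y0 where "1 \<le> B"
    "\<And>u v. y0 \<le> u \<Longrightarrow> 0 \<le> v \<Longrightarrow> \<psi> v = \<psi> u powr \<theta> \<Longrightarrow> \<psi> (A2 * u) \<le> \<eta> * \<psi> (B * u) powr (1 - \<theta>) * \<psi> (v / A)"
proof -
  obtain C xA where C: "1 \<le> C" "0 < xA"
    "\<And>x y. xA \<le> x \<Longrightarrow> x \<le> y \<Longrightarrow> \<psi> (A * x) / \<psi> x \<le> \<psi> (C * A * y) / \<psi> y"
    using nabla0D[OF nab A] by blast
  \<comment> \<open>This choice makes the single ratio \<open>R\<close> control both losses, that of
    \<open>A2\<close> and that of dividing \<open>v\<close> by \<open>A\<close>.\<close>
  define A3 where "A3 = max A2 (C * A)"
  have "1 * A \<le> C * A" using C A by (intro mult_right_mono) auto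
  then have "1 < C * A" using A by linarith
  then have A3: "1 < A3" "A2 \<le> A3" "C * A \<le> A3" by (auto simp: A3_def)
  obtain D x1 where D: "1 \<le> D" "0 < x1" "\<And>u k. x1 \<le> u \<Longrightarrow> \<psi> u * (\<psi> (A3 * u) / \<psi> u) ^ k \<le> \<psi> (D ^ k * u)"
    using nabla0_power[OF nab A3(1)] by blast
  obtain m where m: "1 / \<eta> < A3 ^ m" using real_arch_pow[OF A3(1)] by blast
  \<comment> \<open>After raising to the power \<open>1 - \<theta>\<close> at least
    \<open>m + 2\<close> powers of \<open>R\<close> must remain: one for
    \<open>\<psi> (A2 * u)\<close>, one for \<open>\<psi> (v / A)\<close>, and \<open>m\<close> to
    absorb \<open>\<eta>\<close>, since \<open>R \<ge> A3\<close>.\<close>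
  obtain k where k: "(real m + 2) / (1 - \<theta>) \<le> real k" using real_arch_simple by blast
  \<comment> \<open>If \<open>\<psi> u \<ge> P\<close> then \<open>\<psi> v\<close> is at least both
    \<open>1\<close> and \<open>\<psi> (A * xA)\<close>. This yields
    \<open>xA \<le> v / A \<le> u\<close>, the range in which the nabla-zero condition is
    applied.\<close>
  define P where "P = max 1 (\<psi> (A * xA)) powr (1 / \<theta>)"
  define y0 where "y0 = max x1 (\<psi>i P)"
  have "\<psi> (A2 * u) \<le> \<eta> * \<psi> (D ^ k * u) powr (1 - \<theta>) * \<psi> (v / A)"
    if u: "y0 \<le> u" and v: "0 \<le> v" "\<psi> v = \<psi> u powr \<theta>" for u v
  proof -
    have u1: "x1 \<le> u" "0 < u" using u D(2) by (auto simp: y0_def)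
    have P: "0 \<le> P" by (simp add: P_def)
    have "P \<le> \<psi> u" using u inv_le_iff[of u P] P u1 by (simp add: y0_def)
    then have "P powr \<theta> \<le> \<psi> u powr \<theta>" using \<theta> P by (intro powr_mono2) auto
    moreover have "P powr \<theta> = max 1 (\<psi> (A * xA))" using \<theta> by (simp add: P_def powr_powr)
    ultimately have v1: "1 \<le> \<psi> v" "\<psi> (A * xA) \<le> \<psi> v" using v by auto
    have "A * xA \<le> v" using v1(2) le_iff[of "A * xA" v] v A C by simp
    then have xv: "xA \<le> v / A" using A by (simp add: field_simps)
    have "1 \<le> \<psi> u"
    proof (rule ccontr)
      assume "\<not> 1 \<le> \<psi> u"
      then have "\<psi> u powr \<theta> < 1 powr \<theta>" using \<theta> u1 by (intro powr_less_mono2) auto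
      then show False using v1 v by simp
    qed
    then have "\<psi> u powr \<theta> \<le> \<psi> u powr 1" using \<theta> by (intro powr_mono) auto
    then have "\<psi> v \<le> \<psi> u" using v \<open>1 \<le> \<psi> u\<close> by simp
    then have "v \<le> u" using le_iff[of v u] v u1 by simp
    then have vu: "v / A \<le> u" using A v \<open>v \<le> u\<close> mult_mono[of 1 A v u] by (simp add: field_simps)
    define R where "R = \<psi> (A3 * u) / \<psi> u"
    have pu: "0 < \<psi> u" using u1 pos by simp
    have R: "A3 \<le> R" using scale_ge[of u A3] A3 u1 pu by (simp add: R_def field_simps)
    then have R1: "1 \<le> R" using A3 by simp
    have pR: "\<psi> (A3 * u) = \<psi> u * R" using pu by (simp add: R_def)
    have pvA: "0 < \<psi> (v / A)" using xv C(2) by (intro pos) auto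
    \<comment> \<open>The nabla-zero condition for the factor \<open>A\<close> at
      \<open>v / A \<le> u\<close> bounds the loss \<open>\<psi> v / \<psi> (v / A)\<close> by a
      ratio taken at \<open>u\<close>.\<close>
    have lower: "\<psi> u powr \<theta> / R \<le> \<psi> (v / A)"
    proof -
      have "\<psi> v / \<psi> (v / A) \<le> \<psi> (C * A * u) / \<psi> u"
        using C(3)[OF xv vu] A by simp
      also have "\<dots> \<le> R"
        unfolding R_def using u1 A C A3 pu by (intro divide_right_mono mono mult_right_mono) auto
      finally show ?thesis using pvA R1 v by (simp add: field_simps)
    qed
    have "\<psi> u powr (1 - \<theta>) * R powr (real m + 2) \<le> \<psi> u powr (1 - \<theta>) * R powr (real k * (1 - \<theta>))"
      using k \<theta> R1 by (intro mult_left_mono powr_mono) (auto simp: field_simps)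
    also have "\<dots> = (\<psi> u * R ^ k) powr (1 - \<theta>)"
      using R1 by (simp add: powr_mult powr_realpow[symmetric] powr_powr)
    also have "\<dots> \<le> \<psi> (D ^ k * u) powr (1 - \<theta>)"
      using D(3)[OF u1(1), of k] \<theta> R1 pu by (intro powr_mono2) (auto simp: R_def)
    finally have big: "\<psi> u powr (1 - \<theta>) * R powr (real m + 2) \<le> \<psi> (D ^ k * u) powr (1 - \<theta>)" .
    have "1 \<le> \<eta> * R ^ m"
    proof -
      have "1 / \<eta> \<le> R ^ m" using m power_mono[OF R, of m] A3 by linarith
      then show ?thesis using \<eta> by (simp add: field_simps)
    qed
    have "\<psi> (A2 * u) \<le> \<psi> (A3 * u)"
      using A2 A3 u1 by (intro mono mult_right_mono) auto
    also have "\<dots> = 1 * (\<psi> u * R)" by (simp add: pR)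
    also have "\<dots> \<le> (\<eta> * R ^ m) * (\<psi> u * R)"
      using \<open>1 \<le> \<eta> * R ^ m\<close> pu R1 by (intro mult_right_mono) auto
    also have "\<dots> = \<eta> * (\<psi> u powr (1 - \<theta>) * R powr (real m + 2)) * (\<psi> u powr \<theta> / R)"
      using pu R1 by (simp add: powr_diff powr_add powr_realpow power2_eq_square)
    also have "\<dots> \<le> \<eta> * \<psi> (D ^ k * u) powr (1 - \<theta>) * \<psi> (v / A)"
      using big lower \<eta> R1 by (intro mult_mono mult_left_mono) auto
    finally show ?thesis .
  qed
  then show ?thesis using D(1) by (intro that[of "D ^ k" y0]) auto
qed

end

section \<open>The boundary estimate\<close>

text \<open>The two densities differ by a constant times
  \<open>(1 - norm z ^ 2) powr (\<alpha> - \<beta>)\<close>. This transports a Carleson bound from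
  weight \<open>\<beta>\<close> to weight \<open>\<alpha>\<close> with the gain
  \<open>L\<close>.\<close>

lemma dv_compare:
  assumes "\<alpha> > -1" "\<beta> > -1" "\<beta> < \<alpha>"
  shows "\<exists>\<kappa>>0. \<forall>T L. T \<in> sets borel \<longrightarrow> (\<forall>z\<in>T \<inter> unit_ball. (1 - norm z) powr (\<alpha> - \<beta>) \<le> L) \<longrightarrow> 0 \<le> L \<longrightarrow>
    emeasure (dv \<alpha>) T \<le> ennreal (\<kappa> * L) * emeasure (dv \<beta>) (T :: (complex ^ 'n) set)"
proof -
  obtain k where k: "k > 0" "(dv \<alpha> :: (complex ^ 'n) measure) = density lborel (\<lambda>z. ennreal (k * bweight \<alpha> z))"
    using dv_eq_density[OF assms(1)] by blast
  obtain l where l: "l > 0" "(dv \<beta> :: (complex ^ 'n) measure) = density lborel (\<lambda>z. ennreal (l * bweight \<beta> z))"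
    using dv_eq_density[OF assms(2)] by blast
  define \<kappa> where "\<kappa> = k * 2 powr (\<alpha> - \<beta>) / l"
  have "emeasure (dv \<alpha>) T \<le> ennreal (\<kappa> * L) * emeasure (dv \<beta>) T"
    if T: "T \<in> sets borel" "\<forall>z\<in>T \<inter> unit_ball. (1 - norm z) powr (\<alpha> - \<beta>) \<le> L" "0 \<le> L" for T :: "(complex ^ 'n) set" and L
  proof -
    have [measurable]: "T \<in> sets borel" by fact
    have "emeasure (dv \<alpha>) T = (\<integral>\<^sup>+z. ennreal (k * bweight \<alpha> z) * indicator T z \<partial>lborel)"
      unfolding k(2) by (subst emeasure_density) auto
    also have "\<dots> \<le> (\<integral>\<^sup>+z. ennreal (\<kappa> * L) * (ennreal (l * bweight \<beta> z) * indicator T z) \<partial>lborel)"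
    proof (intro nn_integral_mono)
      fix z :: "complex ^ 'n"
      show "ennreal (k * bweight \<alpha> z) * indicator T z \<le> ennreal (\<kappa> * L) * (ennreal (l * bweight \<beta> z) * indicator T z)"
      proof (cases "z \<in> T \<inter> unit_ball")
        case True
        then have z: "norm z < 1" by (simp add: unit_ball_def)
        have "bweight \<alpha> z = (1 - (norm z)\<^sup>2) powr (\<alpha> - \<beta>) * bweight \<beta> z"
          using True one_minus_norm_sq(3)[OF z] by (simp add: bweight_def powr_diff)
        also have "\<dots> \<le> (2 * (1 - norm z)) powr (\<alpha> - \<beta>) * bweight \<beta> z"
          using one_minus_norm_sq[OF z] assms by (intro mult_right_mono powr_mono2) auto
        also have "(2 * (1 - norm z)) powr (\<alpha> - \<beta>) = 2 powr (\<alpha> - \<beta>) * (1 - norm z) powr (\<alpha> - \<beta>)"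
          by (rule powr_mult)
        also have "\<dots> * bweight \<beta> z \<le> 2 powr (\<alpha> - \<beta>) * L * bweight \<beta> z"
          using T True by (intro mult_right_mono mult_left_mono) auto
        finally have "k * bweight \<alpha> z \<le> k * (2 powr (\<alpha> - \<beta>) * L * bweight \<beta> z)"
          using k(1) by (intro mult_left_mono) auto
        also have "\<dots> = (\<kappa> * L) * (l * bweight \<beta> z)" using l(1) by (simp add: \<kappa>_def)
        finally have "ennreal (k * bweight \<alpha> z) \<le> ennreal ((\<kappa> * L) * (l * bweight \<beta> z))" by (rule ennreal_leI)
        also have "\<dots> = ennreal (\<kappa> * L) * ennreal (l * bweight \<beta> z)"
          using T(3) k(1) l(1) by (intro ennreal_mult) (auto simp: \<kappa>_def)
        finally show ?thesis using True by auto
      qed (auto simp: bweight_def indicator_def)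
    qed
    also have "\<dots> = ennreal (\<kappa> * L) * (\<integral>\<^sup>+z. ennreal (l * bweight \<beta> z) * indicator T z \<partial>lborel)"
      by (intro nn_integral_cmult) measurable
    also have "(\<integral>\<^sup>+z. ennreal (l * bweight \<beta> z) * indicator T z \<partial>lborel) = emeasure (dv \<beta>) T"
      unfolding l(2) by (subst emeasure_density) auto
    finally show ?thesis .
  qed
  then show ?thesis using k(1) l(1) by (intro exI[of _ \<kappa>]) (auto simp: \<kappa>_def)
qed

text \<open>Used in contrapositive form: if \<open>\<phi> z\<close> is close enough to the sphere,
  then so is \<open>z\<close>, and the limit condition may be applied at \<open>z\<close>.\<close>

lemma unit_ball_map_bounded:
  fixes \<phi> :: "complex ^ 'n \<Rightarrow> complex ^ 'm"
  assumes "continuous_on unit_ball \<phi>" "\<forall>z\<in>unit_ball. \<phi> z \<in> unit_ball" "r < 1"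
  shows "\<exists>\<rho><1. \<forall>z. norm z \<le> r \<longrightarrow> norm (\<phi> z) \<le> \<rho>"
proof (cases "r < 0")
  case True
  then show ?thesis by (intro exI[of _ 0]) (auto dest: order_trans[OF norm_ge_zero])
next
  case False
  have sub: "cball 0 r \<subseteq> (unit_ball :: (complex ^ 'n) set)" using assms(3) by (auto simp: unit_ball_def)
  have "continuous_on (cball 0 r) (\<lambda>z. norm (\<phi> z))"
    using sub assms(1) by (intro continuous_on_norm) (rule continuous_on_subset)
  then obtain x where x: "x \<in> cball 0 r" "\<forall>y\<in>cball 0 r. norm (\<phi> y) \<le> norm (\<phi> x)"
    using continuous_attains_sup[of "cball 0 r" "\<lambda>z. norm (\<phi> z)"] False by auto
  then have "norm (\<phi> x) < 1" using sub assms(2) by (auto simp: unit_ball_def)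
  then show ?thesis using x by (intro exI[of _ "norm (\<phi> x)"]) auto
qed

context orlicz
begin

text \<open>A monotone function is Borel; the maximum keeps the argument where
  \<open>\<psi>i\<close> is the actual inverse.\<close>

lemma measurable_inv [measurable]: "(\<lambda>x. \<psi>i (max 0 x)) \<in> borel_measurable borel"
  by (intro borel_measurable_mono monoI inv_mono) auto

lemma measurable_gauge [measurable]: "gauge \<alpha> \<in> borel_measurable (borel :: (complex ^ 'n) measure)"
proof -
  have "gauge \<alpha> = (\<lambda>z :: complex ^ 'n. (\<lambda>x. \<psi>i (max 0 x)) ((1 / (1 - norm z)) powr (real CARD('n) + \<alpha> + 1)))"
    by (simp add: gauge_def fun_eq_iff)
  also have "\<dots> \<in> borel_measurable borel" by measurable
  finally show ?thesis .
qed

lemma measurable_tube: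
  "(\<lambda>p. indicator (tube (fst p)) (snd p - fst p) :: ennreal) \<in> borel_measurable (borel \<Otimes>\<^sub>M (borel :: (complex ^ 'n) measure))"
proof -
  have "open {p :: (complex ^ 'n) \<times> (complex ^ 'n). snd p - fst p \<in> tube (fst p)}"
    unfolding tube_def mem_Collect_eq by (intro open_Collect_conj open_Collect_less continuous_intros) auto
  then have "{p :: (complex ^ 'n) \<times> (complex ^ 'n). snd p - fst p \<in> tube (fst p)} \<in> sets (borel \<Otimes>\<^sub>M borel)"
    unfolding borel_prod by (rule borel_open)
  moreover have "(\<lambda>p :: (complex ^ 'n) \<times> (complex ^ 'n). indicator (tube (fst p)) (snd p - fst p) :: ennreal) = indicator {p. snd p - fst p \<in> tube (fst p)}"
    by (auto simp: fun_eq_iff indicator_def)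
  ultimately show ?thesis by simp
qed

text \<open>Besides closeness to the sphere the set requires a large value of \<open>g\<close>,
  because the nabla-zero condition speaks only about large arguments. The free factor
  \<open>B\<close> inside \<open>\<psi>\<close> is what later makes Luxemburg norms small.\<close>

abbreviation boundary_part :: "(complex ^ 'n \<Rightarrow> complex ^ 'n) \<Rightarrow> real \<Rightarrow> real \<Rightarrow> real \<Rightarrow> (complex ^ 'n \<Rightarrow> complex) \<Rightarrow> complex ^ 'n \<Rightarrow> ennreal" where
  "boundary_part \<phi> \<delta> x B g z \<equiv>
     indicator {z \<in> unit_ball. 1 - \<delta> < norm (\<phi> z) \<and> x \<le> norm (g (\<phi> z))} z * ennreal (\<psi> (B * norm (g (\<phi> z))))"

text \<open>The sub-mean value property turns the integral over \<open>z\<close> into a double integral; after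
  exchanging the order, the inner integral only sees the preimage of an approach region, where
  the hypothesis on \<open>\<beta>\<close> and the decay of the weight \<open>(1 - norm z) powr (\<alpha> - \<beta>)\<close> combine.\<close>

lemma boundary_estimate:
  fixes \<phi> :: "complex ^ 'n \<Rightarrow> complex ^ 'n"
  assumes \<alpha>: "\<alpha> > -1" and \<beta>: "-1 < \<beta>" "\<beta> < \<alpha>"
    and \<phi>: "holo_map_on unit_ball \<phi>" "\<forall>z\<in>unit_ball. \<phi> z \<in> unit_ball" and bdd: "comp_bounded \<psi> \<beta> \<phi>"
    and nab: "nabla0 \<psi>" and B0: "1 < B0"
    and lim: "\<And>\<epsilon>. \<epsilon> > 0 \<Longrightarrow> \<exists>r<1. \<forall>z. r < norm z \<and> norm z < 1 \<longrightarrow> gauge \<alpha> (\<phi> z) / gauge \<alpha> z < \<epsilon>"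
  shows "\<exists>\<delta> x0. 0 < \<delta> \<and> \<delta> < 1 \<and> 0 < x0 \<and> (\<forall>g. holo_fun_on unit_ball g \<longrightarrow> orlicz_mod \<psi> \<alpha> g 1 \<le> 1 \<longrightarrow>
    (\<integral>\<^sup>+z. boundary_part \<phi> \<delta> x0 B0 g z \<partial>dv \<alpha>) \<le> ennreal (1 / 2))"
proof -
  define n1 where "n1 = real CARD('n) + \<alpha> + 1"
  define n2 where "n2 = real CARD('n) + \<beta> + 1"
  have n: "0 < n2" "n2 < n1" using \<beta> by (auto simp: n1_def n2_def)
  define \<theta> where "\<theta> = n2 / n1"
  have \<theta>: "0 < \<theta>" "\<theta> < 1" using n by (auto simp: \<theta>_def)
  have "n1 * \<theta> = n2" using n by (simp add: \<theta>_def)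
  then have \<theta>1: "n1 * \<theta> = n2" "n1 * (1 - \<theta>) = \<alpha> - \<beta>"
    by (simp_all add: right_diff_distrib) (simp add: n1_def n2_def)
  obtain A where A: "2 \<le> A" "\<And>a. a \<in> unit_ball \<Longrightarrow> ennreal (\<psi> (gauge \<beta> a / A)) * emeasure (dv \<beta>) {z \<in> unit_ball. \<phi> z \<in> approach a} \<le> 1"
    using carleson[OF \<beta>(1) \<phi> bdd] by blast
  obtain \<kappa> where \<kappa>: "\<kappa> > 0" "\<And>T L. T \<in> sets borel \<Longrightarrow> (\<forall>z\<in>T \<inter> unit_ball. (1 - norm z) powr (\<alpha> - \<beta>) \<le> L) \<Longrightarrow> 0 \<le> L \<Longrightarrow>
    emeasure (dv \<alpha>) T \<le> ennreal (\<kappa> * L) * emeasure (dv \<beta>) (T :: (complex ^ 'n) set)"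
    using dv_compare[OF \<alpha> \<beta>, where ?'n = 'n] by blast
  obtain C1 where C1: "C1 > 0" and sub: "\<And>f w. holo_fun_on unit_ball f \<Longrightarrow> w \<in> unit_ball \<Longrightarrow>
    ennreal (\<psi> (norm (f w)) * (1 - norm w) powr (real CARD('n) + 1 + \<alpha>))
      \<le> ennreal C1 * (\<integral>\<^sup>+z. indicator (tube w) (z - w) * ennreal (\<psi> (norm (f z))) \<partial>(dv \<alpha> :: (complex ^ 'n) measure))"
    using submean_dv[OF \<alpha>, where ?'n = 'n] by blast
  obtain K3 where K3: "1 \<le> K3" "\<And>f C w. holo_fun_on unit_ball f \<Longrightarrow> 0 < C \<Longrightarrow> orlicz_mod \<psi> \<alpha> f C \<le> 1 \<Longrightarrow> w \<in> unit_ball \<Longrightarrow>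
     norm (f w) \<le> C * (K3 * gauge \<alpha> (w :: complex ^ 'n))"
    using pointwise_bound[OF \<alpha>, where ?'n = 'n] by blast
  obtain CB x0 where CB: "1 \<le> CB" "0 < x0"
    "\<And>x y. x0 \<le> x \<Longrightarrow> x \<le> y \<Longrightarrow> \<psi> (B0 * x) / \<psi> x \<le> \<psi> (CB * B0 * y) / \<psi> y"
    using nabla0D[OF nab B0] by blast
  \<comment> \<open>The nabla-zero ratio is compared at the value \<open>norm (g w)\<close> and at
    its pointwise bound \<open>K3 * gauge \<alpha> w\<close>.\<close>
  define A1 where "A1 = CB * B0 * K3"
  have A1: "0 \<le> A1" using CB B0 K3 by (auto simp: A1_def)
  \<comment> \<open>The factor accounts for replacing \<open>gauge \<alpha> (\<phi> z)\<close> by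
    the gauge at a point of its tube neighbourhood.\<close>
  define A2 where "A2 = A1 * 3 powr n1"
  have A2: "0 \<le> A2" using A1 by (simp add: A2_def)
  \<comment> \<open>Chosen so that \<open>\<eta> * \<kappa> = 1 / (2 * C1)\<close>; the sub-mean
    constant \<open>C1\<close> then leaves exactly \<open>1 / 2\<close>.\<close>
  define \<eta> where "\<eta> = 1 / (2 * C1 * \<kappa>)"
  have \<eta>: "0 < \<eta>" using C1 \<kappa> by (simp add: \<eta>_def)
  obtain B' y0 where B': "1 \<le> B'" and absorb:
    "\<And>u v. y0 \<le> u \<Longrightarrow> 0 \<le> v \<Longrightarrow> \<psi> v = \<psi> u powr \<theta> \<Longrightarrow> \<psi> (A2 * u) \<le> \<eta> * \<psi> (B' * u) powr (1 - \<theta>) * \<psi> (v / A)"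
    using nabla0_absorb[OF nab _ \<theta> \<eta> A2, of A] A(1) by auto
  \<comment> \<open>The extra factor accounts for passing from the gauge at \<open>\<zeta>\<close>
    back to the gauge at \<open>\<phi> z\<close>, where the limit condition is stated.\<close>
  define B where "B = B' * 8 powr n1"
  have B: "0 < B" using B' by (simp add: B_def)
  obtain r where r: "r < 1" "\<And>z. r < norm z \<Longrightarrow> norm z < 1 \<Longrightarrow> gauge \<alpha> (\<phi> z) / gauge \<alpha> z < 1 / B"
    using lim[of "1 / B"] B by auto
  have cont: "continuous_on unit_ball \<phi>" by (rule holo_map_on_continuous[OF \<phi>(1)])
  obtain \<rho> where \<rho>: "\<rho> < 1" "\<And>z. norm z \<le> r \<Longrightarrow> norm (\<phi> z) \<le> \<rho>"
    using unit_ball_map_bounded[OF cont \<phi>(2) r(1)] by blast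
  define Y where "Y = max 1 (\<psi> (max 0 y0)) powr (1 / n1)"
  have Y: "1 \<le> Y" using n by (simp add: Y_def ge_one_powr_ge_zero)
  \<comment> \<open>The bound \<open>1 - \<rho>\<close> forces \<open>norm z > r\<close>, the bound
    \<open>1 / (3 * Y)\<close> forces the gauge at \<open>\<zeta>\<close> above the threshold
    \<open>y0\<close>, and \<open>1 / 2\<close> keeps \<open>\<delta>\<close> below one.\<close>
  define \<delta> where "\<delta> = min (1 / 2) (min (1 - \<rho>) (1 / (3 * Y)))"
  have "\<delta> \<le> 1 / (3 * Y)" "\<delta> \<le> 1 / 2" "\<delta> \<le> 1 - \<rho>" unfolding \<delta>_def by linarith+
  moreover have "0 < \<delta>" using \<rho>(1) Y by (simp add: \<delta>_def)
  ultimately have \<delta>: "0 < \<delta>" "\<delta> < 1" "\<delta> \<le> 1 - \<rho>" "3 * \<delta> \<le> 1 / Y" using Y by (auto simp: field_simps)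
  \<comment> \<open>Only the values of \<open>\<phi>\<close> on the ball are controlled; setting it
    to zero elsewhere gives a Borel map on the whole space.\<close>
  define \<phi>0 where "\<phi>0 = (\<lambda>z. indicator unit_ball z *\<^sub>R \<phi> z)"
  have [measurable]: "\<phi>0 \<in> borel_measurable borel"
    unfolding \<phi>0_def using cont by (intro borel_measurable_continuous_on_indicator) auto
  have \<phi>0: "\<phi>0 z = \<phi> z" if "z \<in> unit_ball" for z using that by (simp add: \<phi>0_def)
  define \<Omega> where "\<Omega> = {z \<in> unit_ball. 1 - \<delta> < norm (\<phi>0 z)}"
  have [measurable]: "\<Omega> \<in> sets borel" unfolding \<Omega>_def by measurable
  \<comment> \<open>The kernel of the double integral. Its bound for fixed \<open>\<zeta>\<close>,
    uniform in \<open>\<zeta>\<close>, plays the part of a Schur test.\<close>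
  define H where "H = (\<lambda>z \<zeta>. indicator \<Omega> z * (ennreal (\<psi>p (A1 * gauge \<alpha> (\<phi>0 z))) * indicator (tube (\<phi>0 z)) (\<zeta> - \<phi>0 z)))"
  have Hm: "(\<lambda>p. indicator (tube (\<phi>0 (fst p))) (snd p - \<phi>0 (fst p)) :: ennreal) \<in> borel_measurable (borel \<Otimes>\<^sub>M borel)"
    using measurable_compose[OF _ measurable_tube, where f = "\<lambda>p. (\<phi>0 (fst p), snd p)"] by simp
  have [measurable]: "(\<lambda>p. H (fst p) (snd p)) \<in> borel_measurable (borel \<Otimes>\<^sub>M borel)"
    unfolding H_def using Hm by measurable
  have inner: "(\<integral>\<^sup>+z. H z \<zeta> \<partial>dv \<alpha>) \<le> ennreal (1 / (2 * C1))" if \<zeta>: "\<zeta> \<in> unit_ball" for \<zeta>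
  proof -
    define T where "T = {z \<in> \<Omega>. \<zeta> - \<phi>0 z \<in> tube (\<phi>0 z)}"
    have [measurable]: "T \<in> sets borel"
    proof -
      have "(\<lambda>z. indicator (tube (\<phi>0 z)) (\<zeta> - \<phi>0 z) :: ennreal) \<in> borel_measurable borel"
        using measurable_compose[OF _ measurable_tube, where f = "\<lambda>z. (\<phi>0 z, \<zeta>)"] by simp
      moreover have "T = \<Omega> \<inter> {z. indicator (tube (\<phi>0 z)) (\<zeta> - \<phi>0 z) = (1 :: ennreal)}"
        by (auto simp: T_def indicator_def)
      ultimately show ?thesis by simp
    qed
    show ?thesis
    proof (cases "T = {}")
      case True
      then have "H z \<zeta> = 0" for z by (auto simp: H_def T_def indicator_def)
      then show ?thesis by simp
    next
      case False
      define u where "u = gauge \<alpha> \<zeta>"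
      define v where "v = gauge \<beta> \<zeta>"
      have \<zeta>1: "norm \<zeta> < 1" using \<zeta> by (simp add: unit_ball_def)
      have u: "0 < u" "\<psi> u = (1 / (1 - norm \<zeta>)) powr n1" and v: "0 < v" "\<psi> v = (1 / (1 - norm \<zeta>)) powr n2"
        by (simp_all add: u_def v_def gauge_pos[OF \<zeta>1] psi_gauge n1_def n2_def)
      \<comment> \<open>This power relation between the gauges of the two weights is the form in
        which \<open>nabla0_absorb\<close> expects \<open>u\<close> and \<open>v\<close>.\<close>
      have vu: "\<psi> v = \<psi> u powr \<theta>" using \<theta>1 by (simp add: u v powr_powr)
      have geo: "norm z < 1" "norm (\<phi> z) < 1" "1 - norm (\<phi> z) < \<delta>" "\<phi> z \<in> approach \<zeta>" "1 - norm \<zeta> \<le> 3 * (1 - norm (\<phi> z))"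
          "1 - norm (\<phi> z) \<le> 8 * (1 - norm \<zeta>)" "r < norm z" if "z \<in> T" for z
      proof -
        have z: "z \<in> unit_ball" "1 - \<delta> < norm (\<phi> z)" "\<zeta> - \<phi> z \<in> tube (\<phi> z)"
          using that by (auto simp: T_def \<Omega>_def \<phi>0)
        then show "norm z < 1" "1 - norm (\<phi> z) < \<delta>" and w: "norm (\<phi> z) < 1" using \<phi>(2) by (auto simp: unit_ball_def)
        from tube_geometry[OF w z(3)]
        show "\<phi> z \<in> approach \<zeta>" "1 - norm \<zeta> \<le> 3 * (1 - norm (\<phi> z))" "1 - norm (\<phi> z) \<le> 8 * (1 - norm \<zeta>)"
          by (auto simp: approach_def)
        show "r < norm z" using \<rho>(2)[of z] z(2) \<delta>(3) by linarith
      qed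
      have gle: "gauge \<alpha> (\<phi> z) \<le> 3 powr n1 * u" "u \<le> 8 powr n1 * gauge \<alpha> (\<phi> z)" if "z \<in> T" for z
        using gauge_scale[OF \<alpha> \<zeta>1, of 3 "\<phi> z"] gauge_scale[OF \<alpha> geo(2)[OF that], of 8 \<zeta>] geo[OF that]
        by (simp_all add: u_def n1_def)
      have "y0 \<le> u"
      proof -
        obtain z where z: "z \<in> T" using False by auto
        have "Y * (1 - norm \<zeta>) \<le> Y * (3 * \<delta>)" using geo(3,5)[OF z] Y by (intro mult_left_mono) auto
        also have "\<dots> \<le> 1" using \<delta>(4) Y by (simp add: field_simps)
        finally have "Y \<le> 1 / (1 - norm \<zeta>)" using \<zeta>1 by (simp add: field_simps)
        then have "Y powr n1 \<le> \<psi> u" unfolding u using Y n by (intro powr_mono2) auto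
        moreover have "Y powr n1 = max 1 (\<psi> (max 0 y0))" using n by (simp add: Y_def powr_powr)
        ultimately have "\<psi> (max 0 y0) \<le> \<psi> u" by simp
        then show ?thesis using le_iff[of "max 0 y0" u] u by simp
      qed
      define X where "X = \<psi> (B' * u)"
      have X: "0 < X" using B' u by (auto simp: X_def intro!: pos)
      \<comment> \<open>The limit condition gives \<open>B' * u \<le> gauge \<alpha> z\<close>;
        applying \<open>\<psi>\<close> bounds \<open>X\<close> by a power of
        \<open>1 / (1 - norm z)\<close>, and the exponent \<open>1 - \<theta>\<close> turns that
        power into \<open>\<alpha> - \<beta>\<close>.\<close>
      have weight: "(1 - norm z) powr (\<alpha> - \<beta>) \<le> 1 / X powr (1 - \<theta>)" if z: "z \<in> T" for z
      proof -
        have gz: "0 < gauge \<alpha> z" by (rule gauge_pos[OF geo(1)[OF z]])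
        have "B' * u \<le> B' * (8 powr n1 * gauge \<alpha> (\<phi> z))" using gle(2)[OF z] B' by (intro mult_left_mono) auto
        also have "\<dots> = B * gauge \<alpha> (\<phi> z)" by (simp add: B_def)
        also have "\<dots> \<le> gauge \<alpha> z"
          using r(2)[OF geo(7)[OF z] geo(1)[OF z]] gz B by (simp add: field_simps)
        finally have "X \<le> (1 / (1 - norm z)) powr n1"
          unfolding X_def psi_gauge[of \<alpha> z, folded n1_def, symmetric] using B' u by (intro mono) auto
        then have "X powr (1 - \<theta>) \<le> ((1 / (1 - norm z)) powr n1) powr (1 - \<theta>)"
          using X \<theta> by (intro powr_mono2) auto
        also have "\<dots> = 1 / (1 - norm z) powr (\<alpha> - \<beta>)"
          using geo(1)[OF z] by (simp add: powr_powr \<theta>1 powr_divide)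
        finally show ?thesis using X geo(1)[OF z] by (simp add: field_simps)
      qed
      have "(\<integral>\<^sup>+z. H z \<zeta> \<partial>dv \<alpha>) \<le> (\<integral>\<^sup>+z. ennreal (\<psi> (A2 * u)) * indicator T z \<partial>dv \<alpha>)"
      proof (intro nn_integral_mono)
        fix z
        show "H z \<zeta> \<le> ennreal (\<psi> (A2 * u)) * indicator T z"
        proof (cases "z \<in> T")
          case True
          have "z \<in> unit_ball" using geo(1)[OF True] by (simp add: unit_ball_def)
          have "A1 * gauge \<alpha> (\<phi> z) \<le> A1 * (3 powr n1 * u)" using gle(1)[OF True] A1 by (intro mult_left_mono) auto
          then have "\<psi> (A1 * gauge \<alpha> (\<phi> z)) \<le> \<psi> (A2 * u)"
            using A1 gauge_pos[OF geo(2)[OF True], of \<alpha>] by (intro mono) (auto simp: A2_def mult_ac)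
          then show ?thesis
            using True A1 gauge_pos[OF geo(2)[OF True], of \<alpha>] \<phi>0[OF \<open>z \<in> unit_ball\<close>]
            by (auto simp: H_def T_def p_eq intro!: ennreal_leI)
        qed (auto simp: H_def T_def indicator_def)
      qed
      also have "\<dots> = ennreal (\<psi> (A2 * u)) * emeasure (dv \<alpha>) T" by (simp add: nn_integral_cmult)
      also have "\<dots> \<le> ennreal (\<psi> (A2 * u)) * (ennreal (\<kappa> * (1 / X powr (1 - \<theta>))) * emeasure (dv \<beta>) T)"
        using weight by (intro mult_left_mono \<kappa>(2)) auto
      also have "\<dots> \<le> ennreal (\<eta> * X powr (1 - \<theta>) * \<psi> (v / A)) * (ennreal (\<kappa> * (1 / X powr (1 - \<theta>))) * emeasure (dv \<beta>) {z \<in> unit_ball. \<phi> z \<in> approach \<zeta>})"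
      proof (intro mult_mono ennreal_leI)
        show "\<psi> (A2 * u) \<le> \<eta> * X powr (1 - \<theta>) * \<psi> (v / A)"
          unfolding X_def using \<open>y0 \<le> u\<close> v vu by (intro absorb) auto
        have "{z \<in> unit_ball. \<phi> z \<in> approach \<zeta>} = unit_ball \<inter> {z. \<phi>0 z \<in> approach \<zeta>}" using \<phi>0 by auto
        moreover have "open (approach \<zeta>)"
          unfolding approach_def by (intro open_Collect_less continuous_intros continuous_cinner_left)
        then have "{z. \<phi>0 z \<in> approach \<zeta>} \<in> sets borel"
          using measurable_sets[of \<phi>0 borel borel "approach \<zeta>"] by (simp add: vimage_def)
        ultimately have "{z \<in> unit_ball. \<phi> z \<in> approach \<zeta>} \<in> sets borel" by simp
        then show "emeasure (dv \<beta>) T \<le> emeasure (dv \<beta>) {z \<in> unit_ball. \<phi> z \<in> approach \<zeta>}"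
          using geo(1,4) by (intro emeasure_mono) (auto simp: unit_ball_def)
      qed (use \<kappa>(1) in auto)
      also have "\<dots> = ennreal (\<eta> * \<kappa>) * (ennreal (\<psi> (v / A)) * emeasure (dv \<beta>) {z \<in> unit_ball. \<phi> z \<in> approach \<zeta>})"
      proof -
        have "0 \<le> \<psi> (v / A)" using v A by simp
        \<comment> \<open>The gain from the weight cancels the factor
          \<open>X powr (1 - \<theta>)\<close> from \<open>nabla0_absorb\<close>; what remains is
          the quantity bounded by \<open>carleson\<close>.\<close>
        moreover have "(\<eta> * X powr (1 - \<theta>) * \<psi> (v / A)) * (\<kappa> * (1 / X powr (1 - \<theta>))) = \<eta> * \<kappa> * \<psi> (v / A)"
          using X by simp
        ultimately show ?thesis
          using \<eta> \<kappa>(1) X by (simp only: mult.assoc[symmetric] ennreal_mult[symmetric] mult_nonneg_nonneg less_imp_le powr_ge_zero divide_nonneg_nonneg zero_le_one)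
      qed
      also have "\<dots> \<le> ennreal (\<eta> * \<kappa>) * 1"
        unfolding v_def using A(2)[OF \<zeta>] by (intro mult_left_mono) auto
      also have "\<eta> * \<kappa> = 1 / (2 * C1)" using \<kappa> by (simp add: \<eta>_def)
      finally show ?thesis by simp
    qed
  qed
  have "(\<integral>\<^sup>+z. boundary_part \<phi> \<delta> x0 B0 g z \<partial>dv \<alpha>) \<le> ennreal (1 / 2)"
    if g: "holo_fun_on unit_ball g" "orlicz_mod \<psi> \<alpha> g 1 \<le> 1" for g
  proof -
    define G where "G = (\<lambda>\<zeta>. indicator unit_ball \<zeta> * ennreal (\<psi> (norm (g \<zeta>))))"
    have [measurable]: "G \<in> borel_measurable borel"
      unfolding G_def using measurable_modulus[OF holo_fun_onD_continuous[OF g(1)], of 1] by simp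
    interpret finite_measure "dv \<alpha> :: (complex ^ 'n) measure" by (rule finite_measure_dv[OF \<alpha>])
    interpret P: pair_sigma_finite "dv \<alpha> :: (complex ^ 'n) measure" "dv \<alpha> :: (complex ^ 'n) measure" ..
    have "(\<integral>\<^sup>+z. boundary_part \<phi> \<delta> x0 B0 g z \<partial>dv \<alpha>)
      \<le> (\<integral>\<^sup>+z. ennreal C1 * (\<integral>\<^sup>+\<zeta>. H z \<zeta> * G \<zeta> \<partial>dv \<alpha>) \<partial>dv \<alpha>)"
    proof (intro nn_integral_mono)
      fix z
      show "boundary_part \<phi> \<delta> x0 B0 g z
        \<le> ennreal C1 * (\<integral>\<^sup>+\<zeta>. H z \<zeta> * G \<zeta> \<partial>dv \<alpha>)"
      proof (cases "z \<in> unit_ball \<and> 1 - \<delta> < norm (\<phi> z) \<and> x0 \<le> norm (g (\<phi> z))")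
        case True
        define w where "w = \<phi> z"
        have w: "w \<in> unit_ball" "norm w < 1" using True \<phi>(2) by (auto simp: w_def unit_ball_def)
        have z: "z \<in> \<Omega>" "\<phi>0 z = w" using True by (auto simp: \<Omega>_def \<phi>0 w_def)
        define x where "x = norm (g w)"
        define u where "u = gauge \<alpha> w"
        have u: "0 < u" "\<psi> u = (1 / (1 - norm w)) powr n1"
          by (simp_all add: u_def gauge_pos[OF w(2)] psi_gauge n1_def)
        have x: "x0 \<le> x" "0 < x" using True CB(2) by (auto simp: x_def w_def)
        have "x \<le> K3 * u" using K3(2)[OF g(1) _ g(2) w(1)] by (simp add: x_def u_def)
        from CB(3)[OF x(1) this]
        have "\<psi> (B0 * x) / \<psi> x \<le> \<psi> (A1 * u) / \<psi> (K3 * u)" by (simp add: A1_def mult_ac)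
        also have "\<dots> \<le> \<psi> (A1 * u) / \<psi> u"
        proof (rule divide_left_mono)
          have "1 * u \<le> K3 * u" using K3(1) u by (intro mult_right_mono) auto
          then show "\<psi> u \<le> \<psi> (K3 * u)" using u by (intro mono) auto
          show "0 \<le> \<psi> (A1 * u)" using A1 u by auto
          show "0 < \<psi> (K3 * u) * \<psi> u" using K3(1) u by (intro mult_pos_pos pos) auto
        qed
        \<comment> \<open>This trades the factor \<open>B0\<close> inside \<open>\<psi>\<close> for
          a quantity depending only on \<open>w\<close>, times \<open>\<psi> x\<close>. Since
          \<open>1 / \<psi> u\<close> is the power of \<open>1 - norm w\<close> in
          \<open>submean_dv\<close>, the remaining quotient is ready for the sub-mean value
          property.\<close>
        finally have "\<psi> (B0 * x) \<le> \<psi> (A1 * u) * (\<psi> x / \<psi> u)"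
          using pos[OF x(2)] by (simp add: field_simps)
        also have "\<psi> x / \<psi> u = \<psi> x * (1 - norm w) powr (real CARD('n) + 1 + \<alpha>)"
          using w(2) by (simp add: u(2) n1_def powr_divide add_ac)
        finally have "ennreal (\<psi> (B0 * x)) \<le> ennreal (\<psi> (A1 * u) * (\<psi> x * (1 - norm w) powr (real CARD('n) + 1 + \<alpha>)))"
          by (rule ennreal_leI)
        also have "\<dots> = ennreal (\<psi> (A1 * u)) * ennreal (\<psi> x * (1 - norm w) powr (real CARD('n) + 1 + \<alpha>))"
          using A1 u x by (intro ennreal_mult) auto
        also have "\<dots> \<le> ennreal (\<psi> (A1 * u)) * (ennreal C1 * (\<integral>\<^sup>+\<zeta>. indicator (tube w) (\<zeta> - w) * ennreal (\<psi> (norm (g \<zeta>))) \<partial>dv \<alpha>))"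
          unfolding x_def by (intro mult_left_mono sub g w) auto
        also have "(\<integral>\<^sup>+\<zeta>. indicator (tube w) (\<zeta> - w) * ennreal (\<psi> (norm (g \<zeta>))) \<partial>dv \<alpha>) = (\<integral>\<^sup>+\<zeta>. indicator (tube w) (\<zeta> - w) * G \<zeta> \<partial>dv \<alpha>)"
        proof (intro nn_integral_cong)
          fix \<zeta>
          have "\<zeta> \<in> unit_ball" if "\<zeta> - w \<in> tube w"
            using tube_geometry(1)[OF w(2) that] by (simp add: unit_ball_def)
          then show "indicator (tube w) (\<zeta> - w) * ennreal (\<psi> (norm (g \<zeta>))) = indicator (tube w) (\<zeta> - w) * G \<zeta>"
            by (auto simp: G_def indicator_def)
        qed
        also have "ennreal (\<psi> (A1 * u)) * (ennreal C1 * \<dots>) = ennreal C1 * (ennreal (\<psi> (A1 * u)) * \<dots>)"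
          by (simp add: mult_ac)
        also have "ennreal (\<psi> (A1 * u)) * (\<integral>\<^sup>+\<zeta>. indicator (tube w) (\<zeta> - w) * G \<zeta> \<partial>dv \<alpha>) = (\<integral>\<^sup>+\<zeta>. H z \<zeta> * G \<zeta> \<partial>dv \<alpha>)"
        proof -
          have [measurable]: "tube w \<in> sets borel" by (rule borel_open[OF open_tube])
          have "(\<integral>\<^sup>+\<zeta>. H z \<zeta> * G \<zeta> \<partial>dv \<alpha>) = (\<integral>\<^sup>+\<zeta>. ennreal (\<psi> (A1 * u)) * (indicator (tube w) (\<zeta> - w) * G \<zeta>) \<partial>dv \<alpha>)"
            using z u A1 by (intro nn_integral_cong) (simp add: H_def p_eq u_def mult.assoc)
          then show ?thesis by (simp add: nn_integral_cmult)
        qed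
        finally show ?thesis using True by (simp add: x_def w_def)
      qed simp
    qed
    also have "\<dots> = ennreal C1 * (\<integral>\<^sup>+z. (\<integral>\<^sup>+\<zeta>. H z \<zeta> * G \<zeta> \<partial>dv \<alpha>) \<partial>dv \<alpha>)"
      by (intro nn_integral_cmult) measurable
    also have "\<dots> \<le> ennreal C1 * (ennreal (1 / (2 * C1)) * 1)"
    proof (rule mult_left_mono)
      have "(\<integral>\<^sup>+z. (\<integral>\<^sup>+\<zeta>. H z \<zeta> * G \<zeta> \<partial>dv \<alpha>) \<partial>dv \<alpha>) = (\<integral>\<^sup>+\<zeta>. (\<integral>\<^sup>+z. H z \<zeta> * G \<zeta> \<partial>dv \<alpha>) \<partial>dv \<alpha>)"
        by (rule P.Fubini'[symmetric]) measurable
      also have "\<dots> \<le> (\<integral>\<^sup>+\<zeta>. ennreal (1 / (2 * C1)) * G \<zeta> \<partial>dv \<alpha>)"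
      proof (intro nn_integral_mono)
        fix \<zeta>
        have [measurable]: "(\<lambda>z. H z \<zeta>) \<in> borel_measurable borel"
          using measurable_compose[of "\<lambda>z. (z, \<zeta>)" borel "borel \<Otimes>\<^sub>M borel" "\<lambda>p. H (fst p) (snd p)" borel] by simp
        have "(\<integral>\<^sup>+z. H z \<zeta> * G \<zeta> \<partial>dv \<alpha>) = (\<integral>\<^sup>+z. H z \<zeta> \<partial>dv \<alpha>) * G \<zeta>"
          by (intro nn_integral_multc) measurable
        also have "\<dots> \<le> ennreal (1 / (2 * C1)) * G \<zeta>"
          using inner[of \<zeta>] by (cases "\<zeta> \<in> unit_ball") (auto simp: G_def intro!: mult_right_mono)
        finally show "(\<integral>\<^sup>+z. H z \<zeta> * G \<zeta> \<partial>dv \<alpha>) \<le> ennreal (1 / (2 * C1)) * G \<zeta>" .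
      qed
      also have "\<dots> = ennreal (1 / (2 * C1)) * orlicz_mod \<psi> \<alpha> g 1"
        unfolding orlicz_mod_eq[OF \<alpha>] by (simp add: G_def[symmetric] nn_integral_cmult)
      also have "\<dots> \<le> ennreal (1 / (2 * C1)) * 1" using g(2) by (intro mult_left_mono) auto
      finally show "(\<integral>\<^sup>+z. (\<integral>\<^sup>+\<zeta>. H z \<zeta> * G \<zeta> \<partial>dv \<alpha>) \<partial>dv \<alpha>) \<le> ennreal (1 / (2 * C1)) * 1" .
    qed simp
    also have "ennreal C1 * (ennreal (1 / (2 * C1)) * 1) = ennreal (1 / 2)"
      using C1 by (simp add: ennreal_mult[symmetric])
    finally show ?thesis .
  qed
  then show ?thesis using \<delta> CB(2) by blast
qed

end

section \<open>Normal families in the unit ball\<close>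

text \<open>Cauchy's inequality for the slice \<open>f (z + c *s v)\<close> on the disc of radius
  \<open>(\<rho>' - \<rho>) / norm v\<close>, whose image stays in the ball of radius
  \<open>\<rho>'\<close>.\<close>

lemma holo_derivative_bound:
  fixes f :: "complex ^ 'n \<Rightarrow> complex"
  assumes f: "holo_fun_on unit_ball f" and \<rho>: "\<rho> < \<rho>'" "\<rho>' < 1" "norm z \<le> \<rho>"
    and M: "\<And>y. norm y \<le> \<rho>' \<Longrightarrow> norm (f y) \<le> M"
    and L: "(f has_derivative L) (at z)" "\<And>c v. L (c *s v) = c * L v"
  shows "norm (L v) \<le> M / (\<rho>' - \<rho>) * norm v"
proof (cases "v = 0")
  case True
  then show ?thesis using L(2)[of 0 0] by simp
next
  case False
  define R where "R = (\<rho>' - \<rho>) / norm v"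
  have R: "R > 0" using False \<rho> by (simp add: R_def)
  define g where "g = (\<lambda>c. f (z + c *s v))"
  have in_cball: "norm (z + c *s v) \<le> \<rho>'" if "norm c \<le> R" for c
  proof -
    have "norm (z + c *s v) \<le> norm z + norm c * norm v" using norm_triangle_ineq[of z "c *s v"] by simp
    also have "norm c * norm v \<le> \<rho>' - \<rho>" using that False by (simp add: R_def field_simps)
    finally show ?thesis using \<rho> by simp
  qed
  define T where "T = {c. norm (z + c *s v) < 1}"
  have T: "open T" unfolding T_def by (intro open_Collect_less continuous_intros)
  have sub: "cball 0 R \<subseteq> T" using in_cball \<rho> by (force simp: T_def)
  have gT: "g holomorphic_on T"
    unfolding g_def using f T by (intro holo_fun_on_slice[of unit_ball]) (auto simp: T_def unit_ball_def)
  have "(f has_derivative L) (at (z + 0 *s v))" using L(1) by simp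
  then have "(g has_derivative (\<lambda>c. L (c *s v))) (at 0)"
    unfolding g_def by (rule has_derivative_compose[OF has_derivative_smult_left])
  then have "(g has_field_derivative L v) (at 0)"
    unfolding has_field_derivative_def L(2) by (simp add: mult.commute[of _ "L v"])
  then have "deriv g 0 = L v" by (rule DERIV_imp_deriv)
  moreover have "norm ((deriv ^^ 1) g 0) \<le> fact 1 * M / R ^ 1"
  proof (rule Cauchy_inequality)
    show "g holomorphic_on ball 0 R" using gT sub ball_subset_cball holomorphic_on_subset by blast
    show "continuous_on (cball 0 R) g" using gT sub holomorphic_on_imp_continuous_on holomorphic_on_subset by blast
    show "norm (g c) \<le> M" if "norm (0 - c) = R" for c
      unfolding g_def using that by (intro M in_cball) simp
  qed (use R in auto)
  ultimately show ?thesis by (simp add: R_def)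
qed

text \<open>Cauchy estimates on differences make the derivatives uniformly Cauchy on smaller balls,
  so limit and derivative may be interchanged. Complex homogeneity of the derivatives survives
  pointwise limits.\<close>

lemma locally_uniform_limit_holo:
  fixes f :: "nat \<Rightarrow> complex ^ 'n \<Rightarrow> complex"
  assumes f: "\<And>k. holo_fun_on unit_ball (f k)"
    and Cau: "\<And>\<rho>. \<rho> < 1 \<Longrightarrow> uniformly_Cauchy_on (cball 0 \<rho>) f"
  obtains g where "holo_fun_on unit_ball g" "\<And>\<rho>. \<rho> < 1 \<Longrightarrow> uniform_limit (cball 0 \<rho>) f g sequentially"
proof -
  have "\<forall>k z. z \<in> unit_ball \<longrightarrow> (\<exists>L. (f k has_derivative L) (at z) \<and> (\<forall>c v. L (c *s v) = c * L v))"
    using f unfolding holo_fun_on_def by blast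
  then obtain L where L: "\<And>k z. z \<in> unit_ball \<Longrightarrow> (f k has_derivative L k z) (at z)"
    "\<And>k z c v. z \<in> unit_ball \<Longrightarrow> L k z (c *s v) = c * L k z v"
    by metis
  define g where "g = (\<lambda>z. lim (\<lambda>k. f k z))"
  have lim: "uniform_limit (cball 0 \<rho>) f g sequentially" if \<rho>: "\<rho> < 1" for \<rho>
  proof -
    obtain l where l: "uniform_limit (cball 0 \<rho>) f l sequentially"
      using Cauchy_uniformly_convergent[OF Cau[OF \<rho>]] uniformly_convergent_on_def by blast
    then have "l z = g z" if "z \<in> cball 0 \<rho>" for z
      using tendsto_uniform_limitI[OF l that] unfolding g_def by (simp add: limI)
    then show ?thesis using l by (simp add: uniform_limit_iff)
  qed
  have "\<exists>K. (g has_derivative K) (at z) \<and> (\<forall>c v. K (c *s v) = c * K v)" if "z \<in> unit_ball" for z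
  proof -
    define \<rho> where "\<rho> = (1 + norm z) / 2"
    define \<rho>' where "\<rho>' = (1 + \<rho>) / 2"
    have z: "norm z < 1" using that by (simp add: unit_ball_def)
    have \<rho>: "norm z < \<rho>" "\<rho> < \<rho>'" "\<rho>' < 1" using z by (auto simp: \<rho>_def \<rho>'_def)
    define S where "S = ball (0 :: complex ^ 'n) \<rho>"
    have S: "x \<in> unit_ball" "norm x \<le> \<rho>" if "x \<in> S" for x using that \<rho> by (auto simp: S_def unit_ball_def)
    have diff: "norm (L m x h - L n x h) \<le> e / (\<rho>' - \<rho>) * norm h"
      if "x \<in> S" "\<And>y. norm y \<le> \<rho>' \<Longrightarrow> norm (f m y - f n y) \<le> e" for m n x h e
    proof (rule holo_derivative_bound[where f = "\<lambda>y. f m y - f n y" and L = "\<lambda>h. L m x h - L n x h"])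
      show "((\<lambda>y. f m y - f n y) has_derivative (\<lambda>h. L m x h - L n x h)) (at x)"
        using L(1)[OF S(1)[OF that(1)]] by (intro has_derivative_diff)
    qed (use that S \<rho> L f in \<open>auto intro!: holo_fun_on_diff simp: right_diff_distrib\<close>)
    have ev: "\<exists>N. \<forall>m\<ge>N. \<forall>n\<ge>N. \<forall>x\<in>S. \<forall>h. norm (L m x h - L n x h) \<le> e * norm h" if "e > 0" for e
    proof -
      have "0 < e * (\<rho>' - \<rho>)" using that \<rho> by simp
      then obtain N where N: "\<And>m n y. N \<le> m \<Longrightarrow> N \<le> n \<Longrightarrow> y \<in> cball 0 \<rho>' \<Longrightarrow> dist (f m y) (f n y) < e * (\<rho>' - \<rho>)"
        using Cau[OF \<rho>(3)] unfolding uniformly_Cauchy_on_def by metis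
      have "norm (L m x h - L n x h) \<le> e * norm h" if mn: "N \<le> m" "N \<le> n" "x \<in> S" for m n x h
        using diff[OF mn(3), of m n "e * (\<rho>' - \<rho>)" h] N[OF mn(1,2)] \<rho> by (auto simp: dist_norm intro: less_imp_le)
      then show ?thesis by blast
    qed
    define G where "G = (\<lambda>x h. lim (\<lambda>k. L k x h))"
    have conv: "(\<lambda>k. L k x h) \<longlonglongrightarrow> G x h" if x: "x \<in> S" for x h
    proof -
      have "Cauchy (\<lambda>k. L k x h)"
      proof (rule metric_CauchyI)
        fix e :: real assume "e > 0"
        then have "0 < e / (norm h + 1)" by (simp add: add_nonneg_pos)
        from ev[OF this] obtain N where N: "\<And>m n. N \<le> m \<Longrightarrow> N \<le> n \<Longrightarrow> norm (L m x h - L n x h) \<le> e / (norm h + 1) * norm h"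
          using x by blast
        have "0 < norm h + 1" by (simp add: add_nonneg_pos)
        then have "e / (norm h + 1) * norm h < e" using \<open>e > 0\<close> by (simp add: pos_divide_less_eq algebra_simps)
        then show "\<exists>N. \<forall>m\<ge>N. \<forall>n\<ge>N. dist (L m x h) (L n x h) < e"
          using N unfolding dist_norm by (meson le_less_trans)
      qed
      then show ?thesis unfolding G_def by (simp add: Cauchy_convergent_iff convergent_LIMSEQ_iff)
    qed
    have "\<exists>l. \<forall>x\<in>S. (\<lambda>k. f k x) \<longlonglongrightarrow> l x \<and> (l has_derivative G x) (at x within S)"
    proof (rule has_derivative_sequence)
      show "convex S" by (simp add: S_def)
      show "(f k has_derivative L k x) (at x within S)" if "x \<in> S" for k x
        using L(1)[OF S(1)[OF that]] has_derivative_at_withinI by blast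
      show "z \<in> S" using \<rho> by (simp add: S_def)
      show "(\<lambda>k. f k z) \<longlonglongrightarrow> g z" using tendsto_uniform_limitI[OF lim, of \<rho> z] \<rho> by simp
      show "\<forall>\<^sub>F n in sequentially. \<forall>x\<in>S. \<forall>h. norm (L n x h - G x h) \<le> e * norm h" if "e > 0" for e
      proof -
        obtain N where N: "\<And>m n x h. N \<le> m \<Longrightarrow> N \<le> n \<Longrightarrow> x \<in> S \<Longrightarrow> norm (L m x h - L n x h) \<le> e * norm h"
          using ev[OF \<open>e > 0\<close>] by blast
        have "norm (L n x h - G x h) \<le> e * norm h" if n: "N \<le> n" "x \<in> S" for n x h
        proof (rule tendsto_upperbound)
          show "(\<lambda>m. norm (L n x h - L m x h)) \<longlonglongrightarrow> norm (L n x h - G x h)"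
            by (intro tendsto_intros conv n)
          show "\<forall>\<^sub>F m in sequentially. norm (L n x h - L m x h) \<le> e * norm h"
            using N[OF n(1) _ n(2)] by (auto simp: eventually_sequentially)
        qed simp
        then show ?thesis by (auto simp: eventually_sequentially)
      qed
    qed
    then obtain l where l: "\<And>x. x \<in> S \<Longrightarrow> (\<lambda>k. f k x) \<longlonglongrightarrow> l x" "\<And>x. x \<in> S \<Longrightarrow> (l has_derivative G x) (at x within S)"
      by blast
    have zS: "z \<in> S" using \<rho> by (simp add: S_def)
    have lg: "l x = g x" if "x \<in> S" for x using l(1)[OF that] by (simp add: g_def limI)
    have "open S" by (simp add: S_def)
    have "at z within S = at z" by (rule at_within_open[OF zS \<open>open S\<close>])
    then have "(l has_derivative G z) (at z)" using l(2)[OF zS] by simp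
    then have "(g has_derivative G z) (at z)"
      by (rule has_derivative_transform_within_open[OF _ \<open>open S\<close> zS lg])
    moreover have "G z (c *s v) = c * G z v" for c v
    proof (rule LIMSEQ_unique)
      show "(\<lambda>k. L k z (c *s v)) \<longlonglongrightarrow> G z (c *s v)" by (rule conv[OF zS])
      show "(\<lambda>k. L k z (c *s v)) \<longlonglongrightarrow> c * G z v"
        unfolding L(2)[OF that] by (intro tendsto_intros conv[OF zS])
    qed
    ultimately show ?thesis by blast
  qed
  then have "holo_fun_on unit_ball g" by (simp add: holo_fun_on_def)
  then show ?thesis using lim that by blast
qed

text \<open>Derivative bounds give a common Lipschitz constant on each smaller ball, so
  Arzela-Ascoli applies there; a diagonal sequence serves all balls at once.\<close>

lemma montel_unit_ball:
  fixes f :: "nat \<Rightarrow> complex ^ 'n \<Rightarrow> complex"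
  assumes f: "\<And>k. holo_fun_on unit_ball (f k)"
    and bdd: "\<And>\<rho>. \<rho> < 1 \<Longrightarrow> \<exists>M. \<forall>k z. norm z \<le> \<rho> \<longrightarrow> norm (f k z) \<le> M"
  obtains r g where "strict_mono (r :: nat \<Rightarrow> nat)" "holo_fun_on unit_ball g"
    "\<And>\<rho>. \<rho> < 1 \<Longrightarrow> uniform_limit (cball 0 \<rho>) (\<lambda>k. f (r k)) g sequentially"
proof -
  \<comment> \<open>The radii increase to one; the offset \<open>2\<close> gives
    \<open>R 0 = 1 / 2\<close>, so every auxiliary ball contains the centre.\<close>
  define R where "R = (\<lambda>i. 1 - 1 / (real i + 2))"
  have R: "R i < 1" for i by (simp add: R_def add_nonneg_pos)
  \<comment> \<open>The Cauchy property involves no limit function, so none has to be matched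
    between different radii before the diagonal sequence exists.\<close>
  define P where "P = (\<lambda>i s. uniformly_Cauchy_on (cball (0 :: complex ^ 'n) (R i)) (s :: nat \<Rightarrow> complex ^ 'n \<Rightarrow> complex))"
  have sub: "\<exists>k. strict_mono k \<and> P i ((\<lambda>k. f (s k)) \<circ> k)" for i and s :: "nat \<Rightarrow> nat"
  proof -
    define \<rho>' where "\<rho>' = (1 + R i) / 2"
    have \<rho>': "R i < \<rho>'" "\<rho>' < 1" using R[of i] by (auto simp: \<rho>'_def)
    obtain M where M: "\<And>k z. norm z \<le> \<rho>' \<Longrightarrow> norm (f k z) \<le> M" using bdd[OF \<rho>'(2)] by blast
    define D where "D = M / (\<rho>' - R i)"
    have M0: "0 \<le> M"
    proof -
      have "0 \<le> \<rho>'" using \<rho>' by (simp add: \<rho>'_def R_def field_simps)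
      then show ?thesis using M[of 0 0] by (auto intro: order_trans[OF norm_ge_zero])
    qed
    then have D: "0 \<le> D" using \<rho>' by (simp add: D_def)
    have lip: "norm (f k x - f k y) \<le> D * norm (x - y)" if "x \<in> cball 0 (R i)" "y \<in> cball 0 (R i)" for k and x y :: "complex ^ 'n"
    proof -
      have ub: "z \<in> unit_ball" if "z \<in> cball 0 (R i)" for z :: "complex ^ 'n" using that R[of i] by (auto simp: unit_ball_def)
      obtain L where L: "\<And>z. z \<in> unit_ball \<Longrightarrow> (f k has_derivative L z) (at z)"
        "\<And>z c v. z \<in> unit_ball \<Longrightarrow> L z (c *s v) = c * L z v"
        using f[of k] unfolding holo_fun_on_def by metis
      show ?thesis
      proof (rule differentiable_bound[where f' = L and S = "cball 0 (R i)"])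
        fix z :: "complex ^ 'n" assume z: "z \<in> cball 0 (R i)"
        show "(f k has_derivative L z) (at z within cball 0 (R i))"
          using L(1)[OF ub[OF z]] has_derivative_at_withinI by blast
        have "norm (L z v) \<le> D * norm v" for v
          unfolding D_def using z \<rho>' M L ub[OF z] f by (intro holo_derivative_bound[of "f k"]) auto
        then show "onorm (L z) \<le> D" using D by (intro onorm_le) auto
      qed (use that in auto)
    qed
    obtain g k where k: "strict_mono (k :: nat \<Rightarrow> nat)"
      "\<And>e. 0 < e \<Longrightarrow> \<exists>N. \<forall>n x. n \<ge> N \<and> x \<in> cball 0 (R i) \<longrightarrow> norm (f (s (k n)) x - g x) < e"
    proof (rule Arzela_Ascoli[of "cball 0 (R i)" "\<lambda>k. f (s k)" M])
      show "compact (cball (0 :: complex ^ 'n) (R i))" by simp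
      show "norm (f (s n) x) \<le> M" if "x \<in> cball 0 (R i)" for n x
        using that \<rho>' by (intro M) auto
      show "\<exists>d>0. \<forall>n y. y \<in> cball 0 (R i) \<and> norm (x - y) < d \<longrightarrow> norm (f (s n) x - f (s n) y) < e"
        if x: "x \<in> cball 0 (R i)" and e: "0 < e" for x e
      proof (intro exI[of _ "e / (D + 1)"] conjI allI impI)
        show "0 < e / (D + 1)" using D e by simp
        fix n y assume y: "y \<in> cball 0 (R i) \<and> norm (x - y) < e / (D + 1)"
        have "norm (f (s n) x - f (s n) y) \<le> D * norm (x - y)" using x y by (intro lip) auto
        also have "\<dots> \<le> (D + 1) * norm (x - y)" by (intro mult_right_mono) auto
        also have "\<dots> < e" using y D by (simp add: field_simps)
        finally show "norm (f (s n) x - f (s n) y) < e" .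
      qed
    qed blast
    have "uniform_limit (cball 0 (R i)) (\<lambda>n. f (s (k n))) g sequentially"
      unfolding uniform_limit_iff eventually_sequentially dist_norm using k(2) by metis
    then have "uniformly_Cauchy_on (cball 0 (R i)) (\<lambda>n. f (s (k n)))"
      using uniformly_convergent_Cauchy uniformly_convergent_on_def by blast
    then show ?thesis using k(1) by (auto simp: P_def o_def)
  qed
  have "\<exists>k. strict_mono k \<and> (\<forall>i. P i (f \<circ> k))"
  proof -
    obtain k where "strict_mono (k :: nat \<Rightarrow> nat)" "\<And>i. P i (f \<circ> (id \<circ> k))"
    proof (rule subsequence_diagonalization_lemma[where P = "\<lambda>i s. P i (f \<circ> s)" and r = id])
      show "\<exists>k. strict_mono k \<and> P i (f \<circ> (s \<circ> k))" for i and s :: "nat \<Rightarrow> nat"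
        using sub[of i s] by (simp add: o_def)
      \<comment> \<open>The diagonal argument needs the property to survive passage to a sequence
        that is eventually drawn from the old one in later positions.\<close>
      fix i and s k1 k2 :: "nat \<Rightarrow> nat" and N
      assume P1: "P i (f \<circ> (s \<circ> k1))" and k: "\<And>j. N \<le> j \<Longrightarrow> \<exists>j'\<ge>j. k2 j = k1 j'"
      show "P i (f \<circ> (s \<circ> k2))"
        unfolding P_def uniformly_Cauchy_on_def
      proof (intro allI impI)
        fix e :: real assume "e > 0"
        then obtain M where M: "\<And>x m n. x \<in> cball 0 (R i) \<Longrightarrow> M \<le> m \<Longrightarrow> M \<le> n \<Longrightarrow> dist (f (s (k1 m)) x) (f (s (k1 n)) x) < e"
          using P1 unfolding P_def uniformly_Cauchy_on_def o_def by metis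
        have "dist (f (s (k2 m)) x) (f (s (k2 n)) x) < e" if "x \<in> cball 0 (R i)" "max N M \<le> m" "max N M \<le> n" for x m n
        proof -
          have "N \<le> m" "N \<le> n" using that by auto
          then obtain m' n' where "m' \<ge> m" "k2 m = k1 m'" "n' \<ge> n" "k2 n = k1 n'" using k by meson
          then show ?thesis using M[OF that(1), of m' n'] that by simp
        qed
        then show "\<exists>M. \<forall>x\<in>cball 0 (R i). \<forall>m\<ge>M. \<forall>n\<ge>M. dist ((f \<circ> (s \<circ> k2)) m x) ((f \<circ> (s \<circ> k2)) n x) < e"
          by (intro exI[of _ "max N M"]) (simp add: o_def)
      qed
    qed blast
    then show ?thesis by auto
  qed
  then obtain k where k: "strict_mono k" "\<And>i. P i (f \<circ> k)" by blast
  have Cau: "uniformly_Cauchy_on (cball 0 \<rho>) (\<lambda>n. f (k n))" if "\<rho> < 1" for \<rho>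
  proof -
    obtain i where "1 / (1 - \<rho>) < real i" using reals_Archimedean2 by blast
    then have "\<rho> \<le> R i" using that by (simp add: R_def field_simps)
    then have "cball 0 \<rho> \<subseteq> cball (0 :: complex ^ 'n) (R i)" by auto
    then show ?thesis using k(2)[of i] unfolding P_def uniformly_Cauchy_on_def o_def by (meson subsetD)
  qed
  obtain g where "holo_fun_on unit_ball g" "\<And>\<rho>. \<rho> < 1 \<Longrightarrow> uniform_limit (cball 0 \<rho>) (\<lambda>n. f (k n)) g sequentially"
    using locally_uniform_limit_holo[of "\<lambda>n. f (k n)"] f Cau by blast
  then show ?thesis using that k(1) by blast
qed

section \<open>Necessity\<close>

lemma comp_op_apply: "comp_op \<phi> f = (\<lambda>z. f (\<phi> z))"
  by (simp add: comp_op_def fun_eq_iff)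

context orlicz
begin

text \<open>The bound \<open>pointwise_bound\<close> holds for every constant strictly above the
  Luxemburg norm; the excess \<open>e\<close> then tends to zero.\<close>

lemma norm_le_lux_norm:
  assumes "\<alpha> > -1"
  shows "\<exists>K\<ge>1. \<forall>f\<in>bergman_orlicz \<psi> \<alpha>. \<forall>w\<in>unit_ball. norm (f w) \<le> lux_norm \<psi> \<alpha> f * (K * gauge \<alpha> (w :: complex ^ 'n))"
proof -
  obtain K where K: "1 \<le> K" "\<And>f C w. holo_fun_on unit_ball f \<Longrightarrow> 0 < C \<Longrightarrow> orlicz_mod \<psi> \<alpha> f C \<le> 1 \<Longrightarrow> w \<in> unit_ball \<Longrightarrow>
     norm (f w) \<le> C * (K * gauge \<alpha> (w :: complex ^ 'n))"
    using pointwise_bound[OF assms, where ?'n = 'n] by blast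
  have "norm (f w) \<le> lux_norm \<psi> \<alpha> f * (K * gauge \<alpha> w)" if f: "f \<in> bergman_orlicz \<psi> \<alpha>" and w: "w \<in> unit_ball" for f and w :: "complex ^ 'n"
  proof -
    have "0 < gauge \<alpha> w" using w by (intro gauge_pos) (simp add: unit_ball_def)
    then have G: "0 < K * gauge \<alpha> w" using K(1) by simp
    have "norm (f w) / (K * gauge \<alpha> w) \<le> lux_norm \<psi> \<alpha> f + e" if "0 < e" for e
    proof -
      have "norm (f w) \<le> (lux_norm \<psi> \<alpha> f + e) * (K * gauge \<alpha> w)"
        using lux_norm_nonneg[OF assms f] that w
        by (intro K(2) lux_norm_less[OF assms f] bergman_orliczD(1)[OF assms f]) auto
      then show ?thesis using G by (simp add: field_simps)
    qed
    then have "norm (f w) / (K * gauge \<alpha> w) \<le> lux_norm \<psi> \<alpha> f" by (rule field_le_epsilon)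
    then show ?thesis using G by (simp add: field_simps)
  qed
  then show ?thesis using K(1) by blast
qed

lemma gauge_bounded: "norm (w :: complex ^ 'n) \<le> \<rho> \<Longrightarrow> \<rho> < 1 \<Longrightarrow> -1 < \<alpha> \<Longrightarrow>
    gauge \<alpha> w \<le> \<psi>i ((1 / (1 - \<rho>)) powr (real CARD('n) + \<alpha> + 1))"
proof -
  assume w: "norm w \<le> \<rho>" "\<rho> < 1" "-1 < \<alpha>"
  then have "1 / (1 - norm w) \<le> 1 / (1 - \<rho>)" by (intro divide_left_mono) auto
  then show ?thesis
    unfolding gauge_def using w by (intro inv_mono powr_mono2) auto
qed

text \<open>Superlinearity makes \<open>\<psi>\<close> exceed the identity for large arguments, so
  the gauge grows at most like \<open>(1 - norm a) powr - n1\<close>; the exponent \<open>p\<close>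
  exceeds \<open>n1\<close>. This is why the test functions vanish in the limit.\<close>

lemma gauge_times_power_tendsto_0:
  fixes a :: "nat \<Rightarrow> complex ^ 'n"
  assumes \<alpha>: "\<alpha> > -1" and p: "real CARD('n) + \<alpha> + 1 < real p" and a: "\<And>k. norm (a k) < 1"
    and lim: "(\<lambda>k. 1 - norm (a k)) \<longlonglongrightarrow> 0"
  shows "(\<lambda>k. gauge \<alpha> (a k) * (1 - norm (a k)) ^ p) \<longlonglongrightarrow> 0"
proof -
  define n1 where "n1 = real CARD('n) + \<alpha> + 1"
  define t where "t = (\<lambda>k. 1 - norm (a k))"
  have t: "0 < t k" for k using a by (simp add: t_def)
  obtain x0 where x0: "0 < x0" "\<And>x. x0 \<le> x \<Longrightarrow> 1 * x \<le> \<psi> x" using superlinearD[of 1] by blast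
  have le: "gauge \<alpha> (a k) \<le> x0 + t k powr (- n1)" for k
  proof -
    define y where "y = t k powr (- n1)"
    have y: "0 \<le> y" by (simp add: y_def)
    have "y \<le> \<psi> (x0 + y)" using x0(2)[of "x0 + y"] x0(1) y by simp
    then have "\<psi>i y \<le> x0 + y" using x0(1) y by (subst inv_le_iff) auto
    moreover have "(1 / t k) powr n1 = y" using t[of k] by (simp add: y_def powr_divide powr_minus_divide)
    moreover have "gauge \<alpha> (a k) = \<psi>i ((1 / t k) powr n1)" by (simp add: gauge_def n1_def t_def)
    ultimately show ?thesis by (simp add: y_def)
  qed
  have t0: "t \<longlonglongrightarrow> 0" using lim by (simp add: t_def)
  have "(\<lambda>k. t k powr (real p - n1)) \<longlonglongrightarrow> 0"
  proof (rule tendsto_zero_powrI[OF t0 tendsto_const])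
    show "\<forall>\<^sub>F k in sequentially. 0 \<le> t k" using t by (intro always_eventually allI less_imp_le)
    show "0 < real p - n1" using p by (simp add: n1_def)
  qed
  moreover have "(\<lambda>k. x0 * t k ^ p) \<longlonglongrightarrow> x0 * 0 ^ p" by (intro tendsto_mult tendsto_const tendsto_power t0)
  ultimately have "(\<lambda>k. x0 * t k ^ p + t k powr (real p - n1)) \<longlonglongrightarrow> x0 * 0 ^ p + 0" by (rule tendsto_add[rotated])
  moreover have "0 < p" using p \<alpha> by (intro Nat.gr0I) auto
  ultimately have up: "(\<lambda>k. x0 * t k ^ p + t k powr (real p - n1)) \<longlonglongrightarrow> 0" by (simp add: power_0_left)
  show ?thesis
  proof (rule tendsto_sandwich[OF _ _ tendsto_const up])
    have "gauge \<alpha> (a k) * t k ^ p \<le> x0 * t k ^ p + t k powr (real p - n1)" for k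
    proof -
      have "gauge \<alpha> (a k) * t k ^ p \<le> (x0 + t k powr (- n1)) * t k ^ p"
        using le t[of k] by (intro mult_right_mono) auto
      also have "\<dots> = x0 * t k ^ p + t k powr (real p - n1)"
        using t[of k] by (simp add: algebra_simps powr_diff powr_minus_divide powr_realpow)
      finally show ?thesis .
    qed
    then show "\<forall>\<^sub>F k in sequentially. gauge \<alpha> (a k) * (1 - norm (a k)) ^ p \<le> x0 * t k ^ p + t k powr (real p - n1)"
      by (simp add: t_def)
    show "\<forall>\<^sub>F k in sequentially. 0 \<le> gauge \<alpha> (a k) * (1 - norm (a k)) ^ p"
      using gauge_pos[OF a] a by (auto intro!: always_eventually mult_nonneg_nonneg simp: less_imp_le)
  qed
qed

lemma necessity:
  fixes \<phi> :: "complex ^ 'n \<Rightarrow> complex ^ 'n"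
  assumes \<alpha>: "\<alpha> > -1" and \<phi>: "\<forall>z\<in>unit_ball. \<phi> z \<in> unit_ball" and cmp: "comp_compact \<psi> \<alpha> \<phi>" and \<epsilon>: "0 < \<epsilon>"
  shows "\<exists>r<1. \<forall>z. r < norm z \<and> norm z < 1 \<longrightarrow> gauge \<alpha> (\<phi> z) / gauge \<alpha> z < \<epsilon>"
proof (rule ccontr)
  assume neg: "\<not> ?thesis"
  define n1 where "n1 = real CARD('n) + \<alpha> + 1"
  have n1: "0 < n1" using \<alpha> by (simp add: n1_def)
  have "\<exists>z. 1 - 1 / (real k + 1) < norm z \<and> norm z < 1 \<and> \<epsilon> \<le> gauge \<alpha> (\<phi> z) / gauge \<alpha> z" for k
  proof -
    have "1 - 1 / (real k + 1) < 1" by simp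
    then show ?thesis using neg by (meson not_less)
  qed
  then obtain z where z: "\<And>k. 1 - 1 / (real k + 1) < norm (z k)" "\<And>k. norm (z k) < 1" "\<And>k. \<epsilon> \<le> gauge \<alpha> (\<phi> (z k)) / gauge \<alpha> (z k)"
    by metis
  define a where "a = (\<lambda>k. \<phi> (z k))"
  have a: "norm (a k) < 1" for k using \<phi> z(2) by (auto simp: a_def unit_ball_def)
  have ge: "\<epsilon> * gauge \<alpha> (z k) \<le> gauge \<alpha> (a k)" for k
    using z(3)[of k] gauge_pos[OF z(2), of \<alpha> k] by (simp add: a_def field_simps)
  \<comment> \<open>The test functions tend to zero only if their base points approach the sphere.
    Otherwise \<open>gauge \<alpha> (a k)\<close> would stay bounded along a subsequence while
    \<open>gauge \<alpha> (z k)\<close> tends to infinity, against \<open>ge\<close>.\<close>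
  have lim: "(\<lambda>k. 1 - norm (a k)) \<longlonglongrightarrow> 0"
  proof (rule LIMSEQ_I)
    fix \<tau> :: real assume \<tau>: "0 < \<tau>"
    define \<sigma> where "\<sigma> = min \<tau> (1 / 2)"
    have \<sigma>: "0 < \<sigma>" "\<sigma> \<le> \<tau>" "\<sigma> < 1" using \<tau> by (auto simp: \<sigma>_def)
    \<comment> \<open>Once the gauge at \<open>z k\<close> passes this threshold it exceeds the
      bound for the gauge at \<open>a k\<close> divided by \<open>\<epsilon>\<close>; the summand
      \<open>1\<close> makes the excess strict.\<close>
    define y where "y = max 1 (\<psi> (\<psi>i ((1 / \<sigma>) powr n1) / \<epsilon> + 1))"
    obtain m where m: "y powr (1 / n1) < real m" using reals_Archimedean2 by blast
    have "norm (1 - norm (a k) - 0) < \<tau>" if "m \<le> k" for k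
    proof (rule ccontr)
      assume "\<not> norm (1 - norm (a k) - 0) < \<tau>"
      then have "norm (a k) \<le> 1 - \<sigma>" using a[of k] \<sigma> by simp
      from gauge_bounded[OF this _ \<alpha>] have le: "gauge \<alpha> (a k) \<le> \<psi>i ((1 / \<sigma>) powr n1)"
        using \<sigma> by (simp add: n1_def)
      have "1 - norm (z k) < 1 / (real k + 1)" using z(1)[of k] by simp
      then have "real k + 1 < 1 / (1 - norm (z k))" using z(2)[of k] by (simp add: field_simps)
      then have "y powr (1 / n1) \<le> 1 / (1 - norm (z k))" using m that by linarith
      then have "(y powr (1 / n1)) powr n1 \<le> (1 / (1 - norm (z k))) powr n1" using n1 by (intro powr_mono2) auto
      then have "y \<le> \<psi> (gauge \<alpha> (z k))" using n1 by (simp add: psi_gauge n1_def[symmetric] powr_powr y_def)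
      then have "\<psi> (\<psi>i ((1 / \<sigma>) powr n1) / \<epsilon> + 1) \<le> \<psi> (gauge \<alpha> (z k))" by (simp add: y_def)
      moreover have "0 \<le> \<psi>i ((1 / \<sigma>) powr n1) / \<epsilon>" using inv_nonneg[of "(1 / \<sigma>) powr n1"] \<epsilon> by simp
      ultimately have "\<psi>i ((1 / \<sigma>) powr n1) / \<epsilon> + 1 \<le> gauge \<alpha> (z k)"
        using le_iff[of "\<psi>i ((1 / \<sigma>) powr n1) / \<epsilon> + 1" "gauge \<alpha> (z k)"] gauge_pos[OF z(2), of \<alpha> k] by simp
      then have "\<psi>i ((1 / \<sigma>) powr n1) < \<epsilon> * gauge \<alpha> (z k)" using \<epsilon> by (simp add: field_simps)
      then show False using le ge[of k] by linarith
    qed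
    then show "\<exists>m. \<forall>k\<ge>m. norm (1 - norm (a k) - 0) < \<tau>" by blast
  qed
  obtain p where p: "real CARD('n) + \<alpha> + 1 < real p" using reals_Archimedean2 by blast
  obtain K where K: "K \<ge> 1" "\<And>a. norm (a :: complex ^ 'n) < 1 \<Longrightarrow> orlicz_mod \<psi> \<alpha> (testf \<alpha> p a) K \<le> 1"
    using testf_mod[OF \<alpha> p] by blast
  define f where "f = (\<lambda>k. testf \<alpha> p (a k))"
  have f: "f k \<in> bergman_orlicz \<psi> \<alpha>" for k
    unfolding f_def using K a by (intro bergman_orliczI[of _ K] testf_holo) auto
  have "bounded (range (\<lambda>k. lux_norm \<psi> \<alpha> (f k)))"
  proof (rule boundedI)
    fix x assume "x \<in> range (\<lambda>k. lux_norm \<psi> \<alpha> (f k))"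
    then obtain k where x: "x = lux_norm \<psi> \<alpha> (f k)" by auto
    have "lux_norm \<psi> \<alpha> (f k) \<le> K" unfolding f_def using K a by (intro lux_norm_le) auto
    then show "norm x \<le> K" using lux_norm_nonneg[OF \<alpha> f] by (simp add: x)
  qed
  then obtain r g where r: "strict_mono r" and g: "g \<in> bergman_orlicz \<psi> \<alpha>"
    and conv: "(\<lambda>k. lux_norm \<psi> \<alpha> (\<lambda>z. comp_op \<phi> (f (r k)) z - g z)) \<longlonglongrightarrow> 0"
    using cmp f unfolding comp_compact_def by blast
  have cl: "comp_op \<phi> (f k) \<in> bergman_orlicz \<psi> \<alpha>" for k using cmp f unfolding comp_compact_def by blast
  define d where "d = (\<lambda>k z. comp_op \<phi> (f (r k)) z - g z)"
  have d: "d k \<in> bergman_orlicz \<psi> \<alpha>" for k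
    unfolding d_def using bergman_orlicz_diff[OF \<alpha> cl g] by blast
  obtain K2 where K2: "1 \<le> K2" "\<And>f w. f \<in> bergman_orlicz \<psi> \<alpha> \<Longrightarrow> w \<in> unit_ball \<Longrightarrow> norm (f w) \<le> lux_norm \<psi> \<alpha> f * (K2 * gauge \<alpha> (w :: complex ^ 'n))"
    using norm_le_lux_norm[OF \<alpha>, where ?'n = 'n] by blast
  \<comment> \<open>Norm convergence implies pointwise convergence, and the composed test functions
    tend to zero at every point, so the limit supplied by compactness vanishes on the ball.\<close>
  have g0: "g w = 0" if w: "w \<in> unit_ball" for w
  proof -
    have "(\<lambda>k. lux_norm \<psi> \<alpha> (d k) * (K2 * gauge \<alpha> w)) \<longlonglongrightarrow> 0 * (K2 * gauge \<alpha> w)"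
      using conv unfolding d_def by (intro tendsto_mult tendsto_const)
    then have "(\<lambda>k. lux_norm \<psi> \<alpha> (d k) * (K2 * gauge \<alpha> w)) \<longlonglongrightarrow> 0" by simp
    then have "(\<lambda>k. d k w) \<longlonglongrightarrow> 0"
      by (rule Lim_null_comparison[rotated]) (intro always_eventually allI K2(2)[OF d w])
    moreover have "(\<lambda>k. f (r k) (\<phi> w)) \<longlonglongrightarrow> 0"
    proof (rule Lim_null_comparison)
      define y where "y = \<phi> w"
      have y: "norm y < 1" using \<phi> w by (auto simp: y_def unit_ball_def)
      have "(\<lambda>k. gauge \<alpha> (a (r k)) * (1 - norm (a (r k))) ^ p) \<longlonglongrightarrow> 0"
        using a LIMSEQ_subseq_LIMSEQ[OF lim r] by (intro gauge_times_power_tendsto_0 \<alpha> p) (auto simp: o_def)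
      then show "(\<lambda>k. gauge \<alpha> (a (r k)) * (1 - norm (a (r k))) ^ p / (1 - norm y) ^ p) \<longlonglongrightarrow> 0"
        by (rule tendsto_divide_zero)
      have "norm (f (r k) y) \<le> gauge \<alpha> (a (r k)) * (1 - norm (a (r k))) ^ p / (1 - norm y) ^ p" for k
      proof -
        have "((1 - norm (a (r k))) / norm (1 - cinner y (a (r k)))) ^ p \<le> ((1 - norm (a (r k))) / (1 - norm y)) ^ p"
          using one_minus_cinner(2,3)[OF a[of "r k"] y] a[of "r k"] y by (intro power_mono divide_left_mono mult_pos_pos) auto
        then have "gauge \<alpha> (a (r k)) * ((1 - norm (a (r k))) / norm (1 - cinner y (a (r k)))) ^ p \<le> gauge \<alpha> (a (r k)) * ((1 - norm (a (r k))) / (1 - norm y)) ^ p"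
          using gauge_pos[OF a, of \<alpha> "r k"] by (intro mult_left_mono) auto
        then show ?thesis unfolding f_def norm_testf[OF a] by (simp add: power_divide)
      qed
      then show "\<forall>\<^sub>F k in sequentially. norm (f (r k) (\<phi> w)) \<le> gauge \<alpha> (a (r k)) * (1 - norm (a (r k))) ^ p / (1 - norm y) ^ p"
        by (simp add: y_def)
    qed
    ultimately have "(\<lambda>k. f (r k) (\<phi> w) - d k w) \<longlonglongrightarrow> 0 - 0" by (intro tendsto_diff)
    then show ?thesis by (simp add: d_def comp_op_apply LIMSEQ_const_iff)
  qed
  have "\<epsilon> / (2 ^ p * K2) \<le> lux_norm \<psi> \<alpha> (d k)" for k
  proof -
    define w where "w = z (r k)"
    have w: "w \<in> unit_ball" "norm w < 1" using z(2) by (auto simp: w_def unit_ball_def)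
    define b where "b = a (r k)"
    have b: "norm b < 1" "\<phi> w = b" using a by (auto simp: b_def w_def a_def)
    have "1 - cinner b b = of_real (1 - (norm b)\<^sup>2)" by (simp add: cinner_self)
    then have nb: "norm (1 - cinner b b) = 1 - (norm b)\<^sup>2"
      using one_minus_norm_sq[OF b(1)] by (simp only: norm_of_real)
    \<comment> \<open>At its own base point the test function is still comparable to the gauge,
      because \<open>1 - norm b ^ 2\<close> is at most \<open>2 * (1 - norm b)\<close>.\<close>
    have "(1 / 2) ^ p \<le> ((1 - norm b) / norm (1 - cinner b b)) ^ p"
      unfolding nb using one_minus_norm_sq[OF b(1)] by (intro power_mono) (auto simp: field_simps)
    then have "gauge \<alpha> b * (1 / 2) ^ p \<le> norm (f (r k) b)"
      unfolding f_def b_def[symmetric] norm_testf[OF b(1)] using gauge_pos[OF b(1), of \<alpha>] by (intro mult_left_mono) auto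
    moreover have "norm (f (r k) b) \<le> lux_norm \<psi> \<alpha> (d k) * (K2 * gauge \<alpha> w)"
      using K2(2)[OF d w(1), of k] g0[OF w(1)] b by (simp add: d_def comp_op_apply)
    moreover have "\<epsilon> * gauge \<alpha> w * (1 / 2) ^ p \<le> gauge \<alpha> b * (1 / 2) ^ p"
      using ge[of "r k"] by (intro mult_right_mono) (auto simp: w_def b_def)
    ultimately have "\<epsilon> * gauge \<alpha> w * (1 / 2) ^ p \<le> lux_norm \<psi> \<alpha> (d k) * (K2 * gauge \<alpha> w)" by linarith
    then show ?thesis
      using gauge_pos[OF w(2), of \<alpha>] K2(1) by (simp add: field_simps power_divide)
  qed
  then have "\<epsilon> / (2 ^ p * K2) \<le> 0"
    using conv unfolding d_def by (intro tendsto_lowerbound[OF conv]) auto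
  then show False using \<epsilon> K2(1) by (simp add: field_simps)
qed

end

section \<open>Sufficiency\<close>

context orlicz
begin

lemma measurable_boundary_part:
  fixes \<phi> :: "complex ^ 'n \<Rightarrow> complex ^ 'n" and g :: "complex ^ 'n \<Rightarrow> complex"
  assumes \<phi>: "continuous_on unit_ball \<phi>" and g: "continuous_on unit_ball (\<lambda>z. g (\<phi> z))" and B: "0 \<le> B"
  shows "boundary_part \<phi> \<delta> x B g \<in> borel_measurable borel"
proof -
  define \<phi>0 where "\<phi>0 = (\<lambda>z. indicator unit_ball z *\<^sub>R \<phi> z)"
  have [measurable]: "\<phi>0 \<in> borel_measurable borel"
    unfolding \<phi>0_def using \<phi> by (intro borel_measurable_continuous_on_indicator) auto
  define h where "h = (\<lambda>z. indicator unit_ball z *\<^sub>R g (\<phi> z))"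
  have [measurable]: "h \<in> borel_measurable borel"
    unfolding h_def by (rule measurable_on_unit_ball[OF g])
  define S where "S = {z \<in> unit_ball. 1 - \<delta> < norm (\<phi>0 z) \<and> x \<le> norm (h z)}"
  have [measurable]: "S \<in> sets borel" unfolding S_def by measurable
  have "boundary_part \<phi> \<delta> x B g = (\<lambda>z. indicator S z * ennreal (\<psi>p (B * norm (h z))))"
    using B by (auto simp: fun_eq_iff indicator_def h_def \<phi>0_def S_def p_eq)
  also have "\<dots> \<in> borel_measurable borel" by measurable
  finally show ?thesis .
qed

lemma sufficiency:
  fixes \<phi> :: "complex ^ 'n \<Rightarrow> complex ^ 'n"
  assumes \<alpha>: "\<alpha> > -1" and \<beta>: "-1 < \<beta>" "\<beta> < \<alpha>"
    and \<phi>: "holo_map_on unit_ball \<phi>" "\<forall>z\<in>unit_ball. \<phi> z \<in> unit_ball" and bdd: "comp_bounded \<psi> \<beta> \<phi>"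
    and nab: "nabla0 \<psi>"
    and lim: "\<And>\<epsilon>. \<epsilon> > 0 \<Longrightarrow> \<exists>r<1. \<forall>z. r < norm z \<and> norm z < 1 \<longrightarrow> gauge \<alpha> (\<phi> z) / gauge \<alpha> z < \<epsilon>"
  shows "comp_compact \<psi> \<alpha> \<phi>"
proof -
  interpret finite_measure "dv \<alpha> :: (complex ^ 'n) measure" by (rule finite_measure_dv[OF \<alpha>])
  have cont: "continuous_on unit_ball \<phi>" by (rule holo_map_on_continuous[OF \<phi>(1)])
  have comp: "holo_fun_on unit_ball (\<lambda>z. g (\<phi> z))" if "holo_fun_on unit_ball g" for g
    using that \<phi> by (rule comp_op_holo)
  have ub: "z \<in> unit_ball \<longleftrightarrow> norm z < 1" for z :: "complex ^ 'n" by (simp add: unit_ball_def)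
  have estimate: "\<exists>\<delta> x0. 0 < \<delta> \<and> \<delta> < 1 \<and> 0 < x0 \<and> (\<forall>g. holo_fun_on unit_ball g \<longrightarrow> orlicz_mod \<psi> \<alpha> g 1 \<le> 1 \<longrightarrow>
    (\<integral>\<^sup>+z. boundary_part \<phi> \<delta> x0 B0 g z \<partial>dv \<alpha>) \<le> ennreal (1 / 2))"
    if "1 < B0" for B0
    using boundary_estimate[OF \<alpha> \<beta> \<phi> bdd nab that lim] .
  \<comment> \<open>That the operator acts on the space of weight \<open>\<alpha>\<close> also
    follows from the boundary estimate; any factor above one would serve in place of
    \<open>2\<close>.\<close>
  have closed: "comp_op \<phi> f \<in> bergman_orlicz \<psi> \<alpha>" if f: "f \<in> bergman_orlicz \<psi> \<alpha>" for f
  proof -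
    note fD = bergman_orliczD[OF \<alpha> f]
    obtain C where C: "C > 0" "orlicz_mod \<psi> \<alpha> f C \<le> 1" using fD(2) by blast
    define g where "g = (\<lambda>z. complex_of_real (1 / C) * f z)"
    have g: "holo_fun_on unit_ball g" unfolding g_def by (rule holo_fun_on_cmult[OF fD(1)])
    have ng: "norm (g z) = 1 / C * norm (f z)" for z using C(1) by (simp add: g_def norm_mult norm_divide)
    have g1: "orlicz_mod \<psi> \<alpha> g 1 \<le> 1" using C(2) by (simp add: orlicz_mod_def ng)
    obtain \<delta> x0 where \<delta>: "0 < \<delta>" "\<delta> < 1" "0 < x0"
      and est: "(\<integral>\<^sup>+z. boundary_part \<phi> \<delta> x0 2 g z \<partial>dv \<alpha>) \<le> ennreal (1 / 2)"
      using estimate[of 2] g g1 by fastforce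
    have "cball 0 (1 - \<delta>) \<subseteq> (unit_ball :: (complex ^ 'n) set)" using \<delta> by (auto simp: unit_ball_def)
    then have "compact (g ` cball 0 (1 - \<delta>))"
      by (intro compact_continuous_image continuous_on_subset[OF holo_fun_onD_continuous[OF g]] compact_cball)
    from compact_imp_bounded[OF this] obtain M where M': "\<And>x. x \<in> g ` cball 0 (1 - \<delta>) \<Longrightarrow> norm x \<le> M"
      unfolding bounded_iff by (elim exE) blast
    have M: "norm (g y) \<le> M" if "norm y \<le> 1 - \<delta>" for y using that by (intro M' imageI) simp
    \<comment> \<open>Off the boundary part, either \<open>\<phi> z\<close> lies in a compact ball,
      where \<open>g\<close> is bounded by \<open>M\<close>, or the value of \<open>g\<close> is
      below \<open>x0\<close>.\<close>
    define X where "X = \<psi> (2 * max x0 M)"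
    have "orlicz_mod \<psi> \<alpha> (comp_op \<phi> f) C
      \<le> (\<integral>\<^sup>+z. ennreal X + boundary_part \<phi> \<delta> x0 2 g z \<partial>dv \<alpha>)"
      unfolding orlicz_mod_eq[OF \<alpha>]
    proof (intro nn_integral_mono)
      fix z
      show "indicator unit_ball z * ennreal (\<psi> (1 / C * norm (comp_op \<phi> f z)))
        \<le> ennreal X + boundary_part \<phi> \<delta> x0 2 g z"
      proof (cases "z \<in> unit_ball")
        case True
        have *: "ennreal (\<psi> (1 / C * norm (comp_op \<phi> f z))) \<le> ennreal (\<psi> (2 * norm (g (\<phi> z))))"
        proof -
          have "1 / C * norm (comp_op \<phi> f z) = norm (g (\<phi> z))" by (simp add: comp_op_apply ng)
          then show ?thesis by (auto intro!: ennreal_leI mono)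
        qed
        show ?thesis
        proof (cases "1 - \<delta> < norm (\<phi> z) \<and> x0 \<le> norm (g (\<phi> z))")
          case False
          then have "norm (g (\<phi> z)) \<le> max x0 M" using M[of "\<phi> z"] by auto
          then have "\<psi> (2 * norm (g (\<phi> z))) \<le> X" unfolding X_def by (intro mono) auto
          then show ?thesis using * True False by (auto intro: order_trans ennreal_leI)
        qed (use True * in \<open>auto intro: order_trans add_increasing\<close>)
      qed simp
    qed
    also have "\<dots> = (\<integral>\<^sup>+z. ennreal X \<partial>(dv \<alpha> :: (complex ^ 'n) measure)) + (\<integral>\<^sup>+z. boundary_part \<phi> \<delta> x0 2 g z \<partial>dv \<alpha>)"
      using measurable_boundary_part[OF cont holo_fun_onD_continuous[OF comp[OF g]], of 2]
      by (intro nn_integral_add) auto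
    also have "\<dots> \<le> ennreal X * emeasure (dv \<alpha>) (UNIV :: (complex ^ 'n) set) + ennreal (1 / 2)"
      using est by (intro add_mono) auto
    also have "\<dots> < \<infinity>"
    proof -
      have "ennreal X * emeasure (dv \<alpha>) (UNIV :: (complex ^ 'n) set) \<noteq> \<infinity>"
        by (simp add: emeasure_eq_measure ennreal_mult_eq_top_iff)
      then show ?thesis
        by (metis ennreal_add_eq_top ennreal_neq_top infinity_ennreal_def top.not_eq_extremum)
    qed
    finally show ?thesis
      using comp[OF fD(1)] C(1) by (auto simp: bergman_orlicz_def comp_op_apply)
  qed
  \<comment> \<open>The boundary part contributes at most \<open>1 / 2\<close> uniformly in
    \<open>k\<close>, and the rest tends to zero. As \<open>B0\<close> is arbitrary, this bounds the
    Luxemburg norms by arbitrarily small \<open>1 / B0\<close>.\<close>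
  have vanish: "\<forall>\<^sub>F k in sequentially. orlicz_mod \<psi> \<alpha> (\<lambda>z. g k (\<phi> z)) (1 / B0) \<le> 1"
    if g: "\<And>k. holo_fun_on unit_ball (g k)" "\<And>k. orlicz_mod \<psi> \<alpha> (g k) 1 \<le> 1"
      and ul: "\<And>\<rho>. \<rho> < 1 \<Longrightarrow> uniform_limit (cball 0 \<rho>) g (\<lambda>_. 0) sequentially" and B0: "1 < B0" for g B0
  proof -
    obtain \<delta> x0 where \<delta>: "0 < \<delta>" "\<delta> < 1" "0 < x0"
      and est: "\<And>k. (\<integral>\<^sup>+z. boundary_part \<phi> \<delta> x0 B0 (g k) z \<partial>dv \<alpha>) \<le> ennreal (1 / 2)"
      using estimate[OF B0] g by blast
    define h where "h = (\<lambda>k z. indicator unit_ball z *\<^sub>R g k (\<phi> z))"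
    have hm [measurable]: "h k \<in> borel_measurable borel" for k
      unfolding h_def by (rule measurable_on_unit_ball[OF holo_fun_onD_continuous[OF comp[OF g(1)]]])
    \<comment> \<open>Truncation at \<open>x0\<close> gives a constant majorant for dominated
      convergence; larger values are left to the boundary part.\<close>
    define u where "u = (\<lambda>k z. ennreal (\<psi>p (B0 * min (norm (h k z)) x0)))"
    have um [measurable]: "u k \<in> borel_measurable (dv \<alpha>)" for k unfolding u_def by measurable
    have h0: "(\<lambda>k. norm (h k z)) \<longlonglongrightarrow> 0" for z
    proof (cases "z \<in> unit_ball")
      case True
      then have "norm (\<phi> z) < 1" using \<phi>(2) ub by blast
      then have "(\<lambda>k. g k (\<phi> z)) \<longlonglongrightarrow> 0" using tendsto_uniform_limitI[OF ul, of "norm (\<phi> z)" "\<phi> z"] by simp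
      then show ?thesis using True by (simp add: h_def tendsto_norm_zero)
    qed (simp add: h_def)
    have u0: "(\<lambda>k. u k z) \<longlonglongrightarrow> 0" for z
    proof -
      have "(\<lambda>k. B0 * min (norm (h k z)) x0) \<longlonglongrightarrow> B0 * min 0 x0"
        by (intro tendsto_mult tendsto_min tendsto_const h0)
      then have "(\<lambda>k. \<psi>p (B0 * min (norm (h k z)) x0)) \<longlonglongrightarrow> \<psi>p (B0 * min 0 x0)"
        using continuous_on_tendsto_compose[OF continuous_p[of UNIV]] by auto
      then show ?thesis using tendsto_ennrealI[of _ "\<psi>p (B0 * min 0 x0)"] \<delta>(3) by (simp add: u_def p_eq)
    qed
    have "(\<lambda>k. \<integral>\<^sup>+z. u k z \<partial>dv \<alpha>) \<longlonglongrightarrow> (\<integral>\<^sup>+z. 0 \<partial>(dv \<alpha> :: (complex ^ 'n) measure))"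
    proof (rule nn_integral_dominated_convergence[where w = "\<lambda>_. ennreal (\<psi> (B0 * x0))"])
      show "AE z in dv \<alpha>. u k z \<le> ennreal (\<psi> (B0 * x0))" for k
      proof (intro always_eventually allI)
        fix z
        have "0 \<le> B0 * min (norm (h k z)) x0" "B0 * min (norm (h k z)) x0 \<le> B0 * x0"
          using B0 \<delta>(3) by auto
        then show "u k z \<le> ennreal (\<psi> (B0 * x0))"
          unfolding u_def by (intro ennreal_leI) (simp add: p_eq mono)
      qed
      show "(\<integral>\<^sup>+z. ennreal (\<psi> (B0 * x0)) \<partial>(dv \<alpha> :: (complex ^ 'n) measure)) < \<infinity>"
        by (simp add: emeasure_eq_measure ennreal_mult_less_top)
    qed (use u0 in auto)
    moreover have "(\<integral>\<^sup>+z. 0 \<partial>(dv \<alpha> :: (complex ^ 'n) measure)) < ennreal (1 / 2)"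
      unfolding nn_integral_const mult_zero_left by (rule ennreal_less_zero_iff[THEN iffD2]) simp
    ultimately have "\<forall>\<^sub>F k in sequentially. (\<integral>\<^sup>+z. u k z \<partial>dv \<alpha>) < ennreal (1 / 2)"
      by (rule order_tendstoD(2))
    \<comment> \<open>For such \<open>k\<close> a value of at least \<open>x0\<close> can only occur
      where \<open>norm (\<phi> z) > 1 - \<delta>\<close>, that is, inside the boundary
      part.\<close>
    moreover have "\<forall>\<^sub>F k in sequentially. \<forall>y\<in>cball 0 (1 - \<delta>). dist (g k y) 0 < x0"
      using ul[of "1 - \<delta>"] \<delta> by (simp add: uniform_limit_iff)
    ultimately show ?thesis
    proof eventually_elim
      fix k assume k: "(\<integral>\<^sup>+z. u k z \<partial>dv \<alpha>) < ennreal (1 / 2)" "\<forall>y\<in>cball 0 (1 - \<delta>). dist (g k y) 0 < x0"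
      have "orlicz_mod \<psi> \<alpha> (\<lambda>z. g k (\<phi> z)) (1 / B0)
        \<le> (\<integral>\<^sup>+z. u k z + boundary_part \<phi> \<delta> x0 B0 (g k) z \<partial>dv \<alpha>)"
        unfolding orlicz_mod_eq[OF \<alpha>]
      proof (intro nn_integral_mono)
        fix z
        show "indicator unit_ball z * ennreal (\<psi> (1 / (1 / B0) * norm (g k (\<phi> z))))
          \<le> u k z + boundary_part \<phi> \<delta> x0 B0 (g k) z"
        proof (cases "z \<in> unit_ball")
          case True
          show ?thesis
          proof (cases "x0 \<le> norm (g k (\<phi> z))")
            case big: True
            then have "1 - \<delta> < norm (\<phi> z)" using k(2)[rule_format, of "\<phi> z"] by (auto simp: not_less[symmetric])
            then show ?thesis using True big by (auto intro: add_increasing)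
          next
            case False
            then have "min (norm (h k z)) x0 = norm (g k (\<phi> z))" using True by (simp add: h_def)
            then have "u k z = ennreal (\<psi> (B0 * norm (g k (\<phi> z))))" using B0 by (simp add: u_def p_eq)
            then show ?thesis using True False by simp
          qed
        qed simp
      qed
      also have "\<dots> = (\<integral>\<^sup>+z. u k z \<partial>dv \<alpha>) + (\<integral>\<^sup>+z. boundary_part \<phi> \<delta> x0 B0 (g k) z \<partial>dv \<alpha>)"
        using measurable_boundary_part[OF cont holo_fun_onD_continuous[OF comp[OF g(1)[of k]]], of B0] B0 um
        by (intro nn_integral_add) auto
      also have "\<dots> \<le> ennreal (1 / 2) + ennreal (1 / 2)"
        using k(1) est by (intro add_mono) auto
      also have "\<dots> = 1" by (subst ennreal_plus[symmetric]) simp_all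
      finally show "orlicz_mod \<psi> \<alpha> (\<lambda>z. g k (\<phi> z)) (1 / B0) \<le> 1" .
    qed
  qed
  have "\<exists>r g. strict_mono r \<and> g \<in> bergman_orlicz \<psi> \<alpha> \<and> (\<lambda>k. lux_norm \<psi> \<alpha> (\<lambda>z. comp_op \<phi> (fs (r k)) z - g z)) \<longlonglongrightarrow> 0"
    if fs: "\<forall>k. fs k \<in> bergman_orlicz \<psi> \<alpha>" and bd: "bounded (range (\<lambda>k. lux_norm \<psi> \<alpha> (fs k)))" for fs :: "nat \<Rightarrow> complex ^ 'n \<Rightarrow> complex"
  proof -
    have fsD: "holo_fun_on unit_ball (fs k)" for k using bergman_orliczD(1)[OF \<alpha>] fs by blast
    obtain M where M: "\<And>k. \<bar>lux_norm \<psi> \<alpha> (fs k)\<bar> \<le> M" using bd unfolding bounded_iff by auto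
    define M1 where "M1 = \<bar>M\<bar> + 1"
    have M1: "0 < M1" by (simp add: M1_def)
    have mod: "orlicz_mod \<psi> \<alpha> (fs k) M1 \<le> 1" for k
      using M[of k] fs by (intro lux_norm_less[OF \<alpha>]) (auto simp: M1_def)
    obtain K where K: "1 \<le> K" "\<And>f C w. holo_fun_on unit_ball f \<Longrightarrow> 0 < C \<Longrightarrow> orlicz_mod \<psi> \<alpha> f C \<le> 1 \<Longrightarrow> w \<in> unit_ball \<Longrightarrow>
       norm (f w) \<le> C * (K * gauge \<alpha> (w :: complex ^ 'n))"
      using pointwise_bound[OF \<alpha>, where ?'n = 'n] by blast
    have lb: "\<exists>B. \<forall>k z. norm z \<le> \<rho> \<longrightarrow> norm (fs k z) \<le> B" if \<rho>: "\<rho> < 1" for \<rho>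
    proof (intro exI allI impI)
      fix k z assume z: "norm (z :: complex ^ 'n) \<le> \<rho>"
      have "norm (fs k z) \<le> M1 * (K * gauge \<alpha> z)"
        using z \<rho> by (intro K(2) fsD M1 mod) (auto simp: ub)
      also have "\<dots> \<le> M1 * (K * \<psi>i ((1 / (1 - \<rho>)) powr (real CARD('n) + \<alpha> + 1)))"
        using M1 K(1) gauge_bounded[OF z \<rho> \<alpha>] by (intro mult_left_mono) auto
      finally show "norm (fs k z) \<le> M1 * (K * \<psi>i ((1 / (1 - \<rho>)) powr (real CARD('n) + \<alpha> + 1)))" .
    qed
    obtain r f where r: "strict_mono r" and f: "holo_fun_on unit_ball f"
      and ul: "\<And>\<rho>. \<rho> < 1 \<Longrightarrow> uniform_limit (cball 0 \<rho>) (\<lambda>k. fs (r k)) f sequentially"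
      using montel_unit_ball[OF fsD lb] by blast
    \<comment> \<open>Fatou's lemma: the locally uniform limit inherits the modular bound and hence
      belongs to the space.\<close>
    have modf: "orlicz_mod \<psi> \<alpha> f M1 \<le> 1"
    proof -
      define v where "v = (\<lambda>k z. indicator unit_ball z * ennreal (\<psi> (1 / M1 * norm (fs (r k) z))))"
      have [measurable]: "v k \<in> borel_measurable (dv \<alpha>)" for k
        unfolding v_def using M1 measurable_modulus[OF holo_fun_onD_continuous[OF fsD], of "1 / M1" "r k"] by simp
      have "indicator unit_ball z * ennreal (\<psi> (1 / M1 * norm (f z))) \<le> liminf (\<lambda>k. v k z)" for z
      proof (cases "z \<in> unit_ball")
        case True
        then have "(\<lambda>k. fs (r k) z) \<longlonglongrightarrow> f z" using tendsto_uniform_limitI[OF ul, of "norm z" z] by (simp add: ub)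
        then have "(\<lambda>k. 1 / M1 * norm (fs (r k) z)) \<longlonglongrightarrow> 1 / M1 * norm (f z)"
          by (intro tendsto_mult tendsto_const tendsto_norm)
        then have "(\<lambda>k. \<psi>p (1 / M1 * norm (fs (r k) z))) \<longlonglongrightarrow> \<psi>p (1 / M1 * norm (f z))"
          using continuous_on_tendsto_compose[OF continuous_p[of UNIV]] by auto
        then have "(\<lambda>k. ennreal (\<psi>p (1 / M1 * norm (fs (r k) z)))) \<longlonglongrightarrow> ennreal (\<psi>p (1 / M1 * norm (f z)))"
          by (rule tendsto_ennrealI)
        then have "(\<lambda>k. v k z) \<longlonglongrightarrow> ennreal (\<psi> (1 / M1 * norm (f z)))"
          using M1 True by (simp add: v_def p_eq)
        then show ?thesis using True by (simp add: lim_imp_Liminf)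
      qed simp
      then have "orlicz_mod \<psi> \<alpha> f M1 \<le> (\<integral>\<^sup>+z. liminf (\<lambda>k. v k z) \<partial>dv \<alpha>)"
        unfolding orlicz_mod_eq[OF \<alpha>] by (intro nn_integral_mono) auto
      also have "\<dots> \<le> liminf (\<lambda>k. \<integral>\<^sup>+z. v k z \<partial>dv \<alpha>)" by (rule nn_integral_liminf) measurable
      also have "\<dots> = liminf (\<lambda>k. orlicz_mod \<psi> \<alpha> (fs (r k)) M1)" by (simp add: orlicz_mod_eq[OF \<alpha>] v_def)
      also have "\<dots> \<le> 1" using mod by (intro Liminf_le) auto
      finally show ?thesis .
    qed
    have fA: "f \<in> bergman_orlicz \<psi> \<alpha>" using f M1 modf by (rule bergman_orliczI)
    \<comment> \<open>One factor \<open>2\<close> comes from \<open>orlicz_mod_diff\<close>, which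
      leaves a modular of at most \<open>2\<close>; the other scales this down to
      \<open>1\<close>.\<close>
    define D where "D = 2 * (2 * M1)"
    have D: "0 < D" using M1 by (simp add: D_def)
    define g where "g = (\<lambda>k z. complex_of_real (1 / D) * (fs (r k) z - f z))"
    have g1: "holo_fun_on unit_ball (g k)" for k
      unfolding g_def by (intro holo_fun_on_cmult holo_fun_on_diff fsD f)
    have ng: "norm (g k z) = 1 / D * norm (fs (r k) z - f z)" for k z
      using D by (simp add: g_def norm_mult norm_divide)
    have g2: "orlicz_mod \<psi> \<alpha> (g k) 1 \<le> 1" for k
    proof -
      have c: "continuous_on unit_ball (\<lambda>z. fs (r k) z - f z)"
        by (intro continuous_on_diff holo_fun_onD_continuous fsD f)
      have "orlicz_mod \<psi> \<alpha> (g k) 1 = orlicz_mod \<psi> \<alpha> (\<lambda>z. fs (r k) z - f z) D"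
        by (simp add: orlicz_mod_def ng)
      also have "\<dots> \<le> ennreal (1 / 2) * orlicz_mod \<psi> \<alpha> (\<lambda>z. fs (r k) z - f z) (2 * M1)"
        unfolding D_def using M1 by (intro orlicz_mod_scale \<alpha> c) auto
      also have "\<dots> \<le> ennreal (1 / 2) * (orlicz_mod \<psi> \<alpha> (fs (r k)) M1 + orlicz_mod \<psi> \<alpha> f M1)"
        by (intro mult_left_mono orlicz_mod_diff \<alpha> holo_fun_onD_continuous fsD f M1) auto
      also have "\<dots> \<le> ennreal (1 / 2) * (1 + 1)"
        using mod modf by (intro mult_left_mono add_mono) auto
      also have "\<dots> = ennreal (1 / 2) * ennreal 2" by (simp only: one_add_one ennreal_numeral)
      also have "\<dots> = 1" by (subst ennreal_mult[symmetric]) auto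
      finally show ?thesis .
    qed
    have g3: "uniform_limit (cball 0 \<rho>) g (\<lambda>_. 0) sequentially" if \<rho>: "\<rho> < 1" for \<rho>
      unfolding uniform_limit_iff
    proof (intro allI impI)
      fix e :: real assume e: "0 < e"
      then have "\<forall>\<^sub>F k in sequentially. \<forall>z\<in>cball 0 \<rho>. dist (fs (r k) z) (f z) < e * D"
        using ul[OF \<rho>] D unfolding uniform_limit_iff by simp
      then show "\<forall>\<^sub>F k in sequentially. \<forall>z\<in>cball 0 \<rho>. dist (g k z) 0 < e"
        by eventually_elim (use D in \<open>auto simp: dist_norm ng field_simps\<close>)
    qed
    define G where "G = comp_op \<phi> f"
    have GA: "G \<in> bergman_orlicz \<psi> \<alpha>" unfolding G_def by (rule closed[OF fA])
    have dA: "(\<lambda>z. comp_op \<phi> (fs (r k)) z - G z) \<in> bergman_orlicz \<psi> \<alpha>" for k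
      using bergman_orlicz_diff[OF \<alpha> closed GA] fs by blast
    have "(\<lambda>k. lux_norm \<psi> \<alpha> (\<lambda>z. comp_op \<phi> (fs (r k)) z - G z)) \<longlonglongrightarrow> 0"
    proof (rule tendstoI)
      fix e :: real assume e: "0 < e"
      \<comment> \<open>Dividing the original difference by \<open>e / 2\<close> is the same as
        multiplying the normalized one by \<open>2 * D / e\<close>; the maximum ensures a factor
        above one.\<close>
      define B0 where "B0 = max 2 (2 * D / e)"
      have B0: "1 < B0" "2 * D / e \<le> B0" by (auto simp: B0_def)
      have "\<forall>\<^sub>F k in sequentially. orlicz_mod \<psi> \<alpha> (\<lambda>z. g k (\<phi> z)) (1 / B0) \<le> 1"
        by (rule vanish[OF g1 g2 g3 B0(1)])
      then show "\<forall>\<^sub>F k in sequentially. dist (lux_norm \<psi> \<alpha> (\<lambda>z. comp_op \<phi> (fs (r k)) z - G z)) 0 < e"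
      proof eventually_elim
        case (elim k)
        have "orlicz_mod \<psi> \<alpha> (\<lambda>z. comp_op \<phi> (fs (r k)) z - G z) (e / 2) \<le> orlicz_mod \<psi> \<alpha> (\<lambda>z. g k (\<phi> z)) (1 / B0)"
          unfolding orlicz_mod_def
        proof (intro nn_integral_mono ennreal_leI mono)
          fix z
          have "norm (comp_op \<phi> (fs (r k)) z - G z) / (e / 2) = (2 * D / e) * norm (g k (\<phi> z))"
            using D by (simp add: ng G_def comp_op_apply)
          also have "\<dots> \<le> B0 * norm (g k (\<phi> z))" by (intro mult_right_mono B0) auto
          finally show "norm (comp_op \<phi> (fs (r k)) z - G z) / (e / 2) \<le> norm (g k (\<phi> z)) / (1 / B0)" by (simp add: mult.commute)
        qed (use e in auto)
        then have "lux_norm \<psi> \<alpha> (\<lambda>z. comp_op \<phi> (fs (r k)) z - G z) \<le> e / 2"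
          using elim e by (intro lux_norm_le) auto
        then show ?case using lux_norm_nonneg[OF \<alpha> dA, of k] e by simp
      qed
    qed
    then show ?thesis using r GA by blast
  qed
  then show ?thesis unfolding comp_compact_def using closed by blast
qed

end

theorem theorem3p11:
  fixes \<phi> :: "complex ^ 'n \<Rightarrow> complex ^ 'n"
    and \<psi> :: "real \<Rightarrow> real"
    and \<alpha> \<beta> :: real
  assumes "\<alpha> > -1"
    and "holo_map_on unit_ball \<phi>"
    and "\<forall>z\<in>unit_ball. \<phi> z \<in> unit_ball"
    and "orlicz_fun \<psi>"
    and "nabla0 \<psi>"
    and "-1 < \<beta>" and "\<beta> < \<alpha>"
    and "comp_bounded \<psi> \<beta> \<phi>"
  shows "comp_compact \<psi> \<alpha> \<phi> \<longleftrightarrow>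
    (\<forall>\<epsilon>>0. \<exists>r<1. \<forall>z. r < norm z \<and> norm z < 1 \<longrightarrow>
       \<bar>orlicz_inv \<psi> ((1 / (1 - norm (\<phi> z))) powr (real CARD('n) + \<alpha> + 1))
        / orlicz_inv \<psi> ((1 / (1 - norm z)) powr (real CARD('n) + \<alpha> + 1))\<bar> < \<epsilon>)"
proof -
  interpret orlicz \<psi> by unfold_locales fact
  have abs: "\<bar>orlicz_inv \<psi> ((1 / (1 - norm (\<phi> z))) powr (real CARD('n) + \<alpha> + 1))
        / orlicz_inv \<psi> ((1 / (1 - norm z)) powr (real CARD('n) + \<alpha> + 1))\<bar> = gauge \<alpha> (\<phi> z) / gauge \<alpha> z" for z
    by (simp add: gauge_def inv_nonneg)
  show ?thesis
    unfolding abs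
  proof
    assume "comp_compact \<psi> \<alpha> \<phi>"
    then show "\<forall>\<epsilon>>0. \<exists>r<1. \<forall>z. r < norm z \<and> norm z < 1 \<longrightarrow> gauge \<alpha> (\<phi> z) / gauge \<alpha> z < \<epsilon>"
      using necessity[OF assms(1,3)] by blast
  next
    assume "\<forall>\<epsilon>>0. \<exists>r<1. \<forall>z. r < norm z \<and> norm z < 1 \<longrightarrow> gauge \<alpha> (\<phi> z) / gauge \<alpha> z < \<epsilon>"
    then show "comp_compact \<psi> \<alpha> \<phi>"
      using sufficiency[OF assms(1,6,7,2,3,8,5)] by blast
  qed
qed

end
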